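(* Let $\mathbb{K}\in\{\mathbb{R},\mathbb{C}\}$ and let $\mathcal{H}$ be a graded connected Hopf algebra over $\mathbb{K}$. For any commutative locally convex algebra $B$ over $\mathbb{K}$, the group $G(\mathcal{H},B)$ of $B$-valued characters of $\mathcal{H}$ is a $\mathbb{K}$-analytic Lie group. Furthermore: (i) The Lie algebra $\mathbf{L}(G(\mathcal{H},B))$ of $G(\mathcal{H},B)$ is the Lie algebra $\mathfrak{g}(\mathcal{H},B)$ of infinitesimal characters with the commutator bracket $[\phi,\psi]=\phi\star\psi-\psi\star\phi$. (ii) $G(\mathcal{H},B)$ is a BCH--Lie group which is exponential, i.e. the exponential map is a global $\mathbb{K}$-analytic diffeomorphism, and it is given by the exponential series. (iii) The model space of $G(\mathcal{H},B)$ is a Fréchet space whenever $\mathcal{H}$ is of countable dimension and $B$ is a Fréchet space. In the special case that $B$ is a weakly complete algebra, the modelling space $\mathfrak{g}(\mathcal{H},B)$ is weakly complete as well.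
   Context: Algebras are unital associative $\mathbb{K}$-algebras. A locally convex space is a Hausdorff locally convex topological $\mathbb{K}$-vector space. A locally convex algebra is an algebra with a locally convex vector space topology for which multiplication $B\times B\to B$ is continuous. A locally convex space is weakly complete if it is topologically isomorphic to $\mathbb{K}^I$ (product topology) for some set $I$; a weakly complete algebra is a locally convex algebra whose underlying space is weakly complete. Graded connected Hopf algebra: a Hopf algebra $\mathcal{H}$ with a decomposition $\mathcal{H}=\bigoplus_{n\in\mathbb{N}_0}\mathcal{H}_n$ such that $1_{\mathcal{H}}\in\mathcal{H}_0$, $\mathcal{H}_n\mathcal{H}_m\subseteq\mathcal{H}_{n+m}$, $\Delta(\mathcal{H}_n)\subseteq\bigoplus_{i+j=n}\mathcal{H}_i\otimes\mathcal{H}_j$, $\bigoplus_{n\ge1}\mathcal{H}_n\subseteq\ker\epsilon$, and $\dim\mathcal{H}_0=1$. Put $A:=\mathrm{Hom}_{\mathbb{K}}(\mathcal{H},B)$ with the topology of pointwise convergence and convolution $\phi\star\psi=m_B\circ(\phi\otimes\psi)\circ\Delta_{\mathcal{H}}$, unit $1_A=\epsilon_{\mathcal{H}}(\cdot)1_B$. $G(\mathcal{H},B)\subseteq A$ is the group (under $\star$, inversion $\phi\mapsto\phi\circ S_{\mathcal{H}}$) of unital algebra homomorphisms $\mathcal{H}\to B$. $\mathfrak{g}(\mathcal{H},B)=\{\phi\in A:\phi(ab)=\epsilon_{\mathcal{H}}(a)\phi(b)+\epsilon_{\mathcal{H}}(b)\phi(a)\ \forall a,b\}$, a closed vector subspace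 of $A$. The exponential series is $\phi\mapsto\sum_{k\ge0}\phi^{\star k}/k!$, which converges for every linear $\phi$ with $\phi|_{\mathcal{H}_0}=0$. Calculus (Keller's $C^r_c$-theory): $f:U\to F$, $U\subseteq E$ open, between locally convex spaces is $C^r$ if its iterated directional derivatives $d^{(k)}f:U\times E^k\to F$ ($k\le r$) exist and are continuous. $\mathbb{K}$-analytic means $C^\infty_{\mathbb{C}}$ if $\mathbb{K}=\mathbb{C}$, and extendable to a $C^\infty_{\mathbb{C}}$-map on an open neighbourhood in the complexification if $\mathbb{K}=\mathbb{R}$. A $\mathbb{K}$-analytic Lie group is a group with a $\mathbb{K}$-analytic Hausdorff manifold structure modelled on a locally convex space with $\mathbb{K}$-analytic group operations. The structure meant on $G(\mathcal{H},B)$ is the one inherited as a $\mathbb{K}$-analytic submanifold of $A$ (locally, in suitable $\mathbb{K}$-analytic charts of the affine subspace $\{\phi\in A:\phi(1_{\mathcal{H}})=1_B\}$, it corresponds to a closed vector subspace); its topology is that of pointwise convergence. A Lie group exponential map is a smooth map $\exp:\mathbf{L}(G)\to G$ such that each $t\mapsto\exp(tx)$ is a one-parameter group with derivative $x$ at $0$. A BCH--Lie group is a $\mathbb{K}$-analytic Lie group with an exponential map which is a local $\mathbb{K}$-analytic diffeomorphism at $0$. *)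

theory Defs
  imports "HOL-Analysis.Analysis" "HOL-Library.Function_Algebras" "HOL-Algebra.Group"
begin

section \<open>The ground field\<close>

text \<open>
  Every field in this class is isometrically isomorphic to the real or to the complex numbers with their
  usual absolute value.
\<close>

class real_or_complex = real_normed_field +
  assumes real_or_complex:
    "(\<forall>z. \<exists>a. z = a *\<^sub>R 1) \<or>
     (\<exists>i. i * i = - 1 \<and> (\<forall>z. \<exists>a b. z = a *\<^sub>R 1 + b *\<^sub>R i \<and> norm z = sqrt (a\<^sup>2 + b\<^sup>2)))"

instance real :: real_or_complex
  by standard auto

instance complex :: real_or_complex
proof
  have "\<exists>a b. z = a *\<^sub>R 1 + b *\<^sub>R \<i> \<and> norm z = sqrt (a\<^sup>2 + b\<^sup>2)" for z
    by (intro exI[of _ "Re z"] exI[of _ "Im z"]) (simp add: complex_eq_iff cmod_def)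
  then show "(\<forall>z::complex. \<exists>a. z = a *\<^sub>R 1) \<or>
     (\<exists>i::complex. i * i = - 1 \<and>
       (\<forall>z. \<exists>a b. z = a *\<^sub>R 1 + b *\<^sub>R i \<and> norm z = sqrt (a\<^sup>2 + b\<^sup>2)))"
    by (intro disjI2 exI[of _ \<i>]) simp
qed

definition is_complex_field :: "'k::real_or_complex itself \<Rightarrow> bool"
  where "is_complex_field _ \<longleftrightarrow> (\<exists>i::'k. i * i = - 1)"


section \<open>Locally convex spaces\<close>

text \<open>
  A locally convex space is a vector subspace of an ambient type with the subspace topology.  Only on the
  subspace is the topology required to be Hausdorff and compatible with the operations.  Function types
  carry the topology of pointwise convergence.
\<close>

record ('k, 'e) lcs =
  scale :: "'k \<Rightarrow> 'e \<Rightarrow> 'e"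
  space_of :: "'e set"

definition locally_convex_space ::
    "('k::real_or_complex, 'e::{ab_group_add, topological_space}) lcs \<Rightarrow> bool"
  where "locally_convex_space E \<longleftrightarrow>
    vector_space (scale E) \<and>
    module.subspace (scale E) (space_of E) \<and>
    Hausdorff_space (top_of_set (space_of E)) \<and>
    continuous_on (space_of E \<times> space_of E) (\<lambda>(x, y). x + y) \<and>
    continuous_on (UNIV \<times> space_of E) (\<lambda>(c, x). scale E c x) \<and>
    (\<forall>W. openin (top_of_set (space_of E)) W \<and> 0 \<in> W \<longrightarrow>
      (\<exists>N C. openin (top_of_set (space_of E)) N \<and> 0 \<in> N \<and> N \<subseteq> C \<and> C \<subseteq> W \<and>
        (\<forall>x\<in>C. \<forall>y\<in>C. \<forall>t\<in>{0..1::real}.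
          scale E (of_real t) x + scale E (of_real (1 - t)) y \<in> C)))"

definition closed_subspace ::
    "('k::real_or_complex, 'e::{ab_group_add, topological_space}) lcs \<Rightarrow> ('k, 'e) lcs \<Rightarrow> bool"
  where "closed_subspace E F \<longleftrightarrow>
    scale F = scale E \<and> module.subspace (scale E) (space_of F) \<and>
    closedin (top_of_set (space_of E)) (space_of F)"

definition frechet_space ::
    "('k::real_or_complex, 'e::{ab_group_add, topological_space}) lcs \<Rightarrow> bool"
  where "frechet_space E \<longleftrightarrow>
    locally_convex_space E \<and>
    (\<exists>d. Metric_space (space_of E) d \<and>
         Metric_space.mtopology (space_of E) d = top_of_set (space_of E) \<and>
         Metric_space.mcomplete (space_of E) d \<and>
         (\<forall>x\<in>space_of E. \<forall>y\<in>space_of E. \<forall>z\<in>space_of E. d (x + z) (y + z) = d x y))"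

text \<open>
  In an isomorphism of \<open>E\<close> with a power of the field, indexed by \<open>I\<close>, the coordinates are pairwise
  distinct functionals on \<open>E\<close>.  Hence it is no restriction to take \<open>I\<close> to be a set of functionals.
\<close>

definition weakly_complete ::
    "('k::real_or_complex, 'e::{ab_group_add, topological_space}) lcs \<Rightarrow> bool"
  where "weakly_complete E \<longleftrightarrow>
    locally_convex_space E \<and>
    (\<exists>(I :: ('e \<Rightarrow> 'k) set) T.
      homeomorphic_map (top_of_set (space_of E)) (product_topology (\<lambda>_. euclidean) I) T \<and>
      (\<forall>i\<in>I. \<forall>x\<in>space_of E. \<forall>y\<in>space_of E. T (x + y) i = T x i + T y i) \<and>
      (\<forall>i\<in>I. \<forall>c. \<forall>x\<in>space_of E. T (scale E c x) i = c * T x i))"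

definition prod_lcs :: "('k, 'e) lcs \<Rightarrow> ('k, 'f) lcs \<Rightarrow> ('k, 'e \<times> 'f) lcs"
  where "prod_lcs E F =
    \<lparr>scale = (\<lambda>c (x, y). (scale E c x, scale F c y)), space_of = space_of E \<times> space_of F\<rparr>"

text \<open>\<open>(x, y)\<close> stands for \<open>x + i y\<close>.\<close>

definition complexification ::
    "('k::real_or_complex, 'e::{ab_group_add, topological_space}) lcs \<Rightarrow> (complex, 'e \<times> 'e) lcs"
  where "complexification E =
    \<lparr>scale = (\<lambda>z (x, y).
       (scale E (of_real (Re z)) x - scale E (of_real (Im z)) y,
        scale E (of_real (Re z)) y + scale E (of_real (Im z)) x)),
     space_of = space_of E \<times> space_of E\<rparr>"


section \<open>Keller's differential calculus\<close>

definition diff_quotient ::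
    "('k::real_or_complex, 'e::{ab_group_add, topological_space}) lcs \<Rightarrow> ('k, 'f::{ab_group_add, topological_space}) lcs \<Rightarrow>
     ('e \<Rightarrow> 'f) \<Rightarrow> 'e \<Rightarrow> 'e \<Rightarrow> 'k \<Rightarrow> 'f"
  where "diff_quotient E F f x v t = scale F (inverse t) (f (x + scale E t v) - f x)"

definition dir_deriv ::
    "('k::real_or_complex, 'e::{ab_group_add, topological_space}) lcs \<Rightarrow> ('k, 'f::{ab_group_add, topological_space}) lcs \<Rightarrow>
     ('e \<Rightarrow> 'f) \<Rightarrow> 'e \<Rightarrow> 'e \<Rightarrow> 'f"
  where "dir_deriv E F f x v =
    (THE l. l \<in> space_of F \<and> (diff_quotient E F f x v \<longlongrightarrow> l) (at 0))"

text \<open>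
  The \<open>k\<close>-th iterated directional derivative at \<open>x\<close> in the directions \<open>v 0, \<dots>, v (k - 1)\<close>.
\<close>

primrec iter_deriv ::
    "('k::real_or_complex, 'e::{ab_group_add, topological_space}) lcs \<Rightarrow> ('k, 'f::{ab_group_add, topological_space}) lcs \<Rightarrow>
     ('e \<Rightarrow> 'f) \<Rightarrow> nat \<Rightarrow> 'e \<Rightarrow> (nat \<Rightarrow> 'e) \<Rightarrow> 'f"
  where
    "iter_deriv E F f 0 x v = f x"
  | "iter_deriv E F f (Suc k) x v = dir_deriv E F (\<lambda>y. iter_deriv E F f k y v) x (v k)"

definition smooth_on ::
    "('k::real_or_complex, 'e::{ab_group_add, topological_space}) lcs \<Rightarrow> ('k, 'f::{ab_group_add, topological_space}) lcs \<Rightarrow>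
     'e set \<Rightarrow> ('e \<Rightarrow> 'f) \<Rightarrow> bool"
  where "smooth_on E F U f \<longleftrightarrow>
    openin (top_of_set (space_of E)) U \<and> f ` U \<subseteq> space_of F \<and>
    (\<forall>k.
      (\<forall>x\<in>U. \<forall>v. range v \<subseteq> space_of E \<longrightarrow>
        (\<exists>l\<in>space_of F. (diff_quotient E F (\<lambda>y. iter_deriv E F f k y v) x (v k) \<longlongrightarrow> l) (at 0))) \<and>
      continuous_on (U \<times> ({..<k} \<rightarrow>\<^sub>E space_of E)) (\<lambda>(x, v). iter_deriv E F f k x v))"

definition analytic_map_on ::
    "('k::real_or_complex, 'e::{ab_group_add, topological_space}) lcs \<Rightarrow> ('k, 'f::{ab_group_add, topological_space}) lcs \<Rightarrow>
     'e set \<Rightarrow> ('e \<Rightarrow> 'f) \<Rightarrow> bool"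
  where "analytic_map_on E F U f \<longleftrightarrow>
    (if is_complex_field TYPE('k) then smooth_on E F U f
     else openin (top_of_set (space_of E)) U \<and>
       (\<exists>U' f'. U \<times> {0} \<subseteq> U' \<and>
          smooth_on (complexification E) (complexification F) U' f' \<and>
          (\<forall>x\<in>U. f' (x, 0) = (f x, 0))))"


section \<open>Analytic manifolds and Lie groups\<close>

type_synonym ('m, 'e) chart = "'m set \<times> ('m \<Rightarrow> 'e)"

record ('k, 'm, 'e) mfd =
  model :: "('k, 'e) lcs"
  mtop :: "'m topology"
  atlas :: "('m, 'e) chart set"

definition is_chart :: "('k, 'e::topological_space) lcs \<Rightarrow> 'm topology \<Rightarrow> ('m, 'e) chart \<Rightarrow> bool"
  where "is_chart E T c \<longleftrightarrow>
    openin T (fst c) \<and> openin (top_of_set (space_of E)) (snd c ` fst c) \<and>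
    homeomorphic_map (subtopology T (fst c)) (top_of_set (snd c ` fst c)) (snd c)"

definition local_rep :: "('m, 'e) chart \<Rightarrow> ('n, 'f) chart \<Rightarrow> ('m \<Rightarrow> 'n) \<Rightarrow> 'e \<Rightarrow> 'f"
  where "local_rep c d f = snd d \<circ> f \<circ> inv_into (fst c) (snd c)"

definition analytic_transition ::
    "('k::real_or_complex, 'e::{ab_group_add, topological_space}) lcs \<Rightarrow> ('m, 'e) chart \<Rightarrow> ('m, 'e) chart \<Rightarrow> bool"
  where "analytic_transition E c d \<longleftrightarrow>
    analytic_map_on E E (snd c ` (fst c \<inter> fst d)) (local_rep c d (\<lambda>p. p))"

definition analytic_manifold ::
    "('k::real_or_complex, 'm, 'e::{ab_group_add, topological_space}) mfd \<Rightarrow> bool"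
  where "analytic_manifold M \<longleftrightarrow>
    locally_convex_space (model M) \<and>
    Hausdorff_space (mtop M) \<and>
    (\<forall>c\<in>atlas M. is_chart (model M) (mtop M) c) \<and>
    (\<Union>c\<in>atlas M. fst c) = topspace (mtop M) \<and>
    (\<forall>c\<in>atlas M. \<forall>d\<in>atlas M. analytic_transition (model M) c d)"

definition analytic_map ::
    "('k::real_or_complex, 'm, 'e::{ab_group_add, topological_space}) mfd \<Rightarrow>
     ('k, 'n, 'f::{ab_group_add, topological_space}) mfd \<Rightarrow> ('m \<Rightarrow> 'n) \<Rightarrow> bool"
  where "analytic_map M N f \<longleftrightarrow>
    continuous_map (mtop M) (mtop N) f \<and>
    (\<forall>c\<in>atlas M. \<forall>d\<in>atlas N.
      analytic_map_on (model M) (model N) (snd c ` (fst c \<inter> f -` fst d)) (local_rep c d f))"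

definition smooth_map ::
    "('k::real_or_complex, 'm, 'e::{ab_group_add, topological_space}) mfd \<Rightarrow>
     ('k, 'n, 'f::{ab_group_add, topological_space}) mfd \<Rightarrow> ('m \<Rightarrow> 'n) \<Rightarrow> bool"
  where "smooth_map M N f \<longleftrightarrow>
    continuous_map (mtop M) (mtop N) f \<and>
    (\<forall>c\<in>atlas M. \<forall>d\<in>atlas N.
      smooth_on (model M) (model N) (snd c ` (fst c \<inter> f -` fst d)) (local_rep c d f))"

definition analytic_diffeo ::
    "('k::real_or_complex, 'm, 'e::{ab_group_add, topological_space}) mfd \<Rightarrow>
     ('k, 'n, 'f::{ab_group_add, topological_space}) mfd \<Rightarrow> ('m \<Rightarrow> 'n) \<Rightarrow> bool"
  where "analytic_diffeo M N f \<longleftrightarrow>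
    bij_betw f (topspace (mtop M)) (topspace (mtop N)) \<and>
    analytic_map M N f \<and>
    analytic_map N M (inv_into (topspace (mtop M)) f)"

definition lcs_mfd :: "('k, 'e::topological_space) lcs \<Rightarrow> ('k, 'e, 'e) mfd"
  where "lcs_mfd E =
    \<lparr>model = E, mtop = top_of_set (space_of E), atlas = {(space_of E, \<lambda>x. x)}\<rparr>"

definition prod_mfd :: "('k, 'm, 'e) mfd \<Rightarrow> ('k, 'n, 'f) mfd \<Rightarrow> ('k, 'm \<times> 'n, 'e \<times> 'f) mfd"
  where "prod_mfd M N =
    \<lparr>model = prod_lcs (model M) (model N),
     mtop = prod_topology (mtop M) (mtop N),
     atlas = {(fst c \<times> fst d, map_prod (snd c) (snd d)) | c d. c \<in> atlas M \<and> d \<in> atlas N}\<rparr>"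

definition open_submfd :: "('k, 'm, 'e) mfd \<Rightarrow> 'm set \<Rightarrow> ('k, 'm, 'e) mfd"
  where "open_submfd M W =
    \<lparr>model = model M, mtop = subtopology (mtop M) W, atlas = (\<lambda>c. (fst c \<inter> W, snd c)) ` atlas M\<rparr>"

definition maximal_atlas ::
    "('k::real_or_complex, 'm, 'e::{ab_group_add, topological_space}) mfd \<Rightarrow> ('m, 'e) chart set"
  where "maximal_atlas M = {c. is_chart (model M) (mtop M) c \<and>
    (\<forall>d\<in>atlas M. analytic_transition (model M) c d \<and> analytic_transition (model M) d c)}"

definition adapted_charts ::
    "('k::real_or_complex, 'm, 'e::{ab_group_add, topological_space}) mfd \<Rightarrow> 'm set \<Rightarrow> ('k, 'e) lcs \<Rightarrow>
     ('m, 'e) chart set"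
  where "adapted_charts M S F =
    {(U \<inter> S, \<kappa>) | U \<kappa>. (U, \<kappa>) \<in> maximal_atlas M \<and> \<kappa> ` (U \<inter> S) = \<kappa> ` U \<inter> space_of F}"

text \<open>
  \<open>N\<close> is the subset \<open>S\<close> of \<open>M\<close> as a submanifold modelled on the closed subspace \<open>F\<close>: the atlas of \<open>N\<close>
  consists of restrictions to \<open>S\<close> of charts of \<open>M\<close> in which \<open>S\<close> corresponds to \<open>F\<close>.  Any two such
  restricted charts are compatible, so all atlases \<open>N\<close> as below define the same manifold structure on \<open>S\<close>.
\<close>

definition analytic_submanifold ::
    "('k::real_or_complex, 'm, 'e::{ab_group_add, topological_space}) mfd \<Rightarrow> 'm set \<Rightarrow> ('k, 'e) lcs \<Rightarrow>
     ('k, 'm, 'e) mfd \<Rightarrow> bool"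
  where "analytic_submanifold M S F N \<longleftrightarrow>
    analytic_manifold M \<and> S \<subseteq> topspace (mtop M) \<and> closed_subspace (model M) F \<and>
    model N = F \<and> mtop N = subtopology (mtop M) S \<and> atlas N \<subseteq> adapted_charts M S F \<and>
    analytic_manifold N"

definition charts_at :: "('k, 'm, 'e) mfd \<Rightarrow> 'm \<Rightarrow> ('m, 'e) chart set"
  where "charts_at M p = {c \<in> atlas M. p \<in> fst c}"

text \<open>
  A tangent vector at \<open>p\<close> is the family of its representatives in all the charts around \<open>p\<close>.  The vector
  space operations and the topology of the tangent space are the pointwise ones.
\<close>

definition tangent_space ::
    "('k::real_or_complex, 'm, 'e::{ab_group_add, topological_space}) mfd \<Rightarrow> 'm \<Rightarrow> ('k, ('m, 'e) chart \<Rightarrow> 'e) lcs"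
  where "tangent_space M p =
    \<lparr>scale = (\<lambda>a X c. scale (model M) a (X c)),
     space_of = {X.
       (\<forall>c. c \<notin> charts_at M p \<longrightarrow> X c = 0) \<and>
       (\<forall>c\<in>charts_at M p. X c \<in> space_of (model M)) \<and>
       (\<forall>c\<in>charts_at M p. \<forall>d\<in>charts_at M p.
         X d = dir_deriv (model M) (model M) (local_rep c d (\<lambda>q. q)) (snd c p) (X c))}\<rparr>"

definition tangent_map ::
    "('k::real_or_complex, 'm, 'e::{ab_group_add, topological_space}) mfd \<Rightarrow>
     ('k, 'n, 'f::{ab_group_add, topological_space}) mfd \<Rightarrow> ('m \<Rightarrow> 'n) \<Rightarrow> 'm \<Rightarrow>
     (('m, 'e) chart \<Rightarrow> 'e) \<Rightarrow> (('n, 'f) chart \<Rightarrow> 'f)"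
  where "tangent_map M N f p X = (\<lambda>d.
    if d \<in> charts_at N (f p)
    then let c = (SOME c. c \<in> charts_at M p)
         in dir_deriv (model M) (model N) (local_rep c d f) (snd c p) (X c)
    else 0)"

text \<open>
  For a manifold that is a subset of a vector space, the derivative at \<open>p\<close> of the inclusion; it identifies
  abstract tangent vectors with elements of the surrounding space.
\<close>

definition tangent_inclusion ::
    "('k::real_or_complex, 'm::{ab_group_add, topological_space}, 'e::{ab_group_add, topological_space}) mfd \<Rightarrow>
     ('k, 'm) lcs \<Rightarrow> 'm \<Rightarrow> (('m, 'e) chart \<Rightarrow> 'e) \<Rightarrow> 'm"
  where "tangent_inclusion M E p X = tangent_map M (lcs_mfd E) (\<lambda>q. q) p X (space_of E, \<lambda>q. q)"

definition analytic_lie_group ::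
    "('m, 'a) monoid_scheme \<Rightarrow> ('k::real_or_complex, 'm, 'e::{ab_group_add, topological_space}) mfd \<Rightarrow> bool"
  where "analytic_lie_group G M \<longleftrightarrow>
    group G \<and> carrier G = topspace (mtop M) \<and> analytic_manifold M \<and>
    analytic_map (prod_mfd M M) M (\<lambda>(x, y). x \<otimes>\<^bsub>G\<^esub> y) \<and>
    analytic_map M M (\<lambda>x. inv\<^bsub>G\<^esub> x)"

abbreviation lie_space ::
    "('m, 'a) monoid_scheme \<Rightarrow> ('k::real_or_complex, 'm, 'e::{ab_group_add, topological_space}) mfd \<Rightarrow>
     ('k, ('m, 'e) chart \<Rightarrow> 'e) lcs"
  where "lie_space G M \<equiv> tangent_space M \<one>\<^bsub>G\<^esub>"

definition left_inv_field ::
    "('m, 'a) monoid_scheme \<Rightarrow> ('k::real_or_complex, 'm, 'e::{ab_group_add, topological_space}) mfd \<Rightarrow>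
     (('m, 'e) chart \<Rightarrow> 'e) \<Rightarrow> 'm \<Rightarrow> (('m, 'e) chart \<Rightarrow> 'e)"
  where "left_inv_field G M X g = tangent_map M M (\<lambda>h. g \<otimes>\<^bsub>G\<^esub> h) \<one>\<^bsub>G\<^esub> X"

text \<open>
  The value at the neutral element of the commutator of the left invariant vector fields extending \<open>X\<close>
  and \<open>Y\<close>.  In a chart the commutator of vector fields \<open>\<xi>\<close>, \<open>\<eta>\<close> is \<open>d\<eta>(y; \<xi> y) - d\<xi>(y; \<eta> y)\<close>.
\<close>

definition lie_bracket ::
    "('m, 'a) monoid_scheme \<Rightarrow> ('k::real_or_complex, 'm, 'e::{ab_group_add, topological_space}) mfd \<Rightarrow>
     (('m, 'e) chart \<Rightarrow> 'e) \<Rightarrow> (('m, 'e) chart \<Rightarrow> 'e) \<Rightarrow> (('m, 'e) chart \<Rightarrow> 'e)"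
  where "lie_bracket G M X Y = (\<lambda>c.
    if c \<in> charts_at M \<one>\<^bsub>G\<^esub>
    then let y = snd c \<one>\<^bsub>G\<^esub>;
             \<xi> = (\<lambda>z. left_inv_field G M X (inv_into (fst c) (snd c) z) c);
             \<eta> = (\<lambda>z. left_inv_field G M Y (inv_into (fst c) (snd c) z) c)
         in dir_deriv (model M) (model M) \<eta> y (\<xi> y) - dir_deriv (model M) (model M) \<xi> y (\<eta> y)
    else 0)"

definition lie_algebra ::
    "('k::real_or_complex, 'e::{ab_group_add, topological_space}) lcs \<Rightarrow> ('e \<Rightarrow> 'e \<Rightarrow> 'e) \<Rightarrow> bool"
  where "lie_algebra E br \<longleftrightarrow>
    vector_space (scale E) \<and> module.subspace (scale E) (space_of E) \<and>
    (\<forall>x\<in>space_of E. \<forall>y\<in>space_of E. br x y \<in> space_of E) \<and>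
    (\<forall>x\<in>space_of E. \<forall>y\<in>space_of E. \<forall>z\<in>space_of E.
       br (x + y) z = br x z + br y z \<and> br z (x + y) = br z x + br z y) \<and>
    (\<forall>a. \<forall>x\<in>space_of E. \<forall>y\<in>space_of E.
       br (scale E a x) y = scale E a (br x y) \<and> br x (scale E a y) = scale E a (br x y)) \<and>
    (\<forall>x\<in>space_of E. br x x = 0) \<and>
    (\<forall>x\<in>space_of E. \<forall>y\<in>space_of E. \<forall>z\<in>space_of E.
       br x (br y z) + br y (br z x) + br z (br x y) = 0)"

definition lie_algebra_iso ::
    "('k::real_or_complex, 'e::{ab_group_add, topological_space}) lcs \<Rightarrow> ('e \<Rightarrow> 'e \<Rightarrow> 'e) \<Rightarrow>
     ('k, 'f::{ab_group_add, topological_space}) lcs \<Rightarrow> ('f \<Rightarrow> 'f \<Rightarrow> 'f) \<Rightarrow> ('e \<Rightarrow> 'f) \<Rightarrow> bool"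
  where "lie_algebra_iso E br F br' \<Phi> \<longleftrightarrow>
    lie_algebra E br \<and> lie_algebra F br' \<and>
    homeomorphic_map (top_of_set (space_of E)) (top_of_set (space_of F)) \<Phi> \<and>
    (\<forall>x\<in>space_of E. \<forall>y\<in>space_of E. \<Phi> (x + y) = \<Phi> x + \<Phi> y) \<and>
    (\<forall>a. \<forall>x\<in>space_of E. \<Phi> (scale E a x) = scale F a (\<Phi> x)) \<and>
    (\<forall>x\<in>space_of E. \<forall>y\<in>space_of E. \<Phi> (br x y) = br' (\<Phi> x) (\<Phi> y))"

definition lie_exponential ::
    "('m, 'a) monoid_scheme \<Rightarrow> ('k::real_or_complex, 'm, 'e::{ab_group_add, topological_space}) mfd \<Rightarrow>
     ((('m, 'e) chart \<Rightarrow> 'e) \<Rightarrow> 'm) \<Rightarrow> bool"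
  where "lie_exponential G M ex \<longleftrightarrow>
    smooth_map (lcs_mfd (lie_space G M)) M ex \<and>
    (\<forall>X\<in>space_of (lie_space G M).
      (\<forall>s t :: real. ex (scale (lie_space G M) (of_real (s + t)) X) =
         ex (scale (lie_space G M) (of_real s) X) \<otimes>\<^bsub>G\<^esub> ex (scale (lie_space G M) (of_real t) X)) \<and>
      (\<forall>c\<in>charts_at M \<one>\<^bsub>G\<^esub>.
        ((\<lambda>t::real. scale (model M) (of_real (inverse t))
            (snd c (ex (scale (lie_space G M) (of_real t) X)) - snd c \<one>\<^bsub>G\<^esub>)) \<longlongrightarrow> X c) (at 0)))"

definition bch_lie_group ::
    "('m, 'a) monoid_scheme \<Rightarrow> ('k::real_or_complex, 'm, 'e::{ab_group_add, topological_space}) mfd \<Rightarrow> bool"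
  where "bch_lie_group G M \<longleftrightarrow>
    analytic_lie_group G M \<and>
    (\<exists>ex. lie_exponential G M ex \<and>
      (\<exists>W. openin (top_of_set (space_of (lie_space G M))) W \<and> 0 \<in> W \<and> openin (mtop M) (ex ` W) \<and>
        analytic_diffeo (open_submfd (lcs_mfd (lie_space G M)) W) (open_submfd M (ex ` W)) ex))"


section \<open>Algebras\<close>

definition algebra_over :: "('k::field \<Rightarrow> 'a::{ring, monoid_mult} \<Rightarrow> 'a) \<Rightarrow> bool"
  where "algebra_over s \<longleftrightarrow>
    vector_space s \<and> (\<forall>c x y. s c (x * y) = s c x * y \<and> s c (x * y) = x * s c y)"

text \<open>
  The sort \<open>{comm_ring, comm_monoid_mult}\<close>, unlike \<open>comm_ring_1\<close>, admits the zero algebra.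
\<close>

definition comm_locally_convex_algebra ::
    "('k::real_or_complex \<Rightarrow> 'b::{comm_ring, comm_monoid_mult, topological_space} \<Rightarrow> 'b) \<Rightarrow> bool"
  where "comm_locally_convex_algebra s \<longleftrightarrow>
    algebra_over s \<and>
    locally_convex_space \<lparr>scale = s, space_of = UNIV\<rparr> \<and>
    continuous_on UNIV (\<lambda>(x, y). x * y :: 'b)"

definition countable_dimension :: "('k::field \<Rightarrow> 'a::ab_group_add \<Rightarrow> 'a) \<Rightarrow> bool"
  where "countable_dimension s \<longleftrightarrow>
    (\<exists>b. countable b \<and> \<not> module.dependent s b \<and> module.span s b = UNIV)"


section \<open>Tensor products\<close>

text \<open>
  The tensor square of a vector space \<open>V\<close> is modelled as the space spanned by the evaluation functionals
  \<open>\<beta> \<mapsto> \<beta> x y\<close> on the space of bilinear forms on \<open>V\<close>; likewise for the tensor cube.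
\<close>

definition bilinear_form :: "('k::field \<Rightarrow> 'h::ab_group_add \<Rightarrow> 'h) \<Rightarrow> ('h \<Rightarrow> 'h \<Rightarrow> 'k) \<Rightarrow> bool"
  where "bilinear_form s \<beta> \<longleftrightarrow>
    (\<forall>x. Vector_Spaces.linear s (*) (\<beta> x)) \<and> (\<forall>y. Vector_Spaces.linear s (*) (\<lambda>x. \<beta> x y))"

definition trilinear_form :: "('k::field \<Rightarrow> 'h::ab_group_add \<Rightarrow> 'h) \<Rightarrow> ('h \<Rightarrow> 'h \<Rightarrow> 'h \<Rightarrow> 'k) \<Rightarrow> bool"
  where "trilinear_form s \<tau> \<longleftrightarrow>
    (\<forall>x. bilinear_form s (\<tau> x)) \<and> (\<forall>y z. Vector_Spaces.linear s (*) (\<lambda>x. \<tau> x y z))"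

type_synonym ('k, 'h) tensor2 = "('h \<Rightarrow> 'h \<Rightarrow> 'k) \<Rightarrow> 'k"
type_synonym ('k, 'h) tensor3 = "('h \<Rightarrow> 'h \<Rightarrow> 'h \<Rightarrow> 'k) \<Rightarrow> 'k"

definition tensor :: "('k::field \<Rightarrow> 'h::ab_group_add \<Rightarrow> 'h) \<Rightarrow> 'h \<Rightarrow> 'h \<Rightarrow> ('k, 'h) tensor2"
  where "tensor s x y = (\<lambda>\<beta>. if bilinear_form s \<beta> then \<beta> x y else 0)"

definition tensor3 :: "('k::field \<Rightarrow> 'h::ab_group_add \<Rightarrow> 'h) \<Rightarrow> 'h \<Rightarrow> 'h \<Rightarrow> 'h \<Rightarrow> ('k, 'h) tensor3"
  where "tensor3 s x y z = (\<lambda>\<tau>. if trilinear_form s \<tau> then \<tau> x y z else 0)"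

text \<open>
  All sums of pure tensors \<open>x \<otimes> y\<close> with \<open>(x, y) \<in> P\<close>.  For \<open>P = X \<times> Y\<close> with subspaces \<open>X\<close>, \<open>Y\<close> this is the
  subspace \<open>X \<otimes> Y\<close>, since scalars can be moved into one of the factors; for a union of such sets it is
  the sum of the corresponding subspaces.
\<close>

definition tensor_sums :: "('k::field \<Rightarrow> 'h::ab_group_add \<Rightarrow> 'h) \<Rightarrow> ('h \<times> 'h) set \<Rightarrow> ('k, 'h) tensor2 set"
  where "tensor_sums s P = {\<Sum>(x, y)\<leftarrow>xs. tensor s x y | xs. set xs \<subseteq> P}"

text \<open>
  The linear map on the tensor square induced by a bilinear map \<open>f\<close>, i.e. the one sending \<open>x \<otimes> y\<close> to \<open>f x y\<close>.
\<close>

definition tensor_lift ::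
    "('k::field \<Rightarrow> 'h::ab_group_add \<Rightarrow> 'h) \<Rightarrow> ('h \<Rightarrow> 'h \<Rightarrow> 'w::monoid_add) \<Rightarrow> ('k, 'h) tensor2 \<Rightarrow> 'w"
  where "tensor_lift s f t =
    (THE w. \<exists>xs. t = (\<Sum>(x, y)\<leftarrow>xs. tensor s x y) \<and> w = (\<Sum>(x, y)\<leftarrow>xs. f x y))"

definition tensor_mult ::
    "('k::field \<Rightarrow> 'h::ring \<Rightarrow> 'h) \<Rightarrow> ('k, 'h) tensor2 \<Rightarrow> ('k, 'h) tensor2 \<Rightarrow> ('k, 'h) tensor2"
  where "tensor_mult s t u =
    tensor_lift s (\<lambda>a b. tensor_lift s (\<lambda>c d. tensor s (a * c) (b * d)) u) t"


section \<open>Graded connected Hopf algebras\<close>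

record ('k, 'h) hopf =
  hscale :: "'k \<Rightarrow> 'h \<Rightarrow> 'h"
  comult :: "'h \<Rightarrow> ('k, 'h) tensor2"
  counit :: "'h \<Rightarrow> 'k"
  antipode :: "'h \<Rightarrow> 'h"

definition hopf_algebra :: "('k::field, 'h::ring_1) hopf \<Rightarrow> bool"
  where "hopf_algebra H \<longleftrightarrow>
    (let s = hscale H; \<Delta> = comult H; \<epsilon> = counit H; S = antipode H in
      algebra_over s \<and>
      \<comment> \<open>coalgebra\<close>
      range \<Delta> \<subseteq> tensor_sums s UNIV \<and>
      Vector_Spaces.linear s (\<lambda>c t \<beta>. c * t \<beta>) \<Delta> \<and>
      Vector_Spaces.linear s (*) \<epsilon> \<and>
      (\<forall>x. tensor_lift s (\<lambda>a b. tensor_lift s (\<lambda>c d. tensor3 s c d b) (\<Delta> a)) (\<Delta> x) =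
           tensor_lift s (\<lambda>a b. tensor_lift s (\<lambda>c d. tensor3 s a c d) (\<Delta> b)) (\<Delta> x)) \<and>
      (\<forall>x. tensor_lift s (\<lambda>a b. s (\<epsilon> a) b) (\<Delta> x) = x) \<and>
      (\<forall>x. tensor_lift s (\<lambda>a b. s (\<epsilon> b) a) (\<Delta> x) = x) \<and>
      \<comment> \<open>comultiplication and counit are unital algebra homomorphisms\<close>
      (\<forall>x y. \<Delta> (x * y) = tensor_mult s (\<Delta> x) (\<Delta> y)) \<and> \<Delta> 1 = tensor s 1 1 \<and>
      (\<forall>x y. \<epsilon> (x * y) = \<epsilon> x * \<epsilon> y) \<and> \<epsilon> 1 = 1 \<and>
      \<comment> \<open>antipode\<close>
      Vector_Spaces.linear s s S \<and>
      (\<forall>x. tensor_lift s (\<lambda>a b. S a * b) (\<Delta> x) = s (\<epsilon> x) 1) \<and>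
      (\<forall>x. tensor_lift s (\<lambda>a b. a * S b) (\<Delta> x) = s (\<epsilon> x) 1))"

definition direct_sum_decomposition ::
    "('k::field \<Rightarrow> 'a::ab_group_add \<Rightarrow> 'a) \<Rightarrow> (nat \<Rightarrow> 'a set) \<Rightarrow> bool"
  where "direct_sum_decomposition s V \<longleftrightarrow>
    (\<forall>n. module.subspace s (V n)) \<and>
    (\<forall>x. \<exists>!c. (\<forall>n. c n \<in> V n) \<and> finite {n. c n \<noteq> 0} \<and> x = (\<Sum>n | c n \<noteq> 0. c n))"

definition graded_connected_hopf_algebra ::
    "('k::field, 'h::ring_1) hopf \<Rightarrow> (nat \<Rightarrow> 'h set) \<Rightarrow> bool"
  where "graded_connected_hopf_algebra H V \<longleftrightarrow>
    hopf_algebra H \<and>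
    direct_sum_decomposition (hscale H) V \<and>
    1 \<in> V 0 \<and>
    (\<forall>n m. \<forall>x\<in>V n. \<forall>y\<in>V m. x * y \<in> V (n + m)) \<and>
    (\<forall>n. comult H ` V n \<subseteq> tensor_sums (hscale H) (\<Union>i\<le>n. V i \<times> V (n - i))) \<and>
    (\<forall>n\<ge>1. \<forall>x\<in>V n. counit H x = 0) \<and>
    vector_space.dim (hscale H) (V 0) = 1"


section \<open>The character group\<close>

definition hom_lcs ::
    "('k::real_or_complex, 'h::ring_1) hopf \<Rightarrow>
     ('k \<Rightarrow> 'b::{comm_ring, comm_monoid_mult, topological_space} \<Rightarrow> 'b) \<Rightarrow> ('k, 'h \<Rightarrow> 'b) lcs"
  where "hom_lcs H sB =
    \<lparr>scale = (\<lambda>c \<phi> x. sB c (\<phi> x)), space_of = {\<phi>. Vector_Spaces.linear (hscale H) sB \<phi>}\<rparr>"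

definition convolution ::
    "('k::real_or_complex, 'h::ring_1) hopf \<Rightarrow>
     ('h \<Rightarrow> 'b::{comm_ring, comm_monoid_mult, topological_space}) \<Rightarrow> ('h \<Rightarrow> 'b) \<Rightarrow> ('h \<Rightarrow> 'b)"
  where "convolution H \<phi> \<psi> = (\<lambda>x. tensor_lift (hscale H) (\<lambda>a b. \<phi> a * \<psi> b) (comult H x))"

definition conv_unit ::
    "('k::real_or_complex, 'h::ring_1) hopf \<Rightarrow>
     ('k \<Rightarrow> 'b::{comm_ring, comm_monoid_mult, topological_space} \<Rightarrow> 'b) \<Rightarrow> 'h \<Rightarrow> 'b"
  where "conv_unit H sB = (\<lambda>x. sB (counit H x) 1)"

definition character_group ::
    "('k::real_or_complex, 'h::ring_1) hopf \<Rightarrow>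
     ('k \<Rightarrow> 'b::{comm_ring, comm_monoid_mult, topological_space} \<Rightarrow> 'b) \<Rightarrow> ('h \<Rightarrow> 'b) monoid"
  where "character_group H sB =
    \<lparr>carrier = {\<phi> \<in> space_of (hom_lcs H sB). \<phi> 1 = 1 \<and> (\<forall>x y. \<phi> (x * y) = \<phi> x * \<phi> y)},
     mult = convolution H, one = conv_unit H sB\<rparr>"

definition inf_characters ::
    "('k::real_or_complex, 'h::ring_1) hopf \<Rightarrow>
     ('k \<Rightarrow> 'b::{comm_ring, comm_monoid_mult, topological_space} \<Rightarrow> 'b) \<Rightarrow> ('k, 'h \<Rightarrow> 'b) lcs"
  where "inf_characters H sB =
    \<lparr>scale = scale (hom_lcs H sB),
     space_of = {\<phi> \<in> space_of (hom_lcs H sB).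
       \<forall>x y. \<phi> (x * y) = sB (counit H x) (\<phi> y) + sB (counit H y) (\<phi> x)}\<rparr>"

text \<open>
  The affine subspace of all linear maps \<open>\<phi>\<close> with \<open>\<phi> 1 = 1\<close>, modelled by translation on the vector
  space of all linear maps vanishing at \<open>1\<close>.
\<close>

definition unital_hom_mfd ::
    "('k::real_or_complex, 'h::ring_1) hopf \<Rightarrow>
     ('k \<Rightarrow> 'b::{comm_ring, comm_monoid_mult, topological_space} \<Rightarrow> 'b) \<Rightarrow> ('k, 'h \<Rightarrow> 'b, 'h \<Rightarrow> 'b) mfd"
  where "unital_hom_mfd H sB =
    (let S = {\<phi> \<in> space_of (hom_lcs H sB). \<phi> 1 = 1} in
     \<lparr>model = \<lparr>scale = scale (hom_lcs H sB), space_of = {\<phi> \<in> space_of (hom_lcs H sB). \<phi> 1 = 0}\<rparr>,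
      mtop = top_of_set S,
      atlas = {(S, \<lambda>\<phi>. \<phi> - conv_unit H sB)}\<rparr>)"

definition exp_series_term ::
    "('k::real_or_complex, 'h::ring_1) hopf \<Rightarrow>
     ('k \<Rightarrow> 'b::{comm_ring, comm_monoid_mult, topological_space} \<Rightarrow> 'b) \<Rightarrow> ('h \<Rightarrow> 'b) \<Rightarrow> nat \<Rightarrow> 'h \<Rightarrow> 'b"
  where "exp_series_term H sB \<phi> k =
    scale (hom_lcs H sB) (inverse (fact k)) ((convolution H \<phi> ^^ k) (conv_unit H sB))"

end

theory Submission
  imports Defs
begin

text \<open>
  A linear map \<open>\<phi>\<close> on \<open>H\<close> with \<open>\<phi> 1 = 0\<close> is locally nilpotent under convolution: at an element of degree \<open>n\<close>
  its powers beyond the \<open>n\<close>-th vanish.  Formal power series can therefore be evaluated at \<open>\<phi>\<close>, and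
  the identities between the formal exponential and logarithm make \<open>exp\<close> and \<open>log\<close> inverse bijections between
  \<open>{\<phi>. \<phi> 1 = 0}\<close> and \<open>{\<phi>. \<phi> 1 = 1}\<close>; they restrict to bijections between infinitesimal characters and
  characters.  So \<open>log\<close> is a single global chart of the character group, adapted to the closed subspace of
  infinitesimal characters.  At every argument the maps in question are polynomials in finitely
  many point evaluations, hence smooth in Keller's sense.  Over the reals they extend to the complexification
  because the same formulas make sense over the complexified algebra \<open>B\<close>.  In the chart \<open>log\<close> one-parameter
  groups are additive curves, which leaves only one exponential map.
\<close>

section \<open>Linear algebra and tensor squares\<close>

text \<open>A tensor is known only through its values at scalar bilinear forms, while convolution
  takes values in B. Linear functionals on B separate points and turn B-valued bilinear maps into
  scalar ones; hence sums over a representation of a coproduct do not depend on the representation.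
  Identities in one map \<phi> come from the commutative ring of formal power series, but products
  of characters and brackets mix maps that need not commute. The product is treated as a whole, as
  log(exp \<phi> exp \<psi>). For the bracket, log(1 + u) up to second order is enough: the term -
  u^2 / 2 makes the derivative at 0 of a left invariant field one half of a commutator, and the two
  halves in the bracket add up. Over the reals an analytic extension must also keep its values in
  the complexified subspace. For this \<open>'b cx\<close> is used with two scalar actions: over the
  ground field it is a target of H, so that exp and log relate its characters and infinitesimal
  characters; over the complex numbers it carries the derivatives of the extension.\<close>

lemma vector_space_fun:
  assumes "vector_space s" shows "vector_space (\<lambda>c f x. s c (f x))"
  using assms by (simp add: vector_space_def fun_eq_iff)

lemma linearI:
  assumes "vector_space s" "vector_space s'" "\<And>x y. f (x + y) = f x + f y" "\<And>c x. f (s c x) = s' c (f x)"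
  shows "Vector_Spaces.linear s s' f"
  using assms by (simp add: Vector_Spaces.linear_iff)

lemmas linear_0 = module_hom.zero [OF Vector_Spaces.linear.axioms(3)]
  and linear_diff = module_hom.diff [OF Vector_Spaces.linear.axioms(3)]
  and linear_sum = module_hom.sum [OF Vector_Spaces.linear.axioms(3)]

lemma linear_sum_list: "Vector_Spaces.linear s s' f \<Longrightarrow> f (\<Sum>p\<leftarrow>xs. g p) = (\<Sum>p\<leftarrow>xs. f (g p))"
  by (induction xs) (auto simp: linear_0 Vector_Spaces.linear_iff)

lemma sum_list_fun_apply:
  fixes f :: "'p \<Rightarrow> 'x \<Rightarrow> 'a::monoid_add"
  shows "(\<Sum>p\<leftarrow>xs. f p) b = (\<Sum>p\<leftarrow>xs. f p b)"
  by (induction xs) auto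

lemma sum_sum_list_swap:
  fixes f :: "'i \<Rightarrow> 'p \<Rightarrow> 'a::comm_monoid_add"
  shows "(\<Sum>p\<leftarrow>xs. \<Sum>i\<in>I. f i p) = (\<Sum>i\<in>I. \<Sum>p\<leftarrow>xs. f i p)"
  by (induction xs) (auto simp: sum.distrib)

text \<open>Extends the functional sending v - w to 1. Tensors pair with scalar forms only, so this
  is the bridge from scalar identities to identities in an arbitrary vector space.\<close>

lemma linear_functional_separates:
  fixes s :: "'k::field \<Rightarrow> 'w::ab_group_add \<Rightarrow> 'w"
  assumes "vector_space s" and "\<And>g. Vector_Spaces.linear s (*) g \<Longrightarrow> g v = g w"
  shows "v = w"
proof (rule ccontr)
  assume neq: "v \<noteq> w"
  interpret vector_space_pair s "(*) :: 'k \<Rightarrow> _"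
    using assms(1) vector_space_over_itself.vector_space_axioms by (simp add: vector_space_pair_def)
  have "vs1.independent {v - w}" using neq by (simp add: vs1.dependent_single)
  then obtain g where g: "Vector_Spaces.linear s (*) g" "g (v - w) = 1"
    using linear_independent_extend [of "{v - w}" "\<lambda>_. 1"] by auto
  then show False
    using assms(2) [OF g(1)] linear_diff [OF g(1)] by auto
qed

section \<open>Bilinear maps on the tensor square\<close>

definition bilinear_map ::
    "('k::field \<Rightarrow> 'h::ab_group_add \<Rightarrow> 'h) \<Rightarrow> ('k \<Rightarrow> 'w::ab_group_add \<Rightarrow> 'w) \<Rightarrow> ('h \<Rightarrow> 'h \<Rightarrow> 'w) \<Rightarrow> bool"
  where "bilinear_map s s' f \<longleftrightarrow>
    (\<forall>x. Vector_Spaces.linear s s' (f x)) \<and> (\<forall>y. Vector_Spaces.linear s s' (\<lambda>x. f x y))"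

lemma linear_comp:
  "Vector_Spaces.linear s s' f \<Longrightarrow> Vector_Spaces.linear s' s'' g \<Longrightarrow> Vector_Spaces.linear s s'' (\<lambda>x. g (f x))"
  by (simp add: Vector_Spaces.linear_iff)

text \<open>A functional \<open>g\<close> on the target turns \<open>f\<close> into a scalar form,
  at which the two equal tensors can be evaluated. This is the well-definedness behind the definite
  description in \<open>tensor_lift\<close>.\<close>

lemma tensor_sum_cong:
  assumes "vector_space s" "vector_space s'" "bilinear_map s s' f"
    and eq: "(\<Sum>(x, y)\<leftarrow>xs. tensor s x y) = (\<Sum>(x, y)\<leftarrow>ys. tensor s x y)"
  shows "(\<Sum>(x, y)\<leftarrow>xs. f x y) = (\<Sum>(x, y)\<leftarrow>ys. f x y)"
proof (rule linear_functional_separates [OF assms(2)])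
  fix g assume g: "Vector_Spaces.linear s' (*) g"
  have b: "bilinear_form s (\<lambda>x y. g (f x y))"
    using assms(3) g by (auto simp: bilinear_form_def bilinear_map_def intro: linear_comp [OF _ g])
  have *: "(\<Sum>(x, y)\<leftarrow>zs. tensor s x y) (\<lambda>x y. g (f x y)) = g (\<Sum>(x, y)\<leftarrow>zs. f x y)" for zs
    unfolding sum_list_fun_apply linear_sum_list [OF g]
    by (intro arg_cong[where f=sum_list] map_cong) (use b in \<open>auto simp: tensor_def\<close>)
  show "g (\<Sum>(x, y)\<leftarrow>xs. f x y) = g (\<Sum>(x, y)\<leftarrow>ys. f x y)"
    using eq * by metis
qed

lemma tensor_lift_sum_list:
  assumes "vector_space s" "vector_space s'" "bilinear_map s s' f"
  shows "tensor_lift s f (\<Sum>(x, y)\<leftarrow>xs. tensor s x y) = (\<Sum>(x, y)\<leftarrow>xs. f x y)"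
  unfolding tensor_lift_def
  by (rule the_equality) (auto dest: tensor_sum_cong [OF assms])

abbreviation tscale :: "'k::field \<Rightarrow> ('x \<Rightarrow> 'k) \<Rightarrow> 'x \<Rightarrow> 'k" where "tscale \<equiv> \<lambda>c t \<beta>. c * t \<beta>"

lemma vector_space_tscale: "vector_space tscale"
  by (rule vector_space_fun) (rule vector_space_over_itself.vector_space_axioms)

lemma bilinear_map_tensor:
  "vector_space s \<Longrightarrow> bilinear_map s tscale (tensor s)"
  unfolding bilinear_map_def
  by (intro conjI allI linearI vector_space_tscale; (assumption)?)
    (auto simp: tensor_def fun_eq_iff bilinear_form_def Vector_Spaces.linear_iff)

lemma tensor3_trilinear:
  assumes "vector_space s"
  shows "Vector_Spaces.linear s tscale (\<lambda>x. tensor3 s x y z)"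
    "Vector_Spaces.linear s tscale (\<lambda>y. tensor3 s x y z)"
    "Vector_Spaces.linear s tscale (\<lambda>z. tensor3 s x y z)"
  by (auto intro!: linearI vector_space_tscale assms
      simp: tensor3_def fun_eq_iff trilinear_form_def bilinear_form_def Vector_Spaces.linear_iff)

lemma linear_sum_list_maps:
  assumes "vector_space s" "vector_space s'" "\<And>p. p \<in> set xs \<Longrightarrow> Vector_Spaces.linear s s' (f p)"
  shows "Vector_Spaces.linear s s' (\<lambda>x. \<Sum>p\<leftarrow>xs. f p x)"
  using assms(3)
proof (induction xs)
  case Nil
  interpret vector_space s' by fact
  show ?case by (rule linearI) (use assms in auto)
next
  case (Cons p xs)
  interpret vector_space s' by fact
  from Cons have "Vector_Spaces.linear s s' (f p)" "Vector_Spaces.linear s s' (\<lambda>x. \<Sum>p\<leftarrow>xs. f p x)" by auto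
  then show ?case
    by (intro linearI assms) (auto simp: Vector_Spaces.linear_iff scale_right_distrib)
qed

lemma bilinear_mapI:
  assumes "vector_space s" "vector_space s'"
    and "\<And>x y z. f (x + y) z = f x z + f y z" "\<And>x y z. f z (x + y) = f z x + f z y"
    and "\<And>c x y. f (s c x) y = s' c (f x y)" "\<And>c x y. f x (s c y) = s' c (f x y)"
  shows "bilinear_map s s' f"
  using assms unfolding bilinear_map_def by (auto intro!: linearI)

lemma linear_sum_list_pairs:
  assumes "vector_space s" "vector_space s'" "\<And>c d. Vector_Spaces.linear s s' (f c d)"
  shows "Vector_Spaces.linear s s' (\<lambda>x. \<Sum>(c, d)\<leftarrow>xs. f c d x)"
  using linear_sum_list_maps [OF assms(1,2), of xs "\<lambda>(c, d). f c d"] assms(3)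
  by (simp add: case_prod_unfold)

lemma (in vector_space) scale_sum_list: "scale c (\<Sum>p\<leftarrow>xs. f p) = (\<Sum>p\<leftarrow>xs. scale c (f p))"
  by (induction xs) (auto simp: scale_right_distrib)

section \<open>The convolution algebra\<close>

locale graded_hopf =
  fixes H :: "('k::real_or_complex, 'h::ring_1) hopf" and V :: "nat \<Rightarrow> 'h set"
  assumes graded: "graded_connected_hopf_algebra H V"
begin

section \<open>The coproduct in Sweedler form\<close>

abbreviation s where "s \<equiv> hscale H"
abbreviation \<epsilon> where "\<epsilon> \<equiv> counit H"
abbreviation \<Delta> where "\<Delta> \<equiv> comult H"

lemma hopf: "hopf_algebra H"
  using graded by (simp add: graded_connected_hopf_algebra_def)

lemmas hopf_unfolded = hopf [unfolded hopf_algebra_def Let_def]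

lemma vector_space_s: "vector_space s"
  using hopf_unfolded by (simp add: algebra_over_def)

sublocale hs: vector_space "hscale H"
  by (rule vector_space_s)

lemma s_mult: "s c (x * y) = s c x * y" "s c (x * y) = x * s c y"
  using hopf_unfolded unfolding algebra_over_def by metis+

lemma linear_counit: "Vector_Spaces.linear s (*) \<epsilon>"
  using hopf_unfolded by simp

lemma counit_simps [simp]:
  "\<epsilon> (x * y) = \<epsilon> x * \<epsilon> y" "\<epsilon> 1 = 1" "\<epsilon> (x + y) = \<epsilon> x + \<epsilon> y" "\<epsilon> (s c x) = c * \<epsilon> x"
  using hopf_unfolded by (auto simp: Vector_Spaces.linear_iff)

lemma comult_linear: "\<Delta> (x + y) = \<Delta> x + \<Delta> y" "\<Delta> (s c x) = tscale c (\<Delta> x)"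
  using hopf_unfolded by (auto simp: Vector_Spaces.linear_iff)

lemma comult_one: "\<Delta> 1 = tensor s 1 1"
  using hopf_unfolded by simp

text \<open>One fixed representation of each coproduct, in place of Sweedler's notation. The choice
  is neither linear nor compatible with the grading, hence the lemmas that admit other
  representations.\<close>

definition sweedler :: "'h \<Rightarrow> ('h \<times> 'h) list"
  where "sweedler x = (SOME xs. \<Delta> x = (\<Sum>(a, b)\<leftarrow>xs. tensor s a b))"

lemma comult_sweedler: "\<Delta> x = (\<Sum>(a, b)\<leftarrow>sweedler x. tensor s a b)"
proof -
  have "\<Delta> x \<in> tensor_sums s UNIV" using hopf_unfolded by blast
  then have "\<exists>xs. \<Delta> x = (\<Sum>(a, b)\<leftarrow>xs. tensor s a b)" by (auto simp: tensor_sums_def)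
  then show ?thesis unfolding sweedler_def by (rule someI_ex)
qed

lemma tensor_lift_eq:
  assumes "vector_space s'" "bilinear_map s s' f" "\<Delta> x = (\<Sum>(a, b)\<leftarrow>xs. tensor s a b)"
  shows "tensor_lift s f (\<Delta> x) = (\<Sum>(a, b)\<leftarrow>xs. f a b)"
  using tensor_lift_sum_list [OF vector_space_s assms(1,2)] assms(3) by simp

lemmas tensor_lift_sweedler = tensor_lift_eq [OF _ _ comult_sweedler]

text \<open>Representations can be built from others: appending two lists adds the tensors, and
  scaling the left entries scales the tensor. The lift may be computed from any of them.\<close>

lemma linear_tensor_lift:
  assumes "vector_space s'" "bilinear_map s s' f"
  shows "Vector_Spaces.linear s s' (\<lambda>x. tensor_lift s f (\<Delta> x))"
proof (rule linearI [OF vector_space_s assms(1)])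
  fix x y c
  have "\<Delta> (x + y) = (\<Sum>(a, b)\<leftarrow>sweedler x @ sweedler y. tensor s a b)"
    by (simp add: comult_linear comult_sweedler [symmetric])
  from tensor_lift_eq [OF assms this]
  show "tensor_lift s f (\<Delta> (x + y)) = tensor_lift s f (\<Delta> x) + tensor_lift s f (\<Delta> y)"
    by (simp add: tensor_lift_sweedler [OF assms])
  have t: "tscale c (\<Sum>(a, b)\<leftarrow>xs. tensor s a b) = (\<Sum>(a, b)\<leftarrow>map (\<lambda>(a, b). (s c a, b)) xs. tensor s a b)" for xs
    using bilinear_map_tensor [OF vector_space_s]
    by (induction xs) (auto simp: fun_eq_iff bilinear_map_def Vector_Spaces.linear_iff distrib_left)
  have *: "\<Delta> (s c x) = (\<Sum>(a, b)\<leftarrow>map (\<lambda>(a, b). (s c a, b)) (sweedler x). tensor s a b)"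
    unfolding comult_linear t [symmetric] by (simp add: comult_sweedler [symmetric])
  interpret vector_space s' by fact
  have f: "f (s c a) b = s' c (f a b)" for a b
    using assms(2) by (simp add: bilinear_map_def Vector_Spaces.linear_iff)
  have "(\<Sum>(a, b)\<leftarrow>map (\<lambda>(a, b). (s c a, b)) xs. f a b) = s' c (\<Sum>(a, b)\<leftarrow>xs. f a b)" for xs
    by (induction xs) (auto simp: f scale_right_distrib)
  then show "tensor_lift s f (\<Delta> (s c x)) = s' c (tensor_lift s f (\<Delta> x))"
    unfolding tensor_lift_eq [OF assms *] unfolding tensor_lift_sweedler [OF assms] .
qed

text \<open>The axiom compares nested \<open>tensor_lift\<close>s. They unfold to sums because the
  inner lift is bilinear in the outer pair: in one slot by \<open>linear_tensor_lift\<close>, in the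
  other by linearity of each summand.\<close>

lemma coassoc:
  "(\<Sum>(a, b)\<leftarrow>sweedler x. \<Sum>(c, d)\<leftarrow>sweedler a. tensor3 s c d b) =
   (\<Sum>(a, b)\<leftarrow>sweedler x. \<Sum>(c, d)\<leftarrow>sweedler b. tensor3 s a c d)"
proof -
  note t3 = tensor3_trilinear [OF vector_space_s]
  have b1: "bilinear_map s tscale (\<lambda>c d. tensor3 s c d b)" and b2: "bilinear_map s tscale (\<lambda>c d. tensor3 s b c d)" for b
    using t3 by (auto simp: bilinear_map_def)
  have e1: "tensor_lift s (\<lambda>c d. tensor3 s c d b) (\<Delta> a) = (\<Sum>(c, d)\<leftarrow>sweedler a. tensor3 s c d b)"
    and e2: "tensor_lift s (\<lambda>c d. tensor3 s b c d) (\<Delta> a) = (\<Sum>(c, d)\<leftarrow>sweedler a. tensor3 s b c d)" for a b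
    by (rule tensor_lift_sweedler [OF vector_space_tscale]; fact)+
  have "bilinear_map s tscale (\<lambda>a b. tensor_lift s (\<lambda>c d. tensor3 s c d b) (\<Delta> a))"
    unfolding bilinear_map_def
  proof (intro conjI allI)
    show "Vector_Spaces.linear s tscale (\<lambda>b. tensor_lift s (\<lambda>c d. tensor3 s c d b) (\<Delta> a))" for a
      unfolding e1 by (intro linear_sum_list_pairs vector_space_s vector_space_tscale t3)
    show "Vector_Spaces.linear s tscale (\<lambda>a. tensor_lift s (\<lambda>c d. tensor3 s c d b) (\<Delta> a))" for b
      by (rule linear_tensor_lift [OF vector_space_tscale b1])
  qed
  from tensor_lift_sweedler [OF vector_space_tscale this]
  have l: "tensor_lift s (\<lambda>a b. tensor_lift s (\<lambda>c d. tensor3 s c d b) (\<Delta> a)) (\<Delta> x) =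
    (\<Sum>(a, b)\<leftarrow>sweedler x. \<Sum>(c, d)\<leftarrow>sweedler a. tensor3 s c d b)" by (simp add: e1)
  have "bilinear_map s tscale (\<lambda>a b. tensor_lift s (\<lambda>c d. tensor3 s a c d) (\<Delta> b))"
    unfolding bilinear_map_def
  proof (intro conjI allI)
    show "Vector_Spaces.linear s tscale (\<lambda>a. tensor_lift s (\<lambda>c d. tensor3 s a c d) (\<Delta> b))" for b
      unfolding e2 by (intro linear_sum_list_pairs vector_space_s vector_space_tscale t3)
    show "Vector_Spaces.linear s tscale (\<lambda>b. tensor_lift s (\<lambda>c d. tensor3 s a c d) (\<Delta> b))" for a
      by (rule linear_tensor_lift [OF vector_space_tscale b2])
  qed
  from tensor_lift_sweedler [OF vector_space_tscale this]
  have r: "tensor_lift s (\<lambda>a b. tensor_lift s (\<lambda>c d. tensor3 s a c d) (\<Delta> b)) (\<Delta> x) =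
    (\<Sum>(a, b)\<leftarrow>sweedler x. \<Sum>(c, d)\<leftarrow>sweedler b. tensor3 s a c d)" by (simp add: e2)
  show ?thesis using hopf_unfolded l r by simp
qed

lemma counit_left: "(\<Sum>(a, b)\<leftarrow>sweedler x. s (\<epsilon> a) b) = x"
proof -
  have "bilinear_map s s (\<lambda>a b. s (\<epsilon> a) b)"
    by (intro bilinear_mapI vector_space_s) (auto simp: hs.scale_left_distrib hs.scale_right_distrib mult.commute)
  from tensor_lift_sweedler [OF vector_space_s this, of x] hopf_unfolded show ?thesis by simp
qed

lemma counit_right: "(\<Sum>(a, b)\<leftarrow>sweedler x. s (\<epsilon> b) a) = x"
proof -
  have "bilinear_map s s (\<lambda>a b. s (\<epsilon> b) a)"
    by (intro bilinear_mapI vector_space_s) (auto simp: hs.scale_left_distrib hs.scale_right_distrib mult.commute)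
  from tensor_lift_sweedler [OF vector_space_s this, of x] hopf_unfolded show ?thesis by simp
qed

text \<open>With this representation the value of a convolution at \<open>x * y\<close> becomes a
  double sum over the representations of the two factors.\<close>

lemma comult_mult:
  "\<Delta> (x * y) = (\<Sum>(a, b)\<leftarrow>concat (map (\<lambda>(a, b). map (\<lambda>(c, d). (a * c, b * d)) (sweedler y)) (sweedler x)). tensor s a b)"
proof -
  note bt = bilinear_map_tensor [OF vector_space_s, unfolded bilinear_map_def Vector_Spaces.linear_iff]
  have bl: "bilinear_map s tscale (\<lambda>c d. tensor s (a * c) (b * d))" for a b
    using bt by (intro bilinear_mapI vector_space_s vector_space_tscale) (auto simp: distrib_left s_mult(2) [symmetric])
  have br: "bilinear_map s tscale (\<lambda>a b. tensor s (a * c) (b * d))" for c d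
    using bt by (intro bilinear_mapI vector_space_s vector_space_tscale) (auto simp: distrib_right s_mult(1) [symmetric])
  have e: "tensor_lift s (\<lambda>c d. tensor s (a * c) (b * d)) (\<Delta> y) = (\<Sum>(c, d)\<leftarrow>sweedler y. tensor s (a * c) (b * d))" for a b
    by (rule tensor_lift_sweedler [OF vector_space_tscale bl])
  have b: "bilinear_map s tscale (\<lambda>a b. tensor_lift s (\<lambda>c d. tensor s (a * c) (b * d)) (\<Delta> y))"
    unfolding e bilinear_map_def
    using br by (auto intro!: linear_sum_list_pairs vector_space_s vector_space_tscale simp: bilinear_map_def)
  have m: "(\<Sum>(a, b)\<leftarrow>concat (map (\<lambda>(a, b). map (\<lambda>(c, d). (a * c, b * d)) ys) xs). tensor s a b) =
      (\<Sum>(a, b)\<leftarrow>xs. \<Sum>(c, d)\<leftarrow>ys. tensor s (a * c) (b * d))" for xs ys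
    by (induction xs) (auto simp: o_def case_prod_unfold)
  have "\<Delta> (x * y) = tensor_mult s (\<Delta> x) (\<Delta> y)" using hopf_unfolded by simp
  then show ?thesis
    unfolding tensor_mult_def tensor_lift_sweedler [OF vector_space_tscale b] m by (simp add: e)
qed

section \<open>Grading and degree\<close>

lemma comult_V:
  assumes "x \<in> V n"
  obtains xs where "\<Delta> x = (\<Sum>(a, b)\<leftarrow>xs. tensor s a b)" "set xs \<subseteq> (\<Union>i\<le>n. V i \<times> V (n - i))"
  using assms graded unfolding graded_connected_hopf_algebra_def tensor_sums_def by blast

lemma one_in_V0: "1 \<in> V 0"
  using graded by (simp add: graded_connected_hopf_algebra_def)

text \<open>Connectedness in the form used for nilpotency: a linear map vanishing at 1 vanishes on
  \<open>V 0\<close>. Since 1 is nonzero, it is a nonzero multiple of the only basis vector.\<close>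

lemma V0_scalar:
  assumes "x \<in> V 0" shows "\<exists>c. x = s c 1"
proof -
  have d: "hs.dim (V 0) = 1" using graded by (simp add: graded_connected_hopf_algebra_def)
  obtain B where B: "B \<subseteq> V 0" "hs.independent B" "V 0 \<subseteq> hs.span B" "card B = hs.dim (V 0)"
    using hs.basis_exists by blast
  then obtain b where b: "B = {b}" using d by (metis card_1_singletonE)
  have "1 \<in> hs.span {b}" using one_in_V0 B b by blast
  then obtain c where c: "1 = s c b" by (auto simp: hs.span_singleton)
  have "x \<in> hs.span {b}" using assms B b by blast
  then obtain e where e: "x = s e b" by (auto simp: hs.span_singleton)
  have "c \<noteq> 0" using c hs.scale_zero_left [of b] by (metis zero_neq_one)
  then have "x = s (e / c) 1" unfolding c e by simp
  then show ?thesis ..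
qed

definition filt :: "nat \<Rightarrow> 'h set" where "filt n = hs.span (\<Union>i\<le>n. V i)"

lemma filt_exhaust: "\<exists>n. x \<in> filt n"
proof -
  obtain c where c: "\<forall>n. c n \<in> V n" "finite {n. c n \<noteq> 0}" "x = (\<Sum>n | c n \<noteq> 0. c n)"
    using graded unfolding graded_connected_hopf_algebra_def direct_sum_decomposition_def by metis
  obtain N where N: "\<forall>n\<in>{n. c n \<noteq> 0}. n \<le> N"
    using c(2) finite_nat_set_iff_bounded_le by blast
  have "x \<in> filt N"
    unfolding c(3) filt_def by (intro hs.span_sum hs.span_base) (use N c(1) in auto)
  then show ?thesis ..
qed

text \<open>A filtration degree, so that it makes sense for inhomogeneous elements too. It serves as
  the order at which series are truncated.\<close>

definition deg :: "'h \<Rightarrow> nat" where "deg x = (LEAST n. x \<in> filt n)"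

lemma deg_filt: "x \<in> filt (deg x)"
  unfolding deg_def using filt_exhaust by (rule LeastI_ex)

end

section \<open>Convolution of linear maps into an algebra\<close>

locale hopf_target = graded_hopf H V
  for H :: "('k::real_or_complex, 'h::ring_1) hopf" and V :: "nat \<Rightarrow> 'h set" +
  fixes sB :: "'k \<Rightarrow> 'b::{comm_ring, comm_monoid_mult, topological_space} \<Rightarrow> 'b"
  assumes algebra: "algebra_over sB"
begin

sublocale bs: vector_space sB
  using algebra by (simp add: algebra_over_def)

lemma sB_mult: "sB c (x * y) = sB c x * y" "sB c (x * y) = x * sB c y"
  using algebra unfolding algebra_over_def by metis+

lemma sB_mult_mult: "sB c x * sB d y = sB (c * d) (x * y)"
  by (simp add: sB_mult [symmetric] bs.scale_scale mult.commute)

abbreviation lin where "lin \<equiv> Vector_Spaces.linear s sB"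
abbreviation conv (infixl "\<star>" 70) where "conv \<equiv> convolution H"
abbreviation unit where "unit \<equiv> conv_unit H sB"
abbreviation (input) scl (infixr "\<cdot>" 75) where "scl \<equiv> \<lambda>c \<phi> x. sB c (\<phi> x)"

lemma lin_iff: "lin \<phi> \<longleftrightarrow> (\<forall>x y. \<phi> (x + y) = \<phi> x + \<phi> y) \<and> (\<forall>c x. \<phi> (s c x) = sB c (\<phi> x))"
  using vector_space_s bs.vector_space_axioms by (simp add: Vector_Spaces.linear_iff)

lemma linD: "lin \<phi> \<Longrightarrow> \<phi> (x + y) = \<phi> x + \<phi> y" "lin \<phi> \<Longrightarrow> \<phi> (s c x) = sB c (\<phi> x)"
  by (simp_all add: lin_iff)

lemma lin_add: "lin \<phi> \<Longrightarrow> lin \<psi> \<Longrightarrow> lin (\<phi> + \<psi>)"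
  and lin_diff: "lin \<phi> \<Longrightarrow> lin \<psi> \<Longrightarrow> lin (\<phi> - \<psi>)"
  and lin_minus: "lin \<phi> \<Longrightarrow> lin (- \<phi>)"
  and lin_scl: "lin \<phi> \<Longrightarrow> lin (c \<cdot> \<phi>)"
  and lin_zero: "lin 0"
  and lin_unit: "lin unit"
  by (auto simp: lin_iff bs.scale_right_distrib bs.scale_right_diff_distrib bs.scale_left_commute
      conv_unit_def bs.scale_left_distrib)

lemma bilinear_mult: "lin \<phi> \<Longrightarrow> lin \<psi> \<Longrightarrow> bilinear_map s sB (\<lambda>a b. \<phi> a * \<psi> b)"
  by (intro bilinear_mapI vector_space_s bs.vector_space_axioms)
    (auto simp: lin_iff distrib_left distrib_right sB_mult [symmetric])

text \<open>Stated for an arbitrary representation: graded ones serve for nilpotency, those of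
  \<open>comult_mult\<close> for values at products, and a singleton for the value at 1.\<close>

lemma conv_eq:
  assumes "lin \<phi>" "lin \<psi>" "\<Delta> x = (\<Sum>(a, b)\<leftarrow>xs. tensor s a b)"
  shows "(\<phi> \<star> \<psi>) x = (\<Sum>(a, b)\<leftarrow>xs. \<phi> a * \<psi> b)"
  unfolding convolution_def
  by (rule tensor_lift_eq [OF bs.vector_space_axioms bilinear_mult [OF assms(1,2)] assms(3)])

lemmas conv_sweedler = conv_eq [OF _ _ comult_sweedler]

lemma lin_conv: "lin \<phi> \<Longrightarrow> lin \<psi> \<Longrightarrow> lin (\<phi> \<star> \<psi>)"
  unfolding convolution_def
  by (rule linear_tensor_lift [OF bs.vector_space_axioms bilinear_mult])

lemma unit_conv: assumes "lin \<phi>" shows "unit \<star> \<phi> = \<phi>"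
proof
  fix x
  have "(unit \<star> \<phi>) x = (\<Sum>(a, b)\<leftarrow>sweedler x. \<phi> (s (\<epsilon> a) b))"
    unfolding conv_sweedler [OF lin_unit assms] by (simp add: linD(2) [OF assms] conv_unit_def sB_mult(1) [symmetric])
  also have "\<dots> = \<phi> (\<Sum>(a, b)\<leftarrow>sweedler x. s (\<epsilon> a) b)"
    by (simp add: linear_sum_list [OF assms] case_prod_unfold)
  finally show "(unit \<star> \<phi>) x = \<phi> x" by (simp add: counit_left)
qed

lemma conv_unit: assumes "lin \<phi>" shows "\<phi> \<star> unit = \<phi>"
proof
  fix x
  have "(\<phi> \<star> unit) x = (\<Sum>(a, b)\<leftarrow>sweedler x. \<phi> (s (\<epsilon> b) a))"
    unfolding conv_sweedler [OF assms lin_unit] by (simp add: linD(2) [OF assms] conv_unit_def sB_mult(2) [symmetric])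
  also have "\<dots> = \<phi> (\<Sum>(a, b)\<leftarrow>sweedler x. s (\<epsilon> b) a)"
    by (simp add: linear_sum_list [OF assms] case_prod_unfold)
  finally show "(\<phi> \<star> unit) x = \<phi> x" by (simp add: counit_right)
qed

text \<open>Coassociativity is an equation between functionals on trilinear forms. It is evaluated
  at the product of the three maps followed by a functional \<open>g\<close> on the target, and such
  functionals separate points.\<close>

lemma conv_assoc:
  assumes "lin \<phi>" "lin \<psi>" "lin \<theta>"
  shows "(\<phi> \<star> \<psi>) \<star> \<theta> = \<phi> \<star> (\<psi> \<star> \<theta>)"
proof
  fix x
  note lc = lin_conv [OF assms(1,2)] lin_conv [OF assms(2,3)]
  have "((\<phi> \<star> \<psi>) \<star> \<theta>) x = (\<Sum>(a, b)\<leftarrow>sweedler x. \<Sum>(c, d)\<leftarrow>sweedler a. \<phi> c * \<psi> d * \<theta> b)"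
    by (simp add: conv_sweedler assms lc case_prod_unfold sum_list_mult_const)
  also have "\<dots> = (\<Sum>(a, b)\<leftarrow>sweedler x. \<Sum>(c, d)\<leftarrow>sweedler b. \<phi> a * \<psi> c * \<theta> d)"
  proof (rule linear_functional_separates [OF bs.vector_space_axioms])
    fix g assume g: "Vector_Spaces.linear sB (*) g"
    let ?\<tau> = "\<lambda>c d b. g (\<phi> c * \<psi> d * \<theta> b)"
    have "trilinear_form s ?\<tau>"
      unfolding trilinear_form_def bilinear_form_def
      using assms by (intro conjI allI linear_comp [OF _ g])
        (auto simp: lin_iff distrib_left distrib_right sB_mult [symmetric])
    then have t: "tensor3 s c d b ?\<tau> = ?\<tau> c d b" for c d b by (simp add: tensor3_def)
    have "(\<Sum>(a, b)\<leftarrow>sweedler x. \<Sum>(c, d)\<leftarrow>sweedler a. tensor3 s c d b) ?\<tau> =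
          (\<Sum>(a, b)\<leftarrow>sweedler x. \<Sum>(c, d)\<leftarrow>sweedler b. tensor3 s a c d) ?\<tau>"
      by (simp only: coassoc)
    then show "g (\<Sum>(a, b)\<leftarrow>sweedler x. \<Sum>(c, d)\<leftarrow>sweedler a. \<phi> c * \<psi> d * \<theta> b) =
        g (\<Sum>(a, b)\<leftarrow>sweedler x. \<Sum>(c, d)\<leftarrow>sweedler b. \<phi> a * \<psi> c * \<theta> d)"
      by (simp add: sum_list_fun_apply case_prod_unfold t linear_sum_list [OF g])
  qed
  also have "\<dots> = (\<phi> \<star> (\<psi> \<star> \<theta>)) x"
    by (simp add: conv_sweedler assms lc case_prod_unfold sum_list_const_mult mult.assoc)
  finally show "((\<phi> \<star> \<psi>) \<star> \<theta>) x = (\<phi> \<star> (\<psi> \<star> \<theta>)) x" .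
qed

lemma conv_add_left: "lin \<phi> \<Longrightarrow> lin \<phi>' \<Longrightarrow> lin \<psi> \<Longrightarrow> (\<phi> + \<phi>') \<star> \<psi> = \<phi> \<star> \<psi> + \<phi>' \<star> \<psi>"
  and conv_add_right: "lin \<phi> \<Longrightarrow> lin \<phi>' \<Longrightarrow> lin \<psi> \<Longrightarrow> \<psi> \<star> (\<phi> + \<phi>') = \<psi> \<star> \<phi> + \<psi> \<star> \<phi>'"
  and conv_scl_left: "lin \<phi> \<Longrightarrow> lin \<psi> \<Longrightarrow> (c \<cdot> \<phi>) \<star> \<psi> = c \<cdot> (\<phi> \<star> \<psi>)"
  and conv_scl_right: "lin \<phi> \<Longrightarrow> lin \<psi> \<Longrightarrow> \<psi> \<star> (c \<cdot> \<phi>) = c \<cdot> (\<psi> \<star> \<phi>)"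
  by (auto simp: fun_eq_iff conv_sweedler lin_add lin_scl distrib_right distrib_left sum_list_addf case_prod_unfold
      bs.scale_sum_list sB_mult [symmetric])

lemma conv_diff_left: "lin \<phi> \<Longrightarrow> lin \<phi>' \<Longrightarrow> lin \<psi> \<Longrightarrow> (\<phi> - \<phi>') \<star> \<psi> = \<phi> \<star> \<psi> - \<phi>' \<star> \<psi>"
  using conv_add_left [of "\<phi> - \<phi>'" \<phi>' \<psi>] by (simp add: lin_diff)

lemma conv_diff_right: "lin \<phi> \<Longrightarrow> lin \<phi>' \<Longrightarrow> lin \<psi> \<Longrightarrow> \<psi> \<star> (\<phi> - \<phi>') = \<psi> \<star> \<phi> - \<psi> \<star> \<phi>'"
  using conv_add_right [of "\<phi> - \<phi>'" \<phi>' \<psi>] by (simp add: lin_diff)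

lemma conv_mult_arg:
  assumes "lin \<phi>" "lin \<psi>"
  shows "(\<phi> \<star> \<psi>) (x * y) = (\<Sum>(a, b)\<leftarrow>sweedler x. \<Sum>(c, d)\<leftarrow>sweedler y. \<phi> (a * c) * \<psi> (b * d))"
proof -
  have m: "(\<Sum>(a, b)\<leftarrow>concat (map (\<lambda>(a, b). map (\<lambda>(c, d). (a * c, b * d)) ys) xs). \<phi> a * \<psi> b) =
      (\<Sum>(a, b)\<leftarrow>xs. \<Sum>(c, d)\<leftarrow>ys. \<phi> (a * c) * \<psi> (b * d))" for xs ys
    by (induction xs) (auto simp: o_def case_prod_unfold)
  show ?thesis by (simp only: conv_eq [OF assms comult_mult] m)
qed

lemma conv_one: "lin \<phi> \<Longrightarrow> lin \<psi> \<Longrightarrow> (\<phi> \<star> \<psi>) 1 = \<phi> 1 * \<psi> 1"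
  using conv_eq [of \<phi> \<psi> 1 "[(1, 1)]"] by (simp add: comult_one)

end

section \<open>Power series in the convolution algebra\<close>

text \<open>\<open>fps_ln 1\<close> is log(1 + X), the compositional inverse of exp(X) - 1. This is
  the reason for the summand 1 here and for the subtraction of \<open>unit\<close> in
  \<open>logc\<close>.\<close>

lemma fps_exp_compose_fps_ln: "fps_exp (1::'a::field_char_0) oo fps_ln 1 = 1 + fps_X"
proof -
  let ?e = "fps_exp (1::'a) - 1"
  have "?e oo fps_ln 1 = fps_X"
    unfolding fps_ln_fps_exp_inv [OF one_neq_zero] by (rule fps_inv_right) auto
  then have "(fps_exp (1::'a) oo fps_ln 1) - 1 = fps_X" by (simp add: fps_compose_sub_distrib)
  then show ?thesis by (simp add: diff_eq_eq add.commute)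
qed

lemma fps_ln_compose_fps_exp: "fps_ln (1::'a::field_char_0) oo (fps_exp 1 - 1) = fps_X"
  unfolding fps_ln_fps_exp_inv [OF one_neq_zero] by (rule fps_inv) auto

text \<open>A Cauchy product of finite sums has no remainder if everything beyond the diagonal i + j
  = N vanishes, as nilpotency provides.\<close>

lemma sum_square_triangle:
  fixes f :: "nat \<Rightarrow> nat \<Rightarrow> 'a::comm_monoid_add"
  assumes "\<And>i j. i \<le> N \<Longrightarrow> j \<le> N \<Longrightarrow> N < i + j \<Longrightarrow> f i j = 0"
  shows "(\<Sum>i\<le>N. \<Sum>j\<le>N. f i j) = (\<Sum>k\<le>N. \<Sum>i\<le>k. f i (k - i))"
proof -
  have "(\<Sum>i\<le>N. \<Sum>j\<le>N. f i j) = (\<Sum>(i, j)\<in>{..N} \<times> {..N}. f i j)"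
    by (simp add: sum.cartesian_product)
  also have "\<dots> = (\<Sum>(i, j)\<in>{(i, j). i + j \<le> N}. f i j)"
    by (rule sum.mono_neutral_right) (use assms in \<open>auto simp flip: not_less\<close>)
  also have "\<dots> = (\<Sum>k\<le>N. \<Sum>i\<le>k. f i (k - i))" by (rule sum.triangle_reindex_eq)
  finally show ?thesis .
qed

lemma sum_list_prod_swap:
  fixes F G :: "'p \<Rightarrow> 'p \<Rightarrow> 'b::comm_ring"
  shows "(\<Sum>(a, b)\<leftarrow>xs. \<Sum>(c, d)\<leftarrow>ys. F a b * G c d) = (\<Sum>(a, b)\<leftarrow>xs. F a b) * (\<Sum>(c, d)\<leftarrow>ys. G c d)"
  by (simp add: case_prod_unfold sum_list_const_mult sum_list_mult_const)

text \<open>Applying a functional to the coefficients leaves a scalar polynomial that vanishes at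
  all natural numbers, and these are infinitely many in characteristic zero.\<close>

lemma polynomial_vanishes_on_nat:
  fixes sc :: "'k::real_normed_field \<Rightarrow> 'b::ab_group_add \<Rightarrow> 'b"
  assumes vs: "vector_space sc" and z: "\<And>n::nat. (\<Sum>k\<le>N. sc (of_nat n ^ k) (c k)) = 0" and "k \<le> N"
  shows "c k = 0"
proof (rule linear_functional_separates [OF vs])
  fix g assume g: "Vector_Spaces.linear sc (*) g"
  have "(\<Sum>k\<le>N. g (c k) * of_nat n ^ k) = 0" for n :: nat
    using arg_cong [OF z [of n], of g] g
    by (simp add: linear_sum [OF g] linear_0 [OF g] Vector_Spaces.linear_iff mult.commute)
  then have "range of_nat \<subseteq> {x. (\<Sum>k\<le>N. g (c k) * x ^ k) = 0}" by auto
  moreover have "infinite (range (of_nat :: nat \<Rightarrow> 'k))"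
    by (rule range_inj_infinite) (simp add: inj_of_nat)
  ultimately have "infinite {x. (\<Sum>k\<le>N. g (c k) * x ^ k) = 0}" using finite_subset by blast
  then have "g (c k) = 0"
    using \<open>k \<le> N\<close> by (auto simp: polyfun_finite_roots)
  then show "g (c k) = g 0" by (simp add: linear_0 [OF g])
qed

context hopf_target
begin

section \<open>Evaluation of power series at maps vanishing at 1\<close>

abbreviation aug where "aug \<phi> \<equiv> lin \<phi> \<and> \<phi> 1 = 0"

definition cpow where "cpow \<phi> k = (conv \<phi> ^^ k) unit"

lemma cpow_0 [simp]: "cpow \<phi> 0 = unit"
  and cpow_Suc: "cpow \<phi> (Suc k) = \<phi> \<star> cpow \<phi> k"
  by (simp_all add: cpow_def)

lemma lin_cpow: "lin \<phi> \<Longrightarrow> lin (cpow \<phi> k)"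
  by (induction k) (auto simp: cpow_Suc lin_unit lin_conv)

lemma cpow_1: "lin \<phi> \<Longrightarrow> cpow \<phi> (Suc 0) = \<phi>"
  by (simp add: cpow_Suc conv_unit)

lemma cpow_add: "lin \<phi> \<Longrightarrow> cpow \<phi> (m + n) = cpow \<phi> m \<star> cpow \<phi> n"
  by (induction m) (auto simp: cpow_Suc unit_conv lin_cpow conv_assoc)

lemma cpow_scl: "lin \<phi> \<Longrightarrow> cpow (c \<cdot> \<phi>) k = c ^ k \<cdot> cpow \<phi> k"
  by (induction k) (auto simp: cpow_Suc conv_scl_left conv_scl_right lin_cpow lin_scl)

text \<open>Split the coproduct of \<open>x\<close> into parts of degrees i and n - i. For i = 0 the
  left factor is a scalar, killed by \<phi>; otherwise the right factor has degree below n and is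
  killed by the k-th power.\<close>

lemma cpow_vanish_V: "aug \<phi> \<Longrightarrow> x \<in> V n \<Longrightarrow> n < k \<Longrightarrow> cpow \<phi> k x = 0"
proof (induction k arbitrary: n x)
  case (Suc k)
  obtain xs where xs: "\<Delta> x = (\<Sum>(a, b)\<leftarrow>xs. tensor s a b)" "set xs \<subseteq> (\<Union>i\<le>n. V i \<times> V (n - i))"
    by (rule comult_V [OF Suc.prems(2)])
  have "\<phi> a * cpow \<phi> k b = 0" if ab: "(a, b) \<in> set xs" for a b
  proof -
    obtain i where i: "i \<le> n" "a \<in> V i" "b \<in> V (n - i)" using ab xs(2) by blast
    show ?thesis
    proof (cases "i = 0")
      case True
      then obtain c where "a = s c 1" using V0_scalar i by blast
      then show ?thesis using Suc.prems by (simp add: linD)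
    next
      case False
      then have "cpow \<phi> k b = 0" using Suc.IH [OF Suc.prems(1) i(3)] i Suc.prems by auto
      then show ?thesis by simp
    qed
  qed
  then have "(\<Sum>(a, b)\<leftarrow>xs. \<phi> a * cpow \<phi> k b) = (\<Sum>p\<leftarrow>xs. 0)"
    by (intro arg_cong[where f=sum_list] map_cong) auto
  then show ?case
    using Suc.prems by (simp add: cpow_Suc conv_eq [OF _ lin_cpow xs(1)])
qed simp

lemma cpow_vanish:
  assumes "aug \<phi>" "deg x < k" shows "cpow \<phi> k x = 0"
proof -
  have "x \<in> hs.span (\<Union>i\<le>deg x. V i)" using deg_filt by (simp add: filt_def)
  then show ?thesis
  proof (induction rule: hs.span_induct_alt)
    case base
    then show ?case using assms by (simp add: linear_0 [OF lin_cpow])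
  next
    case (step c v y)
    have "cpow \<phi> k v = 0" using step(1) assms by (auto intro: cpow_vanish_V)
    then show ?case using step assms by (simp add: linD [OF lin_cpow])
  qed
qed

text \<open>The truncation at \<open>deg x\<close> makes this total and free of limits. It agrees
  with the full series when \<open>aug \<phi>\<close> holds.\<close>

definition ser :: "'k fps \<Rightarrow> ('h \<Rightarrow> 'b) \<Rightarrow> 'h \<Rightarrow> 'b"
  where "ser c \<phi> x = (\<Sum>k\<le>deg x. sB (fps_nth c k) (cpow \<phi> k x))"

text \<open>\<open>deg\<close> does not behave additively along sums and coproducts, so values at
  different elements are compared after all truncations have been raised to a common bound.\<close>

lemma ser_eq:
  assumes "aug \<phi>" "deg x \<le> N"
  shows "ser c \<phi> x = (\<Sum>k\<le>N. sB (fps_nth c k) (cpow \<phi> k x))"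
  unfolding ser_def
  by (rule sum.mono_neutral_left) (use assms in \<open>auto simp: cpow_vanish not_le\<close>)

lemma lin_ser: assumes "aug \<phi>" shows "lin (ser c \<phi>)"
  unfolding lin_iff
proof (intro conjI allI)
  fix x y a
  have l: "lin (cpow \<phi> k)" for k using assms lin_cpow by blast
  define N where "N = Max {deg x, deg y, deg (x + y), deg (s a x)}"
  have N: "deg x \<le> N" "deg y \<le> N" "deg (x + y) \<le> N" "deg (s a x) \<le> N" by (auto simp: N_def)
  show "ser c \<phi> (x + y) = ser c \<phi> x + ser c \<phi> y"
    by (simp add: ser_eq [OF assms N(1)] ser_eq [OF assms N(2)] ser_eq [OF assms N(3)] linD [OF l] bs.scale_right_distrib sum.distrib)
  show "ser c \<phi> (s a x) = sB a (ser c \<phi> x)"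
    by (simp add: ser_eq [OF assms N(1)] ser_eq [OF assms N(4)] linD [OF l] bs.scale_sum_right mult.commute)
qed

lemma deg_one: "deg 1 = 0"
proof -
  have "1 \<in> filt 0" unfolding filt_def by (rule hs.span_base) (use one_in_V0 in auto)
  then show ?thesis by (simp add: deg_def)
qed

lemma unit_one [simp]: "unit 1 = 1"
  by (simp add: conv_unit_def)

lemma ser_at_one: "ser c \<phi> 1 = sB (fps_nth c 0) 1"
  by (simp add: ser_def deg_one)

lemma aug_ser: "aug \<phi> \<Longrightarrow> fps_nth c 0 = 0 \<Longrightarrow> aug (ser c \<phi>)"
  by (simp add: lin_ser ser_at_one)

lemma ser_add: "ser (c + d) \<phi> = ser c \<phi> + ser d \<phi>"
  by (auto simp: fun_eq_iff ser_def bs.scale_left_distrib sum.distrib)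

lemma ser_diff: "ser (c - d) \<phi> = ser c \<phi> - ser d \<phi>"
  by (auto simp: fun_eq_iff ser_def bs.scale_left_diff_distrib sum_subtractf)

lemma ser_one: "ser 1 \<phi> = unit"
proof
  fix x
  have "ser 1 \<phi> x = (\<Sum>k\<le>deg x. if k = 0 then unit x else 0)"
    unfolding ser_def by (rule sum.cong) auto
  then show "ser 1 \<phi> x = unit x" by simp
qed

lemma ser_X: assumes "aug \<phi>" shows "ser fps_X \<phi> = \<phi>"
proof
  fix x
  have "ser fps_X \<phi> x = (\<Sum>k\<le>Suc (deg x). if k = Suc 0 then \<phi> x else 0)"
    unfolding ser_eq [OF assms le_SucI [OF order_refl]] using assms
    by (intro sum.cong) (auto simp: fps_X_nth cpow_1)
  then show "ser fps_X \<phi> x = \<phi> x" by simp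
qed

lemma ser_mult: assumes "aug \<phi>" shows "ser (c * d) \<phi> = ser c \<phi> \<star> ser d \<phi>"
proof
  fix x
  \<comment> \<open>The entries of the chosen representation may have larger degree than
    \<open>x\<close> itself.\<close>
  define N where "N = Max (insert (deg x) (deg ` fst ` set (sweedler x) \<union> deg ` snd ` set (sweedler x)))"
  have N: "deg x \<le> N" "\<And>a b. (a, b) \<in> set (sweedler x) \<Longrightarrow> deg a \<le> N" "\<And>a b. (a, b) \<in> set (sweedler x) \<Longrightarrow> deg b \<le> N"
    unfolding N_def by (force intro!: Max_ge)+
  have l: "lin \<phi>" using assms by simp
  have "(ser c \<phi> \<star> ser d \<phi>) x = (\<Sum>(a, b)\<leftarrow>sweedler x. \<Sum>i\<le>N. \<Sum>j\<le>N. sB (fps_nth c i * fps_nth d j) (cpow \<phi> i a * cpow \<phi> j b))"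
    unfolding conv_sweedler [OF lin_ser [OF assms] lin_ser [OF assms]]
    by (intro arg_cong[where f=sum_list] map_cong)
      (auto simp: ser_eq [OF assms N(2)] ser_eq [OF assms N(3)] sum_product sB_mult_mult)
  also have "\<dots> = (\<Sum>i\<le>N. \<Sum>j\<le>N. sB (fps_nth c i * fps_nth d j) (cpow \<phi> (i + j) x))"
    by (simp add: case_prod_unfold sum_sum_list_swap bs.scale_sum_list cpow_add [OF l] conv_sweedler [OF lin_cpow [OF l] lin_cpow [OF l]])
  also have "\<dots> = (\<Sum>k\<le>N. \<Sum>i\<le>k. sB (fps_nth c i * fps_nth d (k - i)) (cpow \<phi> (i + (k - i)) x))"
    by (rule sum_square_triangle) (use N(1) in \<open>auto intro!: cpow_vanish [OF assms]\<close>)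
  also have "\<dots> = ser (c * d) \<phi> x"
    by (simp add: ser_eq [OF assms N(1)] fps_mult_nth bs.scale_sum_left atLeast0AtMost)
  finally show "ser (c * d) \<phi> x = (ser c \<phi> \<star> ser d \<phi>) x" by simp
qed

lemma ser_power: "aug \<phi> \<Longrightarrow> ser (c ^ k) \<phi> = cpow (ser c \<phi>) k"
  by (induction k) (auto simp: ser_one ser_mult cpow_Suc)

text \<open>The double sum may be completed to a square before swapping: \<open>d\<close> has no
  constant term, so coefficient n of \<open>d ^ i\<close> vanishes for n < i.\<close>

lemma ser_compose:
  assumes "aug \<phi>" "fps_nth d 0 = 0"
  shows "ser (c oo d) \<phi> = ser c (ser d \<phi>)"
proof
  fix x
  let ?N = "deg x"
  have z: "fps_nth (d ^ i) n = 0" if "n < i" for n i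
    using startsby_zero_power_prefix [OF assms(2)] that by auto
  have "ser (c oo d) \<phi> x = (\<Sum>n\<le>?N. \<Sum>i\<le>n. sB (fps_nth c i * fps_nth (d ^ i) n) (cpow \<phi> n x))"
    by (simp add: ser_def fps_compose_nth bs.scale_sum_left atLeast0AtMost)
  also have "\<dots> = (\<Sum>n\<le>?N. \<Sum>i\<le>?N. sB (fps_nth c i * fps_nth (d ^ i) n) (cpow \<phi> n x))"
    by (intro sum.cong refl sum.mono_neutral_left) (auto simp: z not_le)
  also have "\<dots> = (\<Sum>i\<le>?N. \<Sum>n\<le>?N. sB (fps_nth c i * fps_nth (d ^ i) n) (cpow \<phi> n x))"
    by (rule sum.swap)
  also have "\<dots> = (\<Sum>i\<le>?N. sB (fps_nth c i) (ser (d ^ i) \<phi> x))"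
    by (simp add: ser_def bs.scale_sum_right)
  finally show "ser (c oo d) \<phi> x = ser c (ser d \<phi>) x"
    by (simp add: ser_power [OF assms(1)] ser_def [of c])
qed

section \<open>Exponential and logarithm\<close>

definition expc where "expc = ser (fps_exp 1)"
definition logc where "logc \<phi> = ser (fps_ln 1) (\<phi> - unit)"

lemma aug_diff_unit: "lin \<phi> \<Longrightarrow> \<phi> 1 = 1 \<Longrightarrow> aug (\<phi> - unit)"
  by (simp add: lin_diff lin_unit)

lemma lin_expc: "aug \<phi> \<Longrightarrow> lin (expc \<phi>)" and expc_one: "expc \<phi> 1 = 1"
  by (simp_all add: expc_def lin_ser ser_at_one)

lemma aug_logc: "lin \<phi> \<Longrightarrow> \<phi> 1 = 1 \<Longrightarrow> aug (logc \<phi>)"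
  unfolding logc_def by (rule aug_ser) (auto simp: aug_diff_unit)

lemma expc_logc: assumes "lin \<phi>" "\<phi> 1 = 1" shows "expc (logc \<phi>) = \<phi>"
proof -
  note a = aug_diff_unit [OF assms]
  have "expc (logc \<phi>) = ser (1 + fps_X) (\<phi> - unit)"
    unfolding expc_def logc_def
    by (simp add: ser_compose [OF a, symmetric] fps_exp_compose_fps_ln)
  then show ?thesis by (simp add: ser_add ser_one ser_X [OF a])
qed

lemma logc_expc: assumes "aug \<phi>" shows "logc (expc \<phi>) = \<phi>"
proof -
  have "expc \<phi> - unit = ser (fps_exp 1 - 1) \<phi>" by (simp add: ser_diff ser_one expc_def)
  then show ?thesis
    by (simp add: logc_def ser_compose [OF assms, symmetric] fps_ln_compose_fps_exp ser_X [OF assms])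
qed

lemma aug_scl: "aug \<phi> \<Longrightarrow> aug (c \<cdot> \<phi>)"
  by (simp add: lin_scl)

text \<open>The scalar is moved from the argument into the series, so that the law of one-parameter
  groups becomes the identity exp(aX) exp(bX) = exp((a + b)X) of formal series.\<close>

lemma expc_scl: "aug \<phi> \<Longrightarrow> expc (c \<cdot> \<phi>) = ser (fps_exp c) \<phi>"
  by (auto simp: expc_def ser_def fun_eq_iff cpow_scl intro!: sum.cong)

lemma expc_scl_add: "aug \<phi> \<Longrightarrow> expc ((c + d) \<cdot> \<phi>) = expc (c \<cdot> \<phi>) \<star> expc (d \<cdot> \<phi>)"
  by (simp add: expc_scl fps_exp_add_mult ser_mult)

lemma expc_zero: "expc 0 = unit"
proof -
  have "aug 0" by (simp add: lin_zero)
  moreover have "(\<lambda>x. sB 0 ((0 :: 'h \<Rightarrow> 'b) x)) = 0" by auto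
  ultimately show ?thesis using expc_scl [of 0 0] by (simp add: ser_one)
qed

lemma logc_unit: "logc unit = 0"
  using logc_expc [of 0] by (simp add: expc_zero lin_zero)

lemma expc_minus: assumes "aug \<phi>" shows "expc (- \<phi>) \<star> expc \<phi> = unit"
proof -
  have "(\<lambda>x. sB (- 1) (\<phi> x)) = - \<phi>" "(\<lambda>x. sB 1 (\<phi> x)) = \<phi>" "(\<lambda>x. sB (- 1 + 1) (\<phi> x)) = 0"
    by (auto simp: fun_eq_iff)
  with expc_scl_add [OF assms, of "- 1" 1] show ?thesis by (simp add: expc_zero)
qed

lemma cpow_expc: "aug \<phi> \<Longrightarrow> cpow (expc \<phi>) n = expc (of_nat n \<cdot> \<phi>)"
  unfolding expc_def ser_power [symmetric] fps_exp_power_mult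
  by (simp add: expc_def [symmetric] expc_scl)

section \<open>Characters and infinitesimal characters\<close>

abbreviation G where "G \<equiv> carrier (character_group H sB)"
abbreviation L where "L \<equiv> space_of (inf_characters H sB)"

lemma G_iff: "\<phi> \<in> G \<longleftrightarrow> lin \<phi> \<and> \<phi> 1 = 1 \<and> (\<forall>x y. \<phi> (x * y) = \<phi> x * \<phi> y)"
  by (simp add: character_group_def hom_lcs_def)

lemma L_iff: "\<phi> \<in> L \<longleftrightarrow> lin \<phi> \<and> (\<forall>x y. \<phi> (x * y) = sB (\<epsilon> x) (\<phi> y) + sB (\<epsilon> y) (\<phi> x))"
  by (simp add: inf_characters_def hom_lcs_def)

lemma L_aug: "\<phi> \<in> L \<Longrightarrow> aug \<phi>"
  using L_iff [of \<phi>] by (metis add_cancel_right_right counit_simps(2) mult_1 bs.scale_one)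

lemma unit_mult: "unit a * x = sB (\<epsilon> a) x"
  by (simp add: conv_unit_def sB_mult(1) [symmetric])

lemma G_unit: "unit \<in> G"
  using lin_unit by (simp add: G_iff conv_unit_def sB_mult(1) [symmetric])

text \<open>Commutativity of B enters here: \<phi> is multiplicative in a and c, \<psi> in b and d,
  and the four factors have to be regrouped into the pairs of the two coproducts.\<close>

lemma G_conv:
  assumes "\<phi> \<in> G" "\<psi> \<in> G" shows "\<phi> \<star> \<psi> \<in> G"
proof -
  have l: "lin \<phi>" "lin \<psi>" using assms by (auto simp: G_iff)
  have "(\<phi> \<star> \<psi>) (x * y) = (\<phi> \<star> \<psi>) x * (\<phi> \<star> \<psi>) y" for x y
  proof -
    have "(\<phi> \<star> \<psi>) (x * y) = (\<Sum>(a, b)\<leftarrow>sweedler x. \<Sum>(c, d)\<leftarrow>sweedler y. (\<phi> a * \<psi> b) * (\<phi> c * \<psi> d))"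
      using assms by (simp add: conv_mult_arg [OF l] G_iff mult_ac)
    then show ?thesis by (simp only: sum_list_prod_swap conv_sweedler [OF l])
  qed
  then show ?thesis using assms by (simp add: G_iff lin_conv conv_one)
qed

lemma G_cpow: "\<phi> \<in> G \<Longrightarrow> cpow \<phi> n \<in> G"
  by (induction n) (auto simp: cpow_Suc G_unit G_conv)

text \<open>Divided powers keep the binomial coefficients out of the Leibniz rule.\<close>

definition dpow where "dpow \<phi> k x = sB (inverse (fact k)) (cpow \<phi> k x)"

lemma lin_dpow: "lin \<phi> \<Longrightarrow> lin (dpow \<phi> k)"
  unfolding dpow_def by (intro lin_scl lin_cpow)

lemma conv_dpow: "lin \<phi> \<Longrightarrow> (\<phi> \<star> dpow \<phi> k) x = sB (of_nat (Suc k)) (dpow \<phi> (Suc k) x)"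
  unfolding dpow_def conv_scl_right [OF lin_cpow] cpow_Suc
  by (simp add: conv_scl_right [OF lin_cpow] field_simps del: of_nat_Suc)

text \<open>Induction via (k + 1) \<gamma>_(k+1) = \<phi> \<star> \<gamma>_k, where \<gamma>_k is
  \<open>dpow \<phi> k\<close>. The two terms of \<open>\<phi> (a * c)\<close> raise either the
  power at \<open>y\<close> or the power at \<open>x\<close>; the resulting multiplicities k + 1 - i
  and i add up to k + 1, which is cancelled at the end.\<close>

lemma dpow_mult:
  assumes "\<phi> \<in> L"
  shows "dpow \<phi> k (x * y) = (\<Sum>i\<le>k. dpow \<phi> i x * dpow \<phi> (k - i) y)"
proof (induction k arbitrary: x y)
  case 0
  show ?case by (simp add: dpow_def conv_unit_def sB_mult(1) [symmetric])
next
  case (Suc k)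
  have l: "lin \<phi>" using assms by (simp add: L_iff)
  note ld = lin_dpow [OF l]
  let ?\<gamma> = "dpow \<phi>"
  let ?T = "\<lambda>j. ?\<gamma> j x * ?\<gamma> (Suc k - j) y"
  have "sB (of_nat (Suc k)) (?\<gamma> (Suc k) (x * y)) = (\<phi> \<star> ?\<gamma> k) (x * y)"
    by (simp only: conv_dpow [OF l])
  also have "\<dots> = (\<Sum>(a, b)\<leftarrow>sweedler x. \<Sum>(c, d)\<leftarrow>sweedler y.
      (\<Sum>i\<le>k. (unit a * ?\<gamma> i b) * (\<phi> c * ?\<gamma> (k - i) d) + (\<phi> a * ?\<gamma> i b) * (unit c * ?\<gamma> (k - i) d)))"
  proof -
    have "\<phi> (a * c) * ?\<gamma> k (b * d) =
      (\<Sum>i\<le>k. (unit a * ?\<gamma> i b) * (\<phi> c * ?\<gamma> (k - i) d) + (\<phi> a * ?\<gamma> i b) * (unit c * ?\<gamma> (k - i) d))" for a b c d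
    proof -
      have "\<phi> (a * c) = unit a * \<phi> c + \<phi> a * unit c"
        using assms by (simp add: L_iff unit_mult mult.commute [of "\<phi> a"])
      then show ?thesis unfolding Suc.IH by (simp add: sum_distrib_left algebra_simps sum.distrib)
    qed
    then show ?thesis by (simp add: conv_mult_arg [OF l ld])
  qed
  also have "\<dots> = (\<Sum>i\<le>k. (unit \<star> ?\<gamma> i) x * (\<phi> \<star> ?\<gamma> (k - i)) y + (\<phi> \<star> ?\<gamma> i) x * (unit \<star> ?\<gamma> (k - i)) y)"
    unfolding conv_sweedler [OF l ld] conv_sweedler [OF lin_unit ld] sum_list_prod_swap [symmetric]
    by (simp add: case_prod_unfold sum_sum_list_swap sum.distrib sum_list_addf)
  also have "\<dots> = (\<Sum>i\<le>k. sB (of_nat (Suc k - i)) (?T i)) + (\<Sum>i\<le>k. sB (of_nat (Suc i)) (?T (Suc i)))"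
    unfolding conv_dpow [OF l] unit_conv [OF ld]
    by (simp add: sum.distrib sB_mult [symmetric] Suc_diff_le del: of_nat_Suc)
  \<comment> \<open>The two ranges are extended by \<open>i = Suc k\<close> and by
    \<open>i = 0\<close> respectively, where the coefficients are 0.\<close>
  also have "\<dots> = (\<Sum>i\<le>Suc k. sB (of_nat (Suc k - i)) (?T i)) + (\<Sum>i\<le>Suc k. sB (of_nat i) (?T i))"
    unfolding sum.atMost_Suc_shift [of "\<lambda>i. sB (of_nat i) (?T i)"] by simp
  also have "\<dots> = (\<Sum>i\<le>Suc k. sB (of_nat (Suc k)) (?T i))"
    unfolding sum.distrib [symmetric] bs.scale_left_distrib [symmetric] of_nat_add [symmetric]
    by (intro sum.cong refl) simp
  finally have "sB (of_nat (Suc k)) (?\<gamma> (Suc k) (x * y)) = sB (of_nat (Suc k)) (\<Sum>i\<le>Suc k. ?T i)"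
    by (simp only: bs.scale_sum_right)
  then show ?case
    using bs.scale_left_imp_eq [of "of_nat (Suc k)"] of_nat_neq_0 [of k] by blast
qed

lemma expc_scl_dpow:
  assumes "aug \<phi>" "deg x \<le> N"
  shows "expc (c \<cdot> \<phi>) x = (\<Sum>k\<le>N. sB (c ^ k) (dpow \<phi> k x))"
  unfolding expc_scl [OF assms(1)] ser_eq [OF assms] dpow_def by (simp add: field_simps)

lemma dpow_vanish: "aug \<phi> \<Longrightarrow> deg x < k \<Longrightarrow> dpow \<phi> k x = 0"
  by (simp add: dpow_def cpow_vanish)

text \<open>The parameter \<open>c\<close> is kept because the formula serves twice: at c = 1
  together with \<open>dpow_mult\<close>, and as a polynomial in c whose linear coefficient is
  extracted in \<open>logc_in_L\<close>.\<close>

lemma expc_scl_mult: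
  assumes "aug \<phi>" "deg x + deg y \<le> N"
  shows "expc (c \<cdot> \<phi>) x * expc (c \<cdot> \<phi>) y = (\<Sum>k\<le>N. sB (c ^ k) (\<Sum>i\<le>k. dpow \<phi> i x * dpow \<phi> (k - i) y))"
proof -
  have N: "deg x \<le> N" "deg y \<le> N" using assms by auto
  have "expc (c \<cdot> \<phi>) x * expc (c \<cdot> \<phi>) y = (\<Sum>i\<le>N. \<Sum>j\<le>N. sB (c ^ (i + j)) (dpow \<phi> i x * dpow \<phi> j y))"
    by (simp add: expc_scl_dpow [OF assms(1) N(1)] expc_scl_dpow [OF assms(1) N(2)] sum_product sB_mult_mult power_add)
  also have "\<dots> = (\<Sum>k\<le>N. \<Sum>i\<le>k. sB (c ^ (i + (k - i))) (dpow \<phi> i x * dpow \<phi> (k - i) y))"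
  proof (rule sum_square_triangle)
    fix i j assume "N < i + j"
    then have "deg x < i \<or> deg y < j" using assms(2) by linarith
    then show "sB (c ^ (i + j)) (dpow \<phi> i x * dpow \<phi> j y) = 0"
      using dpow_vanish [OF assms(1)] by auto
  qed
  also have "\<dots> = (\<Sum>k\<le>N. sB (c ^ k) (\<Sum>i\<le>k. dpow \<phi> i x * dpow \<phi> (k - i) y))"
    by (simp add: bs.scale_sum_right)
  finally show ?thesis .
qed

lemma expc_in_G: assumes "\<phi> \<in> L" shows "expc \<phi> \<in> G"
proof -
  note a = L_aug [OF assms]
  have "expc \<phi> (x * y) = expc \<phi> x * expc \<phi> y" for x y
  proof -
    define N where "N = deg x + deg y + deg (x * y)"
    have N: "deg (x * y) \<le> N" "deg x + deg y \<le> N" by (auto simp: N_def)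
    have "(\<lambda>x. sB 1 (\<phi> x)) = \<phi>" by auto
    then show ?thesis
      using expc_scl_dpow [OF a N(1), of 1] expc_scl_mult [OF a N(2), of 1] by (simp add: dpow_mult [OF assms])
  qed
  then show ?thesis using a by (simp add: G_iff lin_expc expc_one)
qed

text \<open>The powers \<open>expc (n \<cdot> \<psi>) = \<phi> ^ n\<close> are characters, so the defect of multiplicativity of
  \<open>expc (t \<cdot> \<psi>)\<close>, a polynomial in \<open>t\<close>, vanishes at all natural numbers.  Its linear coefficient says
  that \<open>\<psi>\<close> is an infinitesimal character.\<close>

lemma logc_in_L: assumes "\<phi> \<in> G" shows "logc \<phi> \<in> L"
proof -
  define \<psi> where "\<psi> = logc \<phi>"
  have l: "lin \<phi>" "\<phi> 1 = 1" using assms by (auto simp: G_iff)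
  have a: "aug \<psi>" and e: "expc \<psi> = \<phi>" by (simp_all add: \<psi>_def aug_logc expc_logc l)
  have G: "expc (of_nat n \<cdot> \<psi>) \<in> G" for n
    using G_cpow [OF assms, of n] cpow_expc [OF a, of n] by (simp add: e)
  have "\<psi> (x * y) = sB (\<epsilon> x) (\<psi> y) + sB (\<epsilon> y) (\<psi> x)" for x y
  proof -
    \<comment> \<open>\<open>Suc\<close> guarantees 1 \<le> N: the linear coefficient has to lie
      within the range.\<close>
    define N where "N = Suc (deg x + deg y + deg (x * y))"
    have N: "deg (x * y) \<le> N" "deg x + deg y \<le> N" "1 \<le> N" by (auto simp: N_def)
    let ?c = "\<lambda>k. dpow \<psi> k (x * y) - (\<Sum>i\<le>k. dpow \<psi> i x * dpow \<psi> (k - i) y)"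
    have "(\<Sum>k\<le>N. sB (of_nat n ^ k) (?c k)) = 0" for n
    proof -
      have "expc (of_nat n \<cdot> \<psi>) (x * y) = expc (of_nat n \<cdot> \<psi>) x * expc (of_nat n \<cdot> \<psi>) y"
        using G by (simp add: G_iff)
      then show ?thesis
        unfolding expc_scl_dpow [OF a N(1)] expc_scl_mult [OF a N(2)]
        by (simp add: bs.scale_right_diff_distrib sum_subtractf)
    qed
    from polynomial_vanishes_on_nat [OF bs.vector_space_axioms this N(3)]
    show ?thesis using a by (simp add: dpow_def cpow_1 unit_mult mult.commute [of _ "unit y"])
  qed
  then show ?thesis using a by (simp add: L_iff \<psi>_def)
qed

lemma L_scl: "\<phi> \<in> L \<Longrightarrow> c \<cdot> \<phi> \<in> L"
  by (auto simp: L_iff lin_scl bs.scale_right_distrib mult.commute)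

lemma L_add: "\<phi> \<in> L \<Longrightarrow> \<psi> \<in> L \<Longrightarrow> \<phi> + \<psi> \<in> L"
  by (auto simp: L_iff lin_add bs.scale_right_distrib)

lemma L_minus: "\<phi> \<in> L \<Longrightarrow> - \<phi> \<in> L"
  by (auto simp: L_iff lin_minus)

lemma L_zero: "0 \<in> L"
  by (simp add: L_iff lin_zero)

text \<open>The left inverse comes from the logarithm. Its form \<open>expc (- logc \<phi>)\<close>
  shows at once that inversion is negation in the chart.\<close>

lemma group_G: "group (character_group H sB)"
proof (rule groupI)
  fix \<phi> assume \<phi>: "\<phi> \<in> G"
  then have l: "lin \<phi>" "\<phi> 1 = 1" by (auto simp: G_iff)
  have "expc (- logc \<phi>) \<star> \<phi> = unit"
    using expc_minus [OF aug_logc [OF l]] by (simp add: expc_logc l)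
  moreover have "expc (- logc \<phi>) \<in> G" using \<phi> by (intro expc_in_G L_minus logc_in_L)
  ultimately show "\<exists>y\<in>G. y \<otimes>\<^bsub>character_group H sB\<^esub> \<phi> = \<one>\<^bsub>character_group H sB\<^esub>"
    by (auto simp: character_group_def)
next
  fix x y z assume "x \<in> G" "y \<in> G" "z \<in> G"
  then show "x \<otimes>\<^bsub>character_group H sB\<^esub> y \<otimes>\<^bsub>character_group H sB\<^esub> z =
      x \<otimes>\<^bsub>character_group H sB\<^esub> (y \<otimes>\<^bsub>character_group H sB\<^esub> z)"
    using conv_assoc G_iff by (simp add: character_group_def [of H sB, THEN arg_cong, of mult])
next
  fix x y assume "x \<in> G" "y \<in> G"
  then show "x \<otimes>\<^bsub>character_group H sB\<^esub> y \<in> G"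
    using G_conv [of x y] by (simp add: character_group_def [of H sB, THEN arg_cong, of mult])
next
  fix x assume "x \<in> G"
  then show "\<one>\<^bsub>character_group H sB\<^esub> \<otimes>\<^bsub>character_group H sB\<^esub> x = x"
    using unit_conv G_iff by (simp add: character_group_def [of H sB, THEN arg_cong, of mult] character_group_def [of H sB, THEN arg_cong, of one])
qed (use G_unit in \<open>simp add: character_group_def [of H sB, THEN arg_cong, of one]\<close>)

lemma inv_G: assumes "\<phi> \<in> G" shows "inv\<^bsub>character_group H sB\<^esub> \<phi> = expc (- logc \<phi>)"
proof (rule group.inv_equality [OF group_G])
  have l: "lin \<phi>" "\<phi> 1 = 1" using assms by (auto simp: G_iff)
  show "expc (- logc \<phi>) \<otimes>\<^bsub>character_group H sB\<^esub> \<phi> = \<one>\<^bsub>character_group H sB\<^esub>"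
    using expc_minus [OF aug_logc [OF l]] by (simp add: expc_logc l character_group_def)
  show "expc (- logc \<phi>) \<in> G" using assms by (intro expc_in_G L_minus logc_in_L)
qed fact

end

section \<open>Polynomial maps and Keller's calculus\<close>

text \<open>Interpreted twice: by B over its own field and by \<open>'b cx\<close> over the complex
  numbers. Continuity of the operations comes from these axioms and not from type classes, so the
  limit rules are derived from them.\<close>

locale topological_algebra =
  fixes sB :: "'k::real_or_complex \<Rightarrow> 'b::{comm_ring, comm_monoid_mult, topological_space} \<Rightarrow> 'b"
  assumes algebra: "algebra_over sB"
    and hausdorff: "Hausdorff_space (euclidean :: 'b topology)"
    and continuous_plus: "continuous_on UNIV (\<lambda>(x, y). x + y :: 'b)"
    and continuous_scale: "continuous_on UNIV (\<lambda>(c, x). sB c x)"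
    and continuous_times: "continuous_on UNIV (\<lambda>(x, y). x * y :: 'b)"
begin

sublocale bs: vector_space sB
  using algebra by (simp add: algebra_over_def)

lemma sB_mult: "sB c (x * y) = sB c x * y" "sB c (x * y) = x * sB c y"
  using algebra unfolding algebra_over_def by metis+

lemma tendsto_plus: "(f \<longlongrightarrow> a) F \<Longrightarrow> (g \<longlongrightarrow> b) F \<Longrightarrow> ((\<lambda>x. f x + g x :: 'b) \<longlongrightarrow> a + b) F"
  using continuous_on_tendsto_compose [OF continuous_plus tendsto_Pair] by simp

lemma tendsto_times: "(f \<longlongrightarrow> a) F \<Longrightarrow> (g \<longlongrightarrow> b) F \<Longrightarrow> ((\<lambda>x. f x * g x :: 'b) \<longlongrightarrow> a * b) F"
  using continuous_on_tendsto_compose [OF continuous_times tendsto_Pair] by simp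

lemma tendsto_scl: "(f \<longlongrightarrow> a) F \<Longrightarrow> (g \<longlongrightarrow> b) F \<Longrightarrow> ((\<lambda>x. sB (f x) (g x)) \<longlongrightarrow> sB a b) F"
  using continuous_on_tendsto_compose [OF continuous_scale tendsto_Pair] by simp

lemma tendsto_neg: "(f \<longlongrightarrow> a) F \<Longrightarrow> ((\<lambda>x. - f x :: 'b) \<longlongrightarrow> - a) F"
  using tendsto_scl [OF tendsto_const [of "- 1"]] by (simp del: One_nat_def)

lemma tendsto_sub: "(f \<longlongrightarrow> a) F \<Longrightarrow> (g \<longlongrightarrow> b) F \<Longrightarrow> ((\<lambda>x. f x - g x :: 'b) \<longlongrightarrow> a - b) F"
  using tendsto_plus [OF _ tendsto_neg, of f a F g b] by simp

lemma limit_unique: "(f \<longlongrightarrow> (a::'b)) F \<Longrightarrow> (f \<longlongrightarrow> b) F \<Longrightarrow> F \<noteq> bot \<Longrightarrow> a = b"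
  using limitin_Hausdorff_unique [OF _ _ _ hausdorff, of f a F b] by (simp add: limitin_canonical_iff trivial_limit_def)

lemma continuous_on_plus: "continuous_on D f \<Longrightarrow> continuous_on D g \<Longrightarrow> continuous_on D (\<lambda>x. f x + g x :: 'b)"
  unfolding continuous_on_def by (blast intro: tendsto_plus)

lemma continuous_on_times: "continuous_on D f \<Longrightarrow> continuous_on D g \<Longrightarrow> continuous_on D (\<lambda>x. f x * g x :: 'b)"
  unfolding continuous_on_def by (blast intro: tendsto_times)

end

section \<open>Polynomial maps in coordinates\<close>

inductive poly_fun :: "(('v \<Rightarrow> 'c::comm_ring) \<Rightarrow> 'c) \<Rightarrow> bool" where
  const: "poly_fun (\<lambda>\<rho>. c)"
| var: "poly_fun (\<lambda>\<rho>. \<rho> i)"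
| plus: "poly_fun P \<Longrightarrow> poly_fun Q \<Longrightarrow> poly_fun (\<lambda>\<rho>. P \<rho> + Q \<rho>)"
| times: "poly_fun P \<Longrightarrow> poly_fun Q \<Longrightarrow> poly_fun (\<lambda>\<rho>. P \<rho> * Q \<rho>)"

text \<open>Agreement with the polynomial is asked on \<open>D\<close> only, since the Sweedler sum
  computes a convolution only for linear maps.\<close>

definition poly_map :: "('i \<Rightarrow> 'e \<Rightarrow> 'c::comm_ring) \<Rightarrow> 'e set \<Rightarrow> ('e \<Rightarrow> 'c) \<Rightarrow> bool"
  where "poly_map p D f \<longleftrightarrow> (\<exists>P. poly_fun P \<and> (\<forall>x\<in>D. f x = P (\<lambda>i. p i x)))"

lemma poly_map_const: "poly_map p D (\<lambda>x. c)"
  unfolding poly_map_def using poly_fun.const [of c] by blast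

lemma poly_map_coord: "poly_map p D (p i)"
  unfolding poly_map_def using poly_fun.var [of i] by blast

lemma poly_map_plus: "poly_map p D f \<Longrightarrow> poly_map p D g \<Longrightarrow> poly_map p D (\<lambda>x. f x + g x)"
  unfolding poly_map_def using poly_fun.plus by fastforce

lemma poly_map_times: "poly_map p D f \<Longrightarrow> poly_map p D g \<Longrightarrow> poly_map p D (\<lambda>x. f x * g x)"
  unfolding poly_map_def using poly_fun.times by fastforce

lemma poly_map_cong: "poly_map p D f \<Longrightarrow> (\<And>x. x \<in> D \<Longrightarrow> g x = f x) \<Longrightarrow> poly_map p D g"
  unfolding poly_map_def by auto

lemma poly_map_sum: "(\<And>i. i \<in> I \<Longrightarrow> poly_map p D (f i)) \<Longrightarrow> poly_map p D (\<lambda>x. \<Sum>i\<in>I. f i x)"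
  by (induction I rule: infinite_finite_induct) (auto intro: poly_map_const poly_map_plus)

lemma poly_map_sum_list: "(\<And>i. i \<in> set I \<Longrightarrow> poly_map p D (f i)) \<Longrightarrow> poly_map p D (\<lambda>x. \<Sum>i\<leftarrow>I. f i x)"
  by (induction I) (auto intro: poly_map_const poly_map_plus)

lemma poly_map_scale:
  assumes "algebra_over sB" "poly_map p D f" shows "poly_map p D (\<lambda>x. sB c (f x))"
proof -
  have "sB c 1 * y = sB c y" for y
  proof -
    have "sB c (1 * y) = sB c 1 * y" using assms(1) unfolding algebra_over_def by blast
    then show ?thesis by simp
  qed
  then show ?thesis using poly_map_times [OF poly_map_const [of p D "sB c 1"] assms(2)] by simp
qed

lemma poly_map_uminus:
  fixes f :: "'e \<Rightarrow> 'c::{comm_ring, comm_monoid_mult}"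
  assumes "poly_map p D f" shows "poly_map p D (\<lambda>x. - f x)"
  using poly_map_times [OF poly_map_const [of p D "- 1"] assms] by simp

lemma poly_map_diff:
  fixes f :: "'e \<Rightarrow> 'c::{comm_ring, comm_monoid_mult}"
  assumes "poly_map p D f" "poly_map p D g" shows "poly_map p D (\<lambda>x. f x - g x)"
  using poly_map_plus [OF assms(1) poly_map_uminus [OF assms(2)]] by simp

text \<open>The coordinates are defined on the whole ambient type, so that limits can be computed coordinatewise
  before they are known to lie in the subspace.\<close>

definition coord_system ::
    "('k::real_or_complex \<Rightarrow> 'b::{comm_ring, comm_monoid_mult, topological_space} \<Rightarrow> 'b) \<Rightarrow>
     ('k, 'e::{ab_group_add, topological_space}) lcs \<Rightarrow> ('i \<Rightarrow> 'e \<Rightarrow> 'b) \<Rightarrow> (('i \<Rightarrow> 'b) \<Rightarrow> 'e) \<Rightarrow> bool"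
  where "coord_system sB E p r \<longleftrightarrow>
    (\<forall>i. continuous_on UNIV (p i)) \<and> continuous_on UNIV r \<and>
    (\<forall>x. r (\<lambda>i. p i x) = x) \<and> (\<forall>z i. p i (r z) = z i) \<and>
    (\<forall>i x y. p i (x + y) = p i x + p i y) \<and> (\<forall>i c x. p i (scale E c x) = sB c (p i x)) \<and>
    closed (space_of E) \<and> 0 \<in> space_of E \<and>
    (\<forall>x\<in>space_of E. \<forall>y\<in>space_of E. x + y \<in> space_of E) \<and>
    (\<forall>c. \<forall>x\<in>space_of E. scale E c x \<in> space_of E)"

lemma coord_zero: "coord_system sB E p r \<Longrightarrow> p i 0 = 0"
proof -
  assume "coord_system sB E p r"
  then have "p i (0 + 0) = p i 0 + p i 0" unfolding coord_system_def by blast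
  then show ?thesis by simp
qed

lemma coord_diff:
  assumes "coord_system sB E p r" shows "p i (x - y) = p i x - p i y"
proof -
  have "p i (x - y) + p i y = p i x"
  proof -
    have "p i ((x - y) + y) = p i (x - y) + p i y" using assms unfolding coord_system_def by blast
    then show ?thesis by simp
  qed
  then show ?thesis by (simp add: eq_diff_eq)
qed

lemma coord_eqI:
  assumes "coord_system sB E p r" "\<And>i. p i x = p i y" shows "x = y"
proof -
  have "r (\<lambda>i. p i x) = x" "r (\<lambda>i. p i y) = y" using assms(1) by (auto simp: coord_system_def)
  moreover have "(\<lambda>i. p i x) = (\<lambda>i. p i y)" using assms(2) by (rule ext)
  ultimately show ?thesis by metis
qed

lemma coord_system_diff:
  assumes "vector_space sB" "coord_system sB E p r" "x \<in> space_of E" "y \<in> space_of E"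
  shows "x - y \<in> space_of E"
proof -
  interpret vector_space sB by fact
  have e: "x - y = x + scale E (- 1) y"
    by (rule coord_eqI [OF assms(2)]) (use assms(2) in \<open>simp add: coord_diff [OF assms(2)] coord_system_def\<close>)
  show ?thesis unfolding e using assms(2-4) by (simp add: coord_system_def)
qed

lemma tendsto_fun_iff:
  fixes f :: "'a \<Rightarrow> 'i \<Rightarrow> 'b::topological_space"
  shows "(f \<longlongrightarrow> l) F \<longleftrightarrow> (\<forall>i. ((\<lambda>x. f x i) \<longlongrightarrow> l i) F)"
  unfolding limitin_canonical_iff [symmetric] euclidean_product_topology [symmetric]
  by (simp add: limitin_componentwise)

lemma coord_tendsto:
  assumes "coord_system sB E p r" "\<And>i. ((\<lambda>t. p i (X t)) \<longlongrightarrow> p i l) F"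
  shows "(X \<longlongrightarrow> l) F"
proof -
  have "continuous_on UNIV r" using assms(1) by (simp add: coord_system_def)
  moreover have "((\<lambda>t i. p i (X t)) \<longlongrightarrow> (\<lambda>i. p i l)) F" using assms(2) by (simp add: tendsto_fun_iff)
  ultimately have "((\<lambda>t. r (\<lambda>i. p i (X t))) \<longlongrightarrow> r (\<lambda>i. p i l)) F"
    by (rule continuous_on_tendsto_compose) auto
  then show ?thesis using assms(1) by (simp add: coord_system_def)
qed

lemma coord_tendsto_iff:
  assumes "coord_system sB E p r"
  shows "(X \<longlongrightarrow> l) F \<longleftrightarrow> (\<forall>i. ((\<lambda>t. p i (X t)) \<longlongrightarrow> p i l) F)"
proof (intro iffI allI)
  fix i assume X: "(X \<longlongrightarrow> l) F"
  have "continuous_on UNIV (p i)" using assms by (simp add: coord_system_def)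
  then show "((\<lambda>t. p i (X t)) \<longlongrightarrow> p i l) F" using X by (rule continuous_on_tendsto_compose) auto
qed (auto intro: coord_tendsto [OF assms])

lemma coord_continuous:
  assumes "coord_system sB E p r" "\<And>i. continuous_on D (\<lambda>x. p i (f x))"
  shows "continuous_on D f"
  using assms(2) unfolding continuous_on_def by (auto intro: coord_tendsto [OF assms(1)])

text \<open>The variable \<open>(0, i)\<close> stands for the \<open>i\<close>-th coordinate of the base point, \<open>(Suc k, i)\<close> for that of the
  \<open>k\<close>-th direction.\<close>

definition shift :: "('k \<Rightarrow> 'b \<Rightarrow> 'b) \<Rightarrow> nat \<Rightarrow> 'k \<Rightarrow> (nat \<times> 'i \<Rightarrow> 'b::plus) \<Rightarrow> nat \<times> 'i \<Rightarrow> 'b"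
  where "shift sB k t \<rho> = (\<lambda>(n, i). if n = 0 then \<rho> (0, i) + sB t (\<rho> (Suc k, i)) else \<rho> (n, i))"

section \<open>Smoothness of polynomial maps\<close>

context topological_algebra
begin

lemma poly_fun_continuous:
  assumes "poly_fun P" "\<And>i. continuous_on D (\<lambda>x. f x i)"
  shows "continuous_on D (\<lambda>x. P (f x) :: 'b)"
  using assms(1)
  by induction (auto intro: continuous_on_const continuous_on_plus continuous_on_times assms(2))

lemma poly_map_continuous:
  assumes "poly_map p D f" "\<And>i. continuous_on D (p i)"
  shows "continuous_on D (f :: _ \<Rightarrow> 'b)"
proof -
  obtain P where P: "poly_fun P" "\<And>x. x \<in> D \<Longrightarrow> f x = P (\<lambda>i. p i x)"
    using assms(1) unfolding poly_map_def by blast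
  have "continuous_on D (\<lambda>x. P (\<lambda>i. p i x))"
    by (rule poly_fun_continuous [OF P(1)]) (rule assms(2))
  then show ?thesis using P(2) by (simp cong: continuous_on_cong)
qed

text \<open>The derivative is again a polynomial in the coordinates of the base point and the
  directions, so differentiation can be iterated without end.\<close>

lemma poly_fun_deriv:
  fixes P :: "(nat \<times> 'i \<Rightarrow> 'b) \<Rightarrow> 'b"
  assumes "poly_fun P"
  shows "\<exists>Q. poly_fun Q \<and>
    (\<forall>\<rho>. ((\<lambda>t. sB (inverse t) (P (shift sB k t \<rho>) - P \<rho>)) \<longlongrightarrow> Q \<rho>) (at 0))"
  using assms
proof induction
  case (const c)
  show ?case by (rule exI [of _ "\<lambda>_. 0"]) (simp add: poly_fun.const)
next
  case (var j)
  obtain n i where j: "j = (n, i)" by fastforce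
  show ?case
  proof (cases "n = 0")
    case True
    have "((\<lambda>t. sB (inverse t) (shift sB k t \<rho> j - \<rho> j)) \<longlongrightarrow> \<rho> (Suc k, i)) (at 0)" for \<rho>
    proof (rule tendsto_eventually)
      show "\<forall>\<^sub>F t in at 0. sB (inverse t) (shift sB k t \<rho> j - \<rho> j) = \<rho> (Suc k, i)"
        using eventually_neq_at_within [of 0 0 UNIV]
        by eventually_elim (simp add: shift_def j True)
    qed
    then show ?thesis using poly_fun.var [of "(Suc k, i)"] by blast
  next
    case False
    then show ?thesis
      by (intro exI [of _ "\<lambda>_. 0"]) (simp add: poly_fun.const shift_def j)
  qed
next
  case (plus P Q)
  then obtain P' Q' where d: "poly_fun P'" "poly_fun Q'"
    "\<And>\<rho>. ((\<lambda>t. sB (inverse t) (P (shift sB k t \<rho>) - P \<rho>)) \<longlongrightarrow> P' \<rho>) (at 0)"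
    "\<And>\<rho>. ((\<lambda>t. sB (inverse t) (Q (shift sB k t \<rho>) - Q \<rho>)) \<longlongrightarrow> Q' \<rho>) (at 0)" by blast
  have "((\<lambda>t. sB (inverse t) (P (shift sB k t \<rho>) + Q (shift sB k t \<rho>) - (P \<rho> + Q \<rho>))) \<longlongrightarrow> P' \<rho> + Q' \<rho>) (at 0)" for \<rho>
    using tendsto_plus [OF d(3) d(4), of \<rho> \<rho>]
    by (simp add: bs.scale_right_distrib [symmetric] add_diff_add)
  then show ?case using poly_fun.plus [OF d(1,2)] by blast
next
  case (times P Q)
  then obtain P' Q' where d: "poly_fun P'" "poly_fun Q'"
    "\<And>\<rho>. ((\<lambda>t. sB (inverse t) (P (shift sB k t \<rho>) - P \<rho>)) \<longlongrightarrow> P' \<rho>) (at 0)"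
    "\<And>\<rho>. ((\<lambda>t. sB (inverse t) (Q (shift sB k t \<rho>) - Q \<rho>)) \<longlongrightarrow> Q' \<rho>) (at 0)" by blast
  have *: "((\<lambda>t. sB (inverse t) (P (shift sB k t \<rho>) * Q (shift sB k t \<rho>) - P \<rho> * Q \<rho>)) \<longlongrightarrow>
    P' \<rho> * Q \<rho> + P \<rho> * Q' \<rho>) (at 0)" for \<rho>
  proof -
    let ?P = "\<lambda>t. P (shift sB k t \<rho>)" and ?Q = "\<lambda>t. Q (shift sB k t \<rho>)"
    \<comment> \<open>Continuity of \<open>Q\<close> along the line, recovered from its difference
      quotient; the product rule uses it for the moving factor.\<close>
    have "((\<lambda>t. Q \<rho> + sB t (sB (inverse t) (?Q t - Q \<rho>))) \<longlongrightarrow> Q \<rho> + sB 0 (Q' \<rho>)) (at 0)"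
      by (intro tendsto_plus tendsto_const tendsto_scl tendsto_ident_at d)
    moreover have "\<forall>\<^sub>F t in at 0. Q \<rho> + sB t (sB (inverse t) (?Q t - Q \<rho>)) = ?Q t"
      using eventually_neq_at_within [of 0 0 UNIV] by eventually_elim simp
    ultimately have "(?Q \<longlongrightarrow> Q \<rho>) (at 0)" by (auto dest: Lim_transform_eventually)
    then have "((\<lambda>t. sB (inverse t) (?P t - P \<rho>) * ?Q t + P \<rho> * sB (inverse t) (?Q t - Q \<rho>)) \<longlongrightarrow>
        P' \<rho> * Q \<rho> + P \<rho> * Q' \<rho>) (at 0)"
      by (intro tendsto_plus tendsto_times tendsto_const d)
    moreover have "sB (inverse t) (?P t - P \<rho>) * ?Q t + P \<rho> * sB (inverse t) (?Q t - Q \<rho>) =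
        sB (inverse t) (?P t * ?Q t - P \<rho> * Q \<rho>)" for t
      by (simp add: sB_mult [symmetric] bs.scale_right_distrib [symmetric] left_diff_distrib right_diff_distrib)
    ultimately show ?thesis by simp
  qed
  show ?case
    by (intro exI [of _ "\<lambda>\<rho>. P' \<rho> * Q \<rho> + P \<rho> * Q' \<rho>"])
      (simp add: poly_fun.intros d(1,2) times(1,2) *)
qed

lemma coord_limit_unique:
  fixes q :: "'i \<Rightarrow> 'f::{ab_group_add, topological_space} \<Rightarrow> 'b" and X :: "'t \<Rightarrow> 'f"
  assumes "coord_system sB F q r" "(X \<longlongrightarrow> l) Fl" "(X \<longlongrightarrow> l') Fl" "Fl \<noteq> bot"
  shows "l = l'"
proof (rule coord_eqI [OF assms(1)])
  fix i
  have "((\<lambda>t. q i (X t)) \<longlongrightarrow> q i l) Fl" "((\<lambda>t. q i (X t)) \<longlongrightarrow> q i l') Fl"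
    using assms(2,3) by (auto simp: coord_tendsto_iff [OF assms(1)])
  then show "q i l = q i l'" using assms(4) by (rule limit_unique)
qed

lemma dir_deriv_eqI:
  assumes "coord_system sB F q r" "l \<in> space_of F" "(diff_quotient E F f x v \<longlongrightarrow> l) (at 0)"
  shows "dir_deriv E F f x v = l"
  unfolding dir_deriv_def
  by (rule the_equality) (use assms in \<open>auto intro: coord_limit_unique [OF assms(1)]\<close>)

definition env :: "('i \<Rightarrow> 'e \<Rightarrow> 'b) \<Rightarrow> 'e \<Rightarrow> (nat \<Rightarrow> 'e) \<Rightarrow> nat \<times> 'i \<Rightarrow> 'b"
  where "env p x v = (\<lambda>(n, i). case n of 0 \<Rightarrow> p i x | Suc m \<Rightarrow> p i (v m))"

text \<open>Moving the base point by \<open>t\<close> times the k-th direction is a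
  \<open>shift\<close> of the assignment \<open>env\<close>, so the limit is computed
  coordinatewise. It lies in the space of \<open>F\<close> because that space is closed.\<close>

lemma diff_quotient_tendsto:
  assumes cE: "coord_system sB E p r" and cF: "coord_system sB F q r'"
    and P: "\<And>y j. y \<in> space_of E \<Longrightarrow> q j (g y) = P j (env p y v)"
    and gF: "\<And>y. y \<in> space_of E \<Longrightarrow> g y \<in> space_of F"
    and Q: "\<And>j. ((\<lambda>t. sB (inverse t) (P j (shift sB k t (env p x v)) - P j (env p x v))) \<longlongrightarrow> Q j) (at 0)"
    and x: "x \<in> space_of E" and v: "v k \<in> space_of E"
  shows "(diff_quotient E F g x (v k) \<longlongrightarrow> r' Q) (at 0)" "r' Q \<in> space_of F"
proof -
  have xt: "x + scale E t (v k) \<in> space_of E" for t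
    using cE x v by (simp add: coord_system_def)
  have "env p (x + scale E t (v k)) v = shift sB k t (env p x v)" for t
    using cE by (auto simp: env_def shift_def fun_eq_iff coord_system_def split: nat.split)
  then have "q j (diff_quotient E F g x (v k) t) =
      sB (inverse t) (P j (shift sB k t (env p x v)) - P j (env p x v))" for j t
    using cF by (simp add: diff_quotient_def coord_diff [OF cF] coord_system_def P xt x)
  moreover have "q j (r' Q) = Q j" for j using cF by (simp add: coord_system_def)
  ultimately show *: "(diff_quotient E F g x (v k) \<longlongrightarrow> r' Q) (at 0)"
    by (intro coord_tendsto [OF cF]) (simp add: Q)
  show "r' Q \<in> space_of F"
  proof (rule Lim_in_closed_set [OF _ _ _ *])
    show "\<forall>\<^sub>F t in at 0. diff_quotient E F g x (v k) t \<in> space_of F"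
      by (intro always_eventually allI) (use cF gF xt x in
        \<open>simp add: diff_quotient_def coord_system_def coord_system_diff [OF bs.vector_space_axioms cF]\<close>)
  qed (use cF in \<open>simp_all add: coord_system_def\<close>)
qed

text \<open>The k-th derivative involves the directions below k only, and the next differentiation
  uses \<open>v k\<close>. The condition on \<open>v\<close> is restricted accordingly, because
  continuity is asked on families of exactly k directions.\<close>

lemma iter_deriv_poly:
  assumes cE: "coord_system sB E p r" and cF: "coord_system sB F q r'"
    and f: "\<And>x. x \<in> space_of E \<Longrightarrow> f x \<in> space_of F"
    and poly: "\<And>j. poly_map p (space_of E) (\<lambda>x. q j (f x))"
  shows "\<exists>P. (\<forall>j. poly_fun (P j)) \<and>
    (\<forall>x v. x \<in> space_of E \<longrightarrow> (\<forall>i<k. v i \<in> space_of E) \<longrightarrow>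
      iter_deriv E F f k x v \<in> space_of F \<and> (\<forall>j. q j (iter_deriv E F f k x v) = P j (env p x v)))"
proof (induction k)
  case 0
  have "\<exists>P. poly_fun P \<and> (\<forall>x\<in>space_of E. \<forall>v. q j (f x) = P (env p x v))" for j
  proof -
    obtain P where P: "poly_fun P" "\<And>x. x \<in> space_of E \<Longrightarrow> q j (f x) = P (\<lambda>i. p i x)"
      using poly unfolding poly_map_def by blast
    have "poly_fun (\<lambda>\<rho>. P (\<lambda>i. \<rho> (0::nat, i)))"
      using P(1) by induction (auto intro: poly_fun.intros)
    then show ?thesis using P(2) by (intro exI [of _ "\<lambda>\<rho>. P (\<lambda>i. \<rho> (0, i))"]) (simp add: env_def)
  qed
  then obtain P where "\<And>j. poly_fun (P j)" "\<And>j x v. x \<in> space_of E \<Longrightarrow> q j (f x) = P j (env p x v)"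
    using choice [of "\<lambda>j P. poly_fun P \<and> (\<forall>x\<in>space_of E. \<forall>v. q j (f x) = P (env p x v))"] by blast
  then show ?case using f by (intro exI [of _ P]) simp
next
  case (Suc k)
  then obtain P where P: "\<And>j. poly_fun (P j)"
    "\<And>x v. x \<in> space_of E \<Longrightarrow> \<forall>i<k. v i \<in> space_of E \<Longrightarrow> iter_deriv E F f k x v \<in> space_of F"
    "\<And>x v j. x \<in> space_of E \<Longrightarrow> \<forall>i<k. v i \<in> space_of E \<Longrightarrow> q j (iter_deriv E F f k x v) = P j (env p x v)"
    by blast
  have "\<exists>Q. \<forall>j. poly_fun (Q j) \<and>
    (\<forall>\<rho>. ((\<lambda>t. sB (inverse t) (P j (shift sB k t \<rho>) - P j \<rho>)) \<longlongrightarrow> Q j \<rho>) (at 0))"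
    by (intro choice allI poly_fun_deriv P)
  then obtain Q where Q: "\<And>j. poly_fun (Q j)"
    "\<And>j \<rho>. ((\<lambda>t. sB (inverse t) (P j (shift sB k t \<rho>) - P j \<rho>)) \<longlongrightarrow> Q j \<rho>) (at 0)"
    by blast
  have "iter_deriv E F f (Suc k) x v = r' (\<lambda>j. Q j (env p x v)) \<and> r' (\<lambda>j. Q j (env p x v)) \<in> space_of F"
    if x: "x \<in> space_of E" and v: "\<forall>i<Suc k. v i \<in> space_of E" for x v
  proof -
    have *: "\<forall>i<k. v i \<in> space_of E" "v k \<in> space_of E" using v by auto
    note d = diff_quotient_tendsto [where g = "\<lambda>y. iter_deriv E F f k y v", OF cE cF P(3) [OF _ *(1)] P(2) [OF _ *(1)] Q(2) x *(2)]
    show ?thesis using dir_deriv_eqI [OF cF d(2) d(1)] d(2) by simp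
  qed
  then show ?case using Q(1) cF
    by (intro exI [of _ Q]) (auto simp: coord_system_def simp del: iter_deriv.simps)
qed

lemma smooth_on_poly:
  fixes p :: "'i \<Rightarrow> 'e::{ab_group_add, topological_space} \<Rightarrow> 'b"
  assumes cE: "coord_system sB E p r" and cF: "coord_system sB F q r'"
    and f: "\<And>x. x \<in> space_of E \<Longrightarrow> f x \<in> space_of F"
    and poly: "\<And>j. poly_map p (space_of E) (\<lambda>x. q j (f x))"
  shows "smooth_on E F (space_of E) f"
  unfolding smooth_on_def
proof (intro conjI allI impI ballI)
  show "openin (top_of_set (space_of E)) (space_of E)" by simp
  show "f ` space_of E \<subseteq> space_of F" using f by auto
  fix k
  from iter_deriv_poly [OF cE cF f poly, of k] obtain P where P: "\<And>j. poly_fun (P j)"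
    "\<And>x v. x \<in> space_of E \<Longrightarrow> \<forall>i<k. v i \<in> space_of E \<Longrightarrow> iter_deriv E F f k x v \<in> space_of F"
    "\<And>x v j. x \<in> space_of E \<Longrightarrow> \<forall>i<k. v i \<in> space_of E \<Longrightarrow> q j (iter_deriv E F f k x v) = P j (env p x v)"
    by blast
  {
    fix x and v :: "nat \<Rightarrow> _"
    assume x: "x \<in> space_of E" and v: "range v \<subseteq> space_of E"
    have "\<exists>Q. \<forall>j. ((\<lambda>t. sB (inverse t) (P j (shift sB k t (env p x v)) - P j (env p x v))) \<longlongrightarrow> Q j) (at 0)"
    proof (intro choice allI)
      fix j
      show "\<exists>l. ((\<lambda>t. sB (inverse t) (P j (shift sB k t (env p x v)) - P j (env p x v))) \<longlongrightarrow> l) (at 0)"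
        using poly_fun_deriv [OF P(1) [of j], of k] by blast
    qed
    then obtain Q where Q: "\<And>j. ((\<lambda>t. sB (inverse t) (P j (shift sB k t (env p x v)) - P j (env p x v))) \<longlongrightarrow> Q j) (at 0)"
      by blast
    have *: "\<forall>i<k. v i \<in> space_of E" "v k \<in> space_of E" using v by auto
    show "\<exists>l\<in>space_of F. (diff_quotient E F (\<lambda>y. iter_deriv E F f k y v) x (v k) \<longlongrightarrow> l) (at 0)"
      using diff_quotient_tendsto [where g = "\<lambda>y. iter_deriv E F f k y v", OF cE cF P(3) [OF _ *(1)] P(2) [OF _ *(1)] Q x *(2)] by blast
  }
  have ci: "continuous_on UNIV (p i)" for i using cE by (simp add: coord_system_def)
  show "continuous_on (space_of E \<times> ({..<k} \<rightarrow>\<^sub>E space_of E)) (\<lambda>(x, v). iter_deriv E F f k x v)"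
  proof (rule coord_continuous [OF cF])
    fix j
    \<comment> \<open>Extensional families of k directions are \<open>undefined\<close> beyond k,
      which may lie outside the space. The coordinates are continuous on the ambient type, so
      continuity is shown there and restricted afterwards.\<close>
    have "continuous_on UNIV (\<lambda>z. env p (fst z) (snd z) ni)" for ni
    proof (cases ni)
      case (Pair n i)
      have "continuous_on UNIV (\<lambda>z::'e \<times> (nat \<Rightarrow> 'e). snd z m)" for m
        using continuous_on_compose2 [OF continuous_on_product_coordinates [of m] continuous_on_snd [OF continuous_on_id]] by simp
      from continuous_on_compose2 [OF ci this] show ?thesis unfolding Pair env_def
        using continuous_on_compose2 [OF ci continuous_on_fst [OF continuous_on_id]]
        by (cases n) auto
    qed
    then have "continuous_on UNIV (\<lambda>z. P j (env p (fst z) (snd z)))"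
      by (rule poly_fun_continuous [OF P(1)])
    then have "continuous_on (space_of E \<times> ({..<k} \<rightarrow>\<^sub>E space_of E)) (\<lambda>z. P j (env p (fst z) (snd z)))"
      by (rule continuous_on_subset) auto
    then show "continuous_on (space_of E \<times> ({..<k} \<rightarrow>\<^sub>E space_of E)) (\<lambda>z. q j (case z of (x, v) \<Rightarrow> iter_deriv E F f k x v))"
      by (rule continuous_on_eq) (auto simp: P(3) PiE_def Pi_def)
  qed
qed

end

section \<open>Complexification\<close>

text \<open>For an algebra over the reals, \<open>'b cx\<close> is its complexification.  Over either field it is a
  commutative algebra, so that everything proved for \<open>'b\<close> applies to it.\<close>

datatype 'b cx = Cx (re: 'b) (im: 'b)

lemma cx_eqI: "re z = re w \<Longrightarrow> im z = im w \<Longrightarrow> z = w"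
  by (cases z; cases w) auto

instantiation cx :: (comm_ring) comm_ring
begin
definition "0 = Cx 0 0"
definition "z + w = Cx (re z + re w) (im z + im w)"
definition "- z = Cx (- re z) (- im z)"
definition "z - w = Cx (re z - re w) (im z - im w)"
definition "z * w = Cx (re z * re w - im z * im w) (re z * im w + im z * re w)"
instance
  by standard (auto simp: zero_cx_def plus_cx_def uminus_cx_def minus_cx_def times_cx_def algebra_simps)
end

instantiation cx :: ("{comm_ring, comm_monoid_mult}") comm_monoid_mult
begin
definition "1 = Cx 1 0"
instance
  by standard (auto simp: one_cx_def times_cx_def algebra_simps)
end

lemma re_im_simps [simp]:
  "re 0 = 0" "im 0 = 0" "re 1 = 1" "im 1 = 0"
  "re (z + w) = re z + re w" "im (z + w) = im z + im w"
  "re (- z) = - re z" "im (- z) = - im z"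
  "re (z - w) = re z - re w" "im (z - w) = im z - im w"
  "re (z * w) = re z * re w - im z * im w" "im (z * w) = re z * im w + im z * re w"
  by (simp_all add: zero_cx_def one_cx_def plus_cx_def uminus_cx_def minus_cx_def times_cx_def)

instantiation cx :: (topological_space) topological_space
begin
definition open_cx_def: "open (U :: 'a cx set) \<longleftrightarrow> open ((\<lambda>(a, b). Cx a b) -` U)"
instance
  by standard (auto simp: open_cx_def vimage_Int vimage_Union)
end

lemma continuous_Cx: "continuous_on UNIV (\<lambda>(a, b). Cx a b :: 'b::topological_space cx)"
  by (simp add: continuous_on_open_vimage open_cx_def)

lemma continuous_re: "continuous_on UNIV (re :: 'b::topological_space cx \<Rightarrow> 'b)"
proof -
  have "(\<lambda>(a, b). Cx a b) -` re -` U = U \<times> (UNIV :: 'b set)" for U :: "'b set" by auto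
  then show ?thesis by (auto simp: continuous_on_open_vimage open_cx_def open_Times)
qed

lemma continuous_im: "continuous_on UNIV (im :: 'b::topological_space cx \<Rightarrow> 'b)"
proof -
  have "(\<lambda>(a, b). Cx a b) -` im -` U = (UNIV :: 'b set) \<times> U" for U :: "'b set" by auto
  then show ?thesis by (auto simp: continuous_on_open_vimage open_cx_def open_Times)
qed

lemma tendsto_Cx: "(f \<longlongrightarrow> a) F \<Longrightarrow> (g \<longlongrightarrow> b) F \<Longrightarrow> ((\<lambda>x. Cx (f x) (g x)) \<longlongrightarrow> Cx a b) F"
  using continuous_on_tendsto_compose [OF continuous_Cx tendsto_Pair] by simp

lemma continuous_on_Cx: "continuous_on D f \<Longrightarrow> continuous_on D g \<Longrightarrow> continuous_on D (\<lambda>x. Cx (f x) (g x))"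
  unfolding continuous_on_def by (blast intro: tendsto_Cx)

lemmas continuous_on_re = continuous_on_compose2 [OF continuous_re _ subset_UNIV]
lemmas continuous_on_im = continuous_on_compose2 [OF continuous_im _ subset_UNIV]

lemma Hausdorff_cx:
  assumes "Hausdorff_space (euclidean :: 'b::topological_space topology)"
  shows "Hausdorff_space (euclidean :: 'b cx topology)"
proof -
  have sep: "\<exists>U V. open U \<and> open V \<and> x \<in> U \<and> y \<in> V \<and> U \<inter> V = {}" if "x \<noteq> y" for x y :: 'b
    using assms that unfolding Hausdorff_space_def disjnt_def by auto
  have "\<exists>U V. open U \<and> open V \<and> z \<in> U \<and> w \<in> V \<and> disjnt U V" if "z \<noteq> w" for z w :: "'b cx"
  proof -
    have *: "\<exists>U V. open U \<and> open V \<and> z \<in> U \<and> w \<in> V \<and> disjnt U V"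
      if f: "continuous_on UNIV (f :: 'b cx \<Rightarrow> 'b)" "f z \<noteq> f w" for f
    proof -
      obtain U V where UV: "open U" "open V" "f z \<in> U" "f w \<in> V" "U \<inter> V = {}" using sep [OF f(2)] by blast
      have "open (f -` U)" "open (f -` V)" using f(1) UV(1,2) by (auto simp: continuous_on_open_vimage)
      then show ?thesis using UV by (intro exI [of _ "f -` U"] exI [of _ "f -` V"]) (auto simp: disjnt_def)
    qed
    show ?thesis using * [OF continuous_re] * [OF continuous_im] that cx_eqI by metis
  qed
  then show ?thesis by (simp add: Hausdorff_space_def)
qed

text \<open>The action of the ground field, under which \<open>'b cx\<close> is a target for the
  Hopf algebra. The complex action below is the one with respect to which derivatives in a
  complexification are taken.\<close>

definition cx_scale :: "('k \<Rightarrow> 'b \<Rightarrow> 'b) \<Rightarrow> 'k \<Rightarrow> 'b cx \<Rightarrow> 'b cx"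
  where "cx_scale sB c z = Cx (sB c (re z)) (sB c (im z))"

definition cx_complex_scale :: "('k::real_or_complex \<Rightarrow> 'b::ab_group_add \<Rightarrow> 'b) \<Rightarrow> complex \<Rightarrow> 'b cx \<Rightarrow> 'b cx"
  where "cx_complex_scale sB c z =
    Cx (sB (of_real (Re c)) (re z) - sB (of_real (Im c)) (im z)) (sB (of_real (Re c)) (im z) + sB (of_real (Im c)) (re z))"

lemma re_im_scale [simp]:
  "re (cx_scale sB c z) = sB c (re z)" "im (cx_scale sB c z) = sB c (im z)"
  "re (cx_complex_scale sB d z) = sB (of_real (Re d)) (re z) - sB (of_real (Im d)) (im z)"
  "im (cx_complex_scale sB d z) = sB (of_real (Re d)) (im z) + sB (of_real (Im d)) (re z)"
  by (simp_all add: cx_scale_def cx_complex_scale_def)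

lemma algebra_cx_scale:
  fixes sB :: "'k::real_or_complex \<Rightarrow> 'b::{comm_ring, comm_monoid_mult} \<Rightarrow> 'b"
  assumes "algebra_over sB" shows "algebra_over (cx_scale sB)"
proof -
  have vs: "vector_space sB" and 1: "\<And>c x y. sB c x * y = sB c (x * y)" and 2: "\<And>c x y. x * sB c y = sB c (x * y)"
    using assms unfolding algebra_over_def by metis+
  interpret vector_space sB by (rule vs)
  show ?thesis
    unfolding algebra_over_def vector_space_def
    by (auto intro!: cx_eqI simp: scale_right_distrib scale_left_distrib scale_right_diff_distrib 1 2)
qed

lemma algebra_cx_complex_scale:
  fixes sB :: "'k::real_or_complex \<Rightarrow> 'b::{comm_ring, comm_monoid_mult} \<Rightarrow> 'b"
  assumes "algebra_over sB" shows "algebra_over (cx_complex_scale sB)"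
proof -
  have vs: "vector_space sB" and 1: "\<And>c x y. sB c x * y = sB c (x * y)" and 2: "\<And>c x y. x * sB c y = sB c (x * y)"
    using assms unfolding algebra_over_def by metis+
  interpret vector_space sB by (rule vs)
  show ?thesis
    unfolding algebra_over_def vector_space_def
    by (auto intro!: cx_eqI simp: scale_right_distrib scale_left_distrib scale_right_diff_distrib
        scale_left_diff_distrib left_diff_distrib right_diff_distrib distrib_left distrib_right 1 2)
qed

lemma (in topological_algebra) topological_algebra_cx: "topological_algebra (cx_complex_scale sB)"
proof
  show "algebra_over (cx_complex_scale sB)" by (rule algebra_cx_complex_scale [OF algebra])
  show "Hausdorff_space (euclidean :: 'b cx topology)" by (rule Hausdorff_cx [OF hausdorff])
  have r: "((\<lambda>x. re (f x)) \<longlongrightarrow> re a) F" and i: "((\<lambda>x. im (f x)) \<longlongrightarrow> im a) F"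
    if "(f \<longlongrightarrow> a) F" for f :: "'x \<Rightarrow> 'b cx" and a F
    using continuous_on_tendsto_compose [OF continuous_re that] continuous_on_tendsto_compose [OF continuous_im that] by auto
  have "((\<lambda>z. fst z + snd z) \<longlongrightarrow> fst w + snd w) (at w within UNIV)" for w :: "'b cx \<times> 'b cx"
    unfolding plus_cx_def
    by (intro tendsto_Cx tendsto_plus r i tendsto_fst tendsto_snd tendsto_ident_at)
  then show "continuous_on UNIV (\<lambda>(x, y). x + y :: 'b cx)" by (simp add: continuous_on_def case_prod_unfold)
  have "((\<lambda>z. fst z * snd z) \<longlongrightarrow> fst w * snd w) (at w within UNIV)" for w :: "'b cx \<times> 'b cx"
    unfolding times_cx_def
    by (intro tendsto_Cx tendsto_plus tendsto_sub tendsto_times r i tendsto_fst tendsto_snd tendsto_ident_at)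
  then show "continuous_on UNIV (\<lambda>(x, y). x * y :: 'b cx)" by (simp add: continuous_on_def case_prod_unfold)
  have "((\<lambda>z. cx_complex_scale sB (fst z) (snd z)) \<longlongrightarrow> cx_complex_scale sB (fst w) (snd w)) (at w within UNIV)" for w
    unfolding cx_complex_scale_def
    by (intro tendsto_Cx tendsto_plus tendsto_sub tendsto_scl r i tendsto_fst tendsto_snd tendsto_ident_at
        tendsto_of_real tendsto_Re tendsto_Im)
  then show "continuous_on UNIV (\<lambda>(c, x). cx_complex_scale sB c x)" by (simp add: continuous_on_def case_prod_unfold)
qed

lemma space_of_complexification [simp]: "space_of (complexification E) = space_of E \<times> space_of E"
  by (simp add: complexification_def)

text \<open>The coordinates of x + i y are those of x and y joined to elements of
  \<open>'b cx\<close>. They are linear over the complex numbers, which puts complexifications under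
  the same calculus.\<close>

lemma coord_system_complexification:
  fixes E :: "('k::real_or_complex, 'e::{ab_group_add, topological_space}) lcs"
  assumes vs: "vector_space sB" and c: "coord_system sB E p r"
  shows "coord_system (cx_complex_scale sB) (complexification E)
    (\<lambda>i z. Cx (p i (fst z)) (p i (snd z))) (\<lambda>\<rho>. (r (\<lambda>i. re (\<rho> i)), r (\<lambda>i. im (\<rho> i))))"
proof -
  have p: "\<And>i. continuous_on UNIV (p i)" and r: "continuous_on UNIV r" and rp: "\<And>x. r (\<lambda>i. p i x) = x"
    and pr: "\<And>i \<rho>. p i (r \<rho>) = \<rho> i" and add: "\<And>i x y. p i (x + y) = p i x + p i y" and sc: "\<And>i a x. p i (scale E a x) = sB a (p i x)"
    and cl: "closed (space_of E)" and 0: "0 \<in> space_of E"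
    and plus: "\<And>x y. x \<in> space_of E \<Longrightarrow> y \<in> space_of E \<Longrightarrow> x + y \<in> space_of E"
    and scE: "\<And>a x. x \<in> space_of E \<Longrightarrow> scale E a x \<in> space_of E"
    using c unfolding coord_system_def by auto
  have "continuous_on UNIV (\<lambda>z. Cx (p i (fst z)) (p i (snd z)))" for i
    by (intro continuous_on_Cx continuous_on_compose2 [OF p] continuous_on_fst continuous_on_snd continuous_on_id) auto
  moreover have "continuous_on UNIV (\<lambda>\<rho>. (r (\<lambda>i. re (\<rho> i)), r (\<lambda>i. im (\<rho> i))))"
    by (intro continuous_on_Pair continuous_on_compose2 [OF r] continuous_on_coordinatewise_then_product
        continuous_on_re continuous_on_im continuous_on_product_coordinates) auto
  moreover have "Cx (p i (fst (scale (complexification E) a z))) (p i (snd (scale (complexification E) a z))) =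
      cx_complex_scale sB a (Cx (p i (fst z)) (p i (snd z)))" for i a z
    by (cases z) (simp add: complexification_def add sc coord_diff [OF c] cx_complex_scale_def)
  moreover have "scale (complexification E) a z \<in> space_of E \<times> space_of E" if "z \<in> space_of E \<times> space_of E" for a z
    using that by (cases z) (auto simp: complexification_def intro!: plus scE coord_system_diff [OF vs c])
  ultimately show ?thesis
    unfolding coord_system_def
    by (auto simp: rp pr add cl 0 plus plus_cx_def closed_Times zero_prod_def)
qed

section \<open>Analyticity of polynomial maps\<close>

context topological_algebra
begin

text \<open>The case distinction between the two fields is made here once and for all:
  \<open>f\<close> itself is used over the complex numbers, its polynomial extension
  \<open>f'\<close> over the reals.\<close>

lemma analytic_map_on_poly:
  fixes E :: "('k, 'e::{ab_group_add, topological_space}) lcs" and F :: "('k, 'f::{ab_group_add, topological_space}) lcs"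
  assumes cE: "coord_system sB E p r" and cF: "coord_system sB F q r'"
    and f: "\<And>x. x \<in> space_of E \<Longrightarrow> f x \<in> space_of F"
    and poly: "\<And>j. poly_map p (space_of E) (\<lambda>x. q j (f x))"
    and f': "\<And>z. z \<in> space_of E \<times> space_of E \<Longrightarrow> f' z \<in> space_of F \<times> space_of F"
    and poly': "\<And>j. poly_map (\<lambda>i z. Cx (p i (fst z)) (p i (snd z))) (space_of E \<times> space_of E)
      (\<lambda>z. Cx (q j (fst (f' z))) (q j (snd (f' z))))"
    and ext: "\<And>x. x \<in> space_of E \<Longrightarrow> f' (x, 0) = (f x, 0)"
  shows "analytic_map_on E F (space_of E) f"
proof (cases "is_complex_field TYPE('k)")
  case True
  then show ?thesis by (simp add: analytic_map_on_def smooth_on_poly [OF cE cF f poly])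
next
  case False
  interpret cx: topological_algebra "cx_complex_scale sB" by (rule topological_algebra_cx)
  have "smooth_on (complexification E) (complexification F) (space_of (complexification E)) f'"
    by (rule cx.smooth_on_poly [OF coord_system_complexification [OF bs.vector_space_axioms cE]
        coord_system_complexification [OF bs.vector_space_axioms cF]]) (auto simp: f' poly' simp del: mem_Times_iff)
  moreover have "space_of E \<times> {0} \<subseteq> space_of (complexification E)" using cE by (auto simp: coord_system_def)
  ultimately show ?thesis using False ext by (auto simp: analytic_map_on_def)
qed

text \<open>Covers the maps that become simple in the chart: identity, negation and the exponential
  map with its inverse. The extension to the complexification applies \<open>f\<close> to both
  components.\<close>

lemma coordinatewise_linear_analytic:
  fixes E :: "('k, 'e::{ab_group_add, topological_space}) lcs" and F :: "('k, 'f::{ab_group_add, topological_space}) lcs"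
  assumes cE: "coord_system sB E p r" and cF: "coord_system sB F q r'"
    and f: "\<And>x. x \<in> space_of E \<Longrightarrow> f x \<in> space_of F"
    and lin: "\<And>j. \<exists>i a. \<forall>x\<in>space_of E. q j (f x) = sB a (p i x)"
  shows "analytic_map_on E F (space_of E) f" "smooth_on E F (space_of E) f"
proof -
  have poly: "poly_map p (space_of E) (\<lambda>x. q j (f x))" for j
  proof -
    obtain i a where "\<forall>x\<in>space_of E. q j (f x) = sB a (p i x)" using lin by blast
    then show ?thesis by (auto intro: poly_map_cong [OF poly_map_scale [OF algebra poly_map_coord]])
  qed
  show "smooth_on E F (space_of E) f" by (rule smooth_on_poly [OF cE cF f poly])
  have 0: "0 \<in> space_of E" using cE by (simp add: coord_system_def)
  have f0: "f 0 = 0"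
  proof (rule coord_eqI [OF cF])
    fix j
    obtain i a where "\<forall>x\<in>space_of E. q j (f x) = sB a (p i x)" using lin by blast
    then show "q j (f 0) = q j 0" using 0 by (simp add: coord_zero [OF cE] coord_zero [OF cF])
  qed
  show "analytic_map_on E F (space_of E) f"
  proof (rule analytic_map_on_poly [OF cE cF f poly, where f' = "map_prod f f"])
    fix j
    obtain i a where ia: "\<forall>x\<in>space_of E. q j (f x) = sB a (p i x)" using lin by blast
    show "poly_map (\<lambda>i z. Cx (p i (fst z)) (p i (snd z))) (space_of E \<times> space_of E)
      (\<lambda>z. Cx (q j (fst (map_prod f f z))) (q j (snd (map_prod f f z))))"
      by (rule poly_map_cong [OF poly_map_scale [OF algebra_cx_scale [OF algebra] poly_map_coord [where i = i], where c = a]])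
        (use ia in \<open>auto simp: cx_scale_def\<close>)
  qed (auto simp: f f0)
qed

end

section \<open>Polynomial dependence of convolution, exponential and logarithm\<close>

context hopf_target
begin

definition poly_family where "poly_family p D F \<longleftrightarrow> (\<forall>x. poly_map p D (\<lambda>e. F e x))"

lemma poly_family_conv:
  assumes "poly_family p D F" "poly_family p D F'" "\<And>e. e \<in> D \<Longrightarrow> lin (F e)" "\<And>e. e \<in> D \<Longrightarrow> lin (F' e)"
  shows "poly_family p D (\<lambda>e. F e \<star> F' e)"
  unfolding poly_family_def
proof
  fix x
  have "poly_map p D (\<lambda>e. \<Sum>(a, b)\<leftarrow>sweedler x. F e a * F' e b)"
    unfolding case_prod_unfold
    by (intro poly_map_sum_list poly_map_times) (use assms(1,2) in \<open>auto simp: poly_family_def\<close>)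
  then show "poly_map p D (\<lambda>e. (F e \<star> F' e) x)"
    by (rule poly_map_cong) (simp add: conv_sweedler assms)
qed

lemma poly_family_cpow:
  assumes "poly_family p D F" "\<And>e. e \<in> D \<Longrightarrow> lin (F e)"
  shows "poly_family p D (\<lambda>e. cpow (F e) k)"
proof (induction k)
  case 0
  show ?case by (simp add: poly_family_def poly_map_const)
next
  case (Suc k)
  show ?case unfolding cpow_Suc
    by (rule poly_family_conv [OF assms(1) Suc assms(2) lin_cpow [OF assms(2)]])
qed

lemma poly_family_ser:
  assumes "poly_family p D F" "\<And>e. e \<in> D \<Longrightarrow> lin (F e)"
  shows "poly_family p D (\<lambda>e. ser c (F e))"
  using poly_family_cpow [OF assms] unfolding poly_family_def ser_def
  by (intro allI poly_map_sum poly_map_scale [OF algebra]) auto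

lemma poly_family_expc:
  assumes "poly_family p D F" "\<And>e. e \<in> D \<Longrightarrow> lin (F e)"
  shows "poly_family p D (\<lambda>e. expc (F e))"
  unfolding expc_def by (rule poly_family_ser [OF assms])

lemma poly_family_logc:
  assumes "poly_family p D F" "\<And>e. e \<in> D \<Longrightarrow> lin (F e)"
  shows "poly_family p D (\<lambda>e. logc (F e))"
  unfolding logc_def
proof (rule poly_family_ser)
  show "poly_family p D (\<lambda>e. F e - unit)"
    using assms(1) unfolding poly_family_def by (auto intro: poly_map_diff poly_map_const)
qed (simp add: lin_diff assms lin_unit)

lemma logc_conv_expc_in_L: "x \<in> L \<Longrightarrow> y \<in> L \<Longrightarrow> logc (expc x \<star> expc y) \<in> L"
  by (intro logc_in_L G_conv expc_in_G)

end

section \<open>Coordinates and complexification for spaces of linear maps\<close>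

definition fun_coord :: "'h \<Rightarrow> ('h \<Rightarrow> 'b) \<Rightarrow> 'b" where "fun_coord h \<phi> = \<phi> h"

definition pair_coord :: "'h + 'h \<Rightarrow> ('h \<Rightarrow> 'b) \<times> ('h \<Rightarrow> 'b) \<Rightarrow> 'b"
  where "pair_coord i z = (case i of Inl h \<Rightarrow> fst z h | Inr h \<Rightarrow> snd z h)"

text \<open>Together with \<open>cx_split\<close> this identifies the complexification of Hom(H, B)
  with the linear maps into \<open>'b cx\<close>: the pair stands for \<phi> + i \<psi>.\<close>

definition cx_join :: "('h \<Rightarrow> 'b) \<times> ('h \<Rightarrow> 'b) \<Rightarrow> 'h \<Rightarrow> 'b cx" where "cx_join z x = Cx (fst z x) (snd z x)"

definition cx_split :: "('h \<Rightarrow> 'b cx) \<Rightarrow> ('h \<Rightarrow> 'b) \<times> ('h \<Rightarrow> 'b)" where "cx_split \<theta> = (\<lambda>x. re (\<theta> x), \<lambda>x. im (\<theta> x))"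

lemma (in topological_algebra) closed_equalizer:
  assumes "continuous_on UNIV f" "continuous_on UNIV (g :: _ \<Rightarrow> 'b)"
  shows "closed {x. f x = g x}"
  using closedin_continuous_maps_eq [OF hausdorff, of euclidean f g] assms by simp

locale character_lie_group = graded_hopf H V
  for H :: "('k::real_or_complex, 'h::ring_1) hopf" and V :: "nat \<Rightarrow> 'h set" +
  fixes sB :: "'k \<Rightarrow> 'b::{comm_ring, comm_monoid_mult, topological_space} \<Rightarrow> 'b"
  assumes lca: "comm_locally_convex_algebra sB"
begin

sublocale hopf_target H V sB
  using lca by unfold_locales (simp add: comm_locally_convex_algebra_def)

sublocale ta: topological_algebra sB
proof
  show "algebra_over sB" by (rule algebra)
  have "locally_convex_space \<lparr>scale = sB, space_of = UNIV\<rparr>" using lca by (simp add: comm_locally_convex_algebra_def)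
  then show "Hausdorff_space (euclidean :: 'b topology)" "continuous_on UNIV (\<lambda>(x, y). x + y :: 'b)"
    "continuous_on UNIV (\<lambda>(c, x). sB c x)" by (auto simp: locally_convex_space_def)
  show "continuous_on UNIV (\<lambda>(x, y). x * y :: 'b)" using lca by (simp add: comm_locally_convex_algebra_def)
qed

text \<open>The same Hopf algebra with the complexified target: series, characters and infinitesimal
  characters, with all that is proved about them, become available for \<open>'b cx\<close>.\<close>

sublocale C: hopf_target H V "cx_scale sB"
  by unfold_locales (rule algebra_cx_scale [OF algebra])

no_notation C.conv (infixl "\<star>" 70)
no_notation C.scl (infixr "\<cdot>" 75)

abbreviation emb :: "('h \<Rightarrow> 'b) \<Rightarrow> 'h \<Rightarrow> 'b cx" where "emb \<phi> \<equiv> \<lambda>x. Cx (\<phi> x) 0"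

lemma C_lin_iff: "C.lin \<phi> \<longleftrightarrow> lin (\<lambda>x. re (\<phi> x)) \<and> lin (\<lambda>x. im (\<phi> x))"
  unfolding C.lin_iff lin_iff by (auto intro: cx_eqI)

lemma C_aug_iff: "C.aug \<phi> \<longleftrightarrow> aug (\<lambda>x. re (\<phi> x)) \<and> aug (\<lambda>x. im (\<phi> x))"
  unfolding C_lin_iff by (auto intro: cx_eqI)

lemma C_L_iff: "\<phi> \<in> C.L \<longleftrightarrow> (\<lambda>x. re (\<phi> x)) \<in> L \<and> (\<lambda>x. im (\<phi> x)) \<in> L"
  unfolding C.L_iff L_iff C_lin_iff by (auto intro: cx_eqI)

lemma emb_lin: "lin \<phi> \<Longrightarrow> C.lin (emb \<phi>)"
  using lin_zero by (simp add: C_lin_iff zero_fun_def)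

lemma emb_unit: "emb unit = C.unit"
  by (auto simp: conv_unit_def fun_eq_iff intro!: cx_eqI)

lemma Cx_zero: "Cx 0 0 = (0 :: 'b cx)" and Cx_add: "Cx (a + b) 0 = Cx a 0 + Cx (b :: 'b) 0"
  by (auto intro: cx_eqI)

lemma Cx_sum_list: "Cx (\<Sum>x\<leftarrow>xs. f x) 0 = (\<Sum>x\<leftarrow>xs. Cx (f x) 0 :: 'b cx)"
  by (induction xs) (auto simp: Cx_zero Cx_add)

lemma Cx_sum: "Cx (\<Sum>x\<in>X. f x) 0 = (\<Sum>x\<in>X. Cx (f x) 0 :: 'b cx)"
  by (induction X rule: infinite_finite_induct) (auto simp: Cx_zero Cx_add)

lemma Cx_mult: "Cx (a * b) 0 = Cx a 0 * Cx (b :: 'b) 0"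
  by (auto intro!: cx_eqI)

lemma emb_conv: "lin \<phi> \<Longrightarrow> lin \<psi> \<Longrightarrow> emb (\<phi> \<star> \<psi>) = convolution H (emb \<phi>) (emb \<psi>)"
  by (auto simp: fun_eq_iff conv_sweedler C.conv_sweedler emb_lin Cx_sum_list case_prod_unfold Cx_mult)

lemma emb_cpow: "lin \<phi> \<Longrightarrow> emb (cpow \<phi> k) = C.cpow (emb \<phi>) k"
  by (induction k) (simp_all add: emb_unit cpow_Suc C.cpow_Suc emb_conv lin_cpow)

text \<open>At arguments with zero imaginary part the complexified series reduces to the original
  one; this is what makes it an extension.\<close>

lemma emb_ser: assumes "lin \<phi>" shows "emb (ser c \<phi>) = C.ser c (emb \<phi>)"
proof
  fix x
  have "Cx (sB a (cpow \<phi> k x)) 0 = cx_scale sB a (C.cpow (emb \<phi>) k x)" for a k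
    by (simp add: cx_scale_def emb_cpow [OF assms, symmetric])
  then show "emb (ser c \<phi>) x = C.ser c (emb \<phi>) x"
    by (simp add: ser_def C.ser_def Cx_sum)
qed

lemma emb_expc: "lin \<phi> \<Longrightarrow> emb (expc \<phi>) = C.expc (emb \<phi>)"
  by (simp add: expc_def C.expc_def emb_ser)

lemma emb_logc: "lin \<phi> \<Longrightarrow> emb (logc \<phi>) = C.logc (emb \<phi>)"
proof -
  assume "lin \<phi>"
  moreover have "emb (\<phi> - unit) = emb \<phi> - C.unit"
    by (auto simp: fun_eq_iff conv_unit_def intro!: cx_eqI)
  ultimately show ?thesis by (simp add: logc_def C.logc_def emb_ser lin_diff lin_unit)
qed

section \<open>Closed subspaces of linear maps and their coordinates\<close>

abbreviation I where "I \<equiv> \<lparr>scale = scale (hom_lcs H sB), space_of = {\<phi> \<in> space_of (hom_lcs H sB). \<phi> 1 = 0}\<rparr>"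

lemma continuous_eval: "continuous_on UNIV (\<lambda>\<phi>. \<phi> x :: 'b)"
  by (rule continuous_on_product_coordinates)

lemma continuous_on_scl: "continuous_on D f \<Longrightarrow> continuous_on D (\<lambda>x. sB c (f x))"
  unfolding continuous_on_def by (auto intro!: ta.tendsto_scl tendsto_const)

lemma closed_Collect_lin: "closed (Collect lin)"
proof -
  have "Collect lin = (\<Inter>x. \<Inter>y. {\<phi>. \<phi> (x + y) = \<phi> x + \<phi> y}) \<inter> (\<Inter>c. \<Inter>x. {\<phi>. \<phi> (s c x) = sB c (\<phi> x)})"
    by (auto simp: lin_iff)
  moreover have "closed \<dots>"
    by (intro closed_Int closed_INT ballI ta.closed_equalizer continuous_eval ta.continuous_on_plus continuous_on_scl)
  ultimately show ?thesis by simp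
qed

lemma closed_L: "closed L"
proof -
  have "L = Collect lin \<inter> (\<Inter>x. \<Inter>y. {\<phi>. \<phi> (x * y) = sB (\<epsilon> x) (\<phi> y) + sB (\<epsilon> y) (\<phi> x)})"
    by (auto simp: L_iff)
  moreover have "closed \<dots>"
    by (intro closed_Int closed_Collect_lin closed_INT ballI ta.closed_equalizer continuous_eval ta.continuous_on_plus continuous_on_scl)
  ultimately show ?thesis by simp
qed

lemma closed_I: "closed (space_of I)"
proof -
  have "space_of I = Collect lin \<inter> {\<phi>. \<phi> 1 = 0}" by (auto simp: hom_lcs_def)
  moreover have "closed \<dots>"
    by (intro closed_Int closed_Collect_lin ta.closed_equalizer continuous_eval continuous_on_const)
  ultimately show ?thesis by simp
qed

lemma scale_hom_lcs [simp]: "scale (hom_lcs H sB) c \<phi> = c \<cdot> \<phi>"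
  by (simp add: hom_lcs_def)

lemma scale_inf_characters [simp]: "scale (inf_characters H sB) c \<phi> = c \<cdot> \<phi>"
  by (simp add: inf_characters_def)

lemma space_of_hom_lcs: "space_of (hom_lcs H sB) = Collect lin"
  by (simp add: hom_lcs_def)

lemma coord_system_fun:
  fixes E :: "('k, 'h \<Rightarrow> 'b) lcs"
  assumes "scale E = scale (hom_lcs H sB)" "closed (space_of E)" "0 \<in> space_of E"
    "\<And>x y. x \<in> space_of E \<Longrightarrow> y \<in> space_of E \<Longrightarrow> x + y \<in> space_of E"
    "\<And>c x. x \<in> space_of E \<Longrightarrow> c \<cdot> x \<in> space_of E"
  shows "coord_system sB E fun_coord (\<lambda>\<rho>. \<rho>)"
  using assms continuous_eval unfolding coord_system_def fun_coord_def by (auto simp: continuous_on_id)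

lemma coord_system_hom: "coord_system sB (hom_lcs H sB) fun_coord (\<lambda>\<rho>. \<rho>)"
  by (rule coord_system_fun) (auto simp: space_of_hom_lcs closed_Collect_lin lin_zero lin_add lin_scl)

lemma coord_system_I: "coord_system sB I fun_coord (\<lambda>\<rho>. \<rho>)"
  by (rule coord_system_fun) (use closed_I in \<open>auto simp: space_of_hom_lcs lin_zero lin_add lin_scl\<close>)

lemma coord_system_L: "coord_system sB (inf_characters H sB) fun_coord (\<lambda>\<rho>. \<rho>)"
  by (rule coord_system_fun) (auto simp: closed_L L_zero L_add L_scl inf_characters_def[of H sB, THEN arg_cong, of scale])

lemma coord_system_LL:
  "coord_system sB (prod_lcs (inf_characters H sB) (inf_characters H sB)) pair_coord
    (\<lambda>\<rho>. (\<lambda>h. \<rho> (Inl h), \<lambda>h. \<rho> (Inr h)))"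
proof -
  have "continuous_on UNIV (pair_coord i :: ('h \<Rightarrow> 'b) \<times> ('h \<Rightarrow> 'b) \<Rightarrow> 'b)" for i
    unfolding pair_coord_def
    by (cases i) (auto intro!: continuous_on_compose2 [OF continuous_eval] continuous_on_fst continuous_on_snd continuous_on_id)
  moreover have "continuous_on UNIV (\<lambda>\<rho>::'h + 'h \<Rightarrow> 'b. (\<lambda>h. \<rho> (Inl h), \<lambda>h. \<rho> (Inr h)))"
    by (intro continuous_on_Pair continuous_on_coordinatewise_then_product continuous_on_product_coordinates)
  moreover have "closed (L \<times> L)" by (intro closed_Times closed_L)
  ultimately show ?thesis
    unfolding coord_system_def
    by (auto simp: prod_lcs_def pair_coord_def L_add L_scl L_zero zero_prod_def split: sum.split)
qed

lemma poly_map_eval: "poly_map fun_coord D (\<lambda>\<phi>. \<phi> x)"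
  using poly_map_coord [of fun_coord D] by (simp add: fun_coord_def [abs_def])

lemma poly_family_id: "poly_family fun_coord D (\<lambda>\<phi>. \<phi>)"
  by (simp add: poly_family_def poly_map_eval)

text \<open>The extension to the complexification is the same series, evaluated at \<phi> + i \<psi>
  as a map into \<open>'b cx\<close>. A zero constant term keeps the values in
  \<open>I\<close>.\<close>

lemma analytic_ser:
  assumes "fps_nth c 0 = 0" "\<And>\<phi>. \<phi> \<in> space_of I \<Longrightarrow> f \<phi> = ser c \<phi>"
  shows "analytic_map_on I I (space_of I) f"
proof (rule ta.analytic_map_on_poly [OF coord_system_I coord_system_I, where f' = "\<lambda>z. cx_split (C.ser c (cx_join z))"])
  have I: "\<phi> \<in> space_of I \<longleftrightarrow> aug \<phi>" for \<phi> by (simp add: space_of_hom_lcs)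
  show "f \<phi> \<in> space_of I" if "\<phi> \<in> space_of I" for \<phi>
    using assms(2) [OF that] aug_ser [OF _ assms(1)] that unfolding I by simp
  have "poly_family fun_coord (space_of I) (ser c)"
    by (rule poly_family_ser [OF poly_family_id]) (simp add: space_of_hom_lcs)
  then show "poly_map fun_coord (space_of I) (\<lambda>x. fun_coord j (f x))" for j
    unfolding poly_family_def fun_coord_def by (auto intro: poly_map_cong simp: assms(2))
  let ?D = "space_of I \<times> space_of I"
  let ?p = "\<lambda>i (z :: ('h \<Rightarrow> 'b) \<times> ('h \<Rightarrow> 'b)). Cx (fun_coord i (fst z)) (fun_coord i (snd z))"
  have C: "C.aug (cx_join z)" if "z \<in> ?D" for z
    using that unfolding mem_Times_iff I by (simp add: C_lin_iff Cx_zero cx_join_def)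
  have "C.poly_family ?p ?D cx_join"
    unfolding C.poly_family_def using poly_map_coord [of ?p ?D] by (simp add: fun_coord_def cx_join_def)
  from C.poly_family_ser [OF this, of c] have "C.poly_family ?p ?D (\<lambda>z. C.ser c (cx_join z))"
    using C by blast
  then show "poly_map ?p ?D (\<lambda>z. Cx (fun_coord j (fst (cx_split (C.ser c (cx_join z)))))
      (fun_coord j (snd (cx_split (C.ser c (cx_join z))))))" for j
    by (simp add: cx_split_def fun_coord_def C.poly_family_def)
  show "cx_split (C.ser c (cx_join z)) \<in> ?D" if "z \<in> ?D" for z
    using C.aug_ser [OF C [OF that] assms(1)] unfolding cx_split_def mem_Times_iff I C_aug_iff by simp
  show "cx_split (C.ser c (cx_join (\<phi>, 0))) = (f \<phi>, 0)" if "\<phi> \<in> space_of I" for \<phi>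
  proof -
    have "cx_join (\<phi>, 0) = emb \<phi>" by (auto simp: cx_join_def)
    then show ?thesis
      using that emb_ser [of \<phi> c, symmetric] unfolding assms(2) [OF that] I by (auto simp: cx_split_def)
  qed
qed

lemma poly_family_pair: "poly_family pair_coord D fst" "poly_family pair_coord D snd"
  unfolding poly_family_def using poly_map_coord [of pair_coord D "Inl x" for x] poly_map_coord [of pair_coord D "Inr x" for x]
  by (simp_all add: pair_coord_def [abs_def])

text \<open>The Baker-Campbell-Hausdorff product, i.e. the group multiplication read in the chart
  \<open>logc\<close>.\<close>

definition bch where "bch z = logc (expc (fst z) \<star> expc (snd z))"

lemma analytic_bch:
  assumes "\<And>z. z \<in> L \<times> L \<Longrightarrow> f z = bch z"
  shows "analytic_map_on (prod_lcs (inf_characters H sB) (inf_characters H sB)) (inf_characters H sB) (L \<times> L) f"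
proof -
  let ?E = "prod_lcs (inf_characters H sB) (inf_characters H sB)"
  have E: "space_of ?E = L \<times> L" by (simp add: prod_lcs_def)
  let ?D = "(L \<times> L) \<times> (L \<times> L)"
  let ?p = "\<lambda>i (z :: (('h \<Rightarrow> 'b) \<times> ('h \<Rightarrow> 'b)) \<times> (('h \<Rightarrow> 'b) \<times> ('h \<Rightarrow> 'b))). Cx (pair_coord i (fst z)) (pair_coord i (snd z))"
  \<comment> \<open>A point of the complexified product space is (x, y) + i (x', y'). Regrouping
    gives the two arguments x + i x' and y + i y' with values in \<open>'b cx\<close>.\<close>
  define c1 :: "(('h \<Rightarrow> 'b) \<times> ('h \<Rightarrow> 'b)) \<times> (('h \<Rightarrow> 'b) \<times> ('h \<Rightarrow> 'b)) \<Rightarrow> 'h \<Rightarrow> 'b cx"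
    where "c1 z = cx_join (fst (fst z), fst (snd z))" for z
  define c2 :: "(('h \<Rightarrow> 'b) \<times> ('h \<Rightarrow> 'b)) \<times> (('h \<Rightarrow> 'b) \<times> ('h \<Rightarrow> 'b)) \<Rightarrow> 'h \<Rightarrow> 'b cx"
    where "c2 z = cx_join (snd (fst z), snd (snd z))" for z
  note c_defs = c1_def c2_def cx_join_def
  define FC where "FC z = C.logc (convolution H (C.expc (c1 z)) (C.expc (c2 z)))" for z
  have c: "c1 z \<in> C.L" "c2 z \<in> C.L" if "z \<in> ?D" for z
    using that by (auto simp: C_L_iff c_defs mem_Times_iff)
  have lc: "C.lin (c1 z)" "C.lin (c2 z)" "C.lin (C.expc (c1 z))" "C.lin (C.expc (c2 z))" if "z \<in> ?D" for z
    using C.L_aug [OF c(1) [OF that]] C.L_aug [OF c(2) [OF that]] C.lin_expc by blast+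
  have pc: "C.poly_family ?p ?D c1" "C.poly_family ?p ?D c2"
    unfolding C.poly_family_def using poly_map_coord [of ?p ?D "Inl x" for x] poly_map_coord [of ?p ?D "Inr x" for x]
    by (simp_all add: pair_coord_def c_defs)
  have pFC: "C.poly_family ?p ?D FC"
    unfolding FC_def [abs_def]
    by (intro C.poly_family_logc C.poly_family_conv C.poly_family_expc pc C.lin_conv lc)
  have ll: "lin (fst z)" "lin (snd z)" "lin (expc (fst z))" "lin (expc (snd z))" if "z \<in> L \<times> L" for z
    using that L_aug lin_expc by (auto simp: mem_Times_iff)
  have pb: "poly_family pair_coord (L \<times> L) bch"
    unfolding bch_def [abs_def]
    by (intro poly_family_logc poly_family_conv poly_family_expc poly_family_pair lin_conv ll)
  show ?thesis
  proof (rule ta.analytic_map_on_poly [OF coord_system_LL coord_system_L, unfolded E, where f' = "\<lambda>z. cx_split (FC z)"])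
    show "f z \<in> L" if "z \<in> L \<times> L" for z
      using that by (auto simp: assms bch_def logc_conv_expc_in_L)
    show "poly_map pair_coord (L \<times> L) (\<lambda>z. fun_coord j (f z))" for j
      using pb unfolding poly_family_def fun_coord_def by (auto intro: poly_map_cong simp: assms)
    \<comment> \<open>The exponentials of \<open>c1 z\<close> and \<open>c2 z\<close> are characters
      with values in \<open>'b cx\<close>, so the logarithm of their product is infinitesimal, and
      so are its two components.\<close>
    show "cx_split (FC z) \<in> L \<times> L" if "z \<in> ?D" for z
      using C.logc_conv_expc_in_L [OF c [OF that]] by (simp add: C_L_iff FC_def cx_split_def)
    show "poly_map ?p ?D (\<lambda>z. Cx (fun_coord j (fst (cx_split (FC z)))) (fun_coord j (snd (cx_split (FC z)))))" for j
      using pFC by (simp add: C.poly_family_def fun_coord_def cx_split_def)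
    show "cx_split (FC (z, 0)) = (f z, 0)" if z: "z \<in> L \<times> L" for z
    proof -
      have "c1 (z, 0) = emb (fst z)" "c2 (z, 0) = emb (snd z)" by (simp_all add: c_defs fun_eq_iff)
      then have "FC (z, 0) = emb (bch z)"
        using ll [OF z] by (simp add: FC_def bch_def emb_logc emb_conv emb_expc lin_conv)
      then show ?thesis using z by (auto simp: assms cx_split_def)
    qed
  qed
qed

end

section \<open>The character group as a manifold\<close>

lemma open_PiE_UNIV:
  fixes X :: "'i \<Rightarrow> 'b::topological_space set"
  assumes "\<And>i. open (X i)" "finite {i. X i \<noteq> UNIV}"
  shows "open {f. \<forall>i. f i \<in> X i}"
proof -
  have "{f. \<forall>i. f i \<in> X i} = Pi\<^sub>E UNIV X" by (auto simp: PiE_def Pi_def)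
  then show ?thesis using open_PiE [OF assms] by simp
qed

lemma inv_into_eqI: "(\<And>a. a \<in> A \<Longrightarrow> g (f a) = a) \<Longrightarrow> f (g b) = b \<Longrightarrow> g b \<in> A \<Longrightarrow> inv_into A f b = g b"
  by (metis inj_on_inverseI inv_into_f_eq)

context character_lie_group
begin

declare space_of_hom_lcs [simp]

lemma Hausdorff_subset: "Hausdorff_space (top_of_set (D :: ('h \<Rightarrow> 'b) set))"
proof -
  have "Hausdorff_space (euclidean :: ('h \<Rightarrow> 'b) topology)"
    unfolding euclidean_product_topology [symmetric] Hausdorff_space_product_topology using ta.hausdorff by simp
  then show ?thesis by (rule Hausdorff_space_subtopology)
qed

lemma locally_convex_fun:
  fixes E :: "('k, 'h \<Rightarrow> 'b) lcs"
  assumes sc: "scale E = scale (hom_lcs H sB)" and 0: "0 \<in> space_of E"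
    and add: "\<And>x y. x \<in> space_of E \<Longrightarrow> y \<in> space_of E \<Longrightarrow> x + y \<in> space_of E"
    and scl: "\<And>c x. x \<in> space_of E \<Longrightarrow> c \<cdot> x \<in> space_of E"
  shows "locally_convex_space E"
  unfolding locally_convex_space_def
proof (intro conjI allI impI)
  have E: "scale E = (\<lambda>c x. c \<cdot> x)" using sc by (simp add: fun_eq_iff)
  show vs: "vector_space (scale E)" unfolding E by (rule vector_space_fun) (rule bs.vector_space_axioms)
  then interpret vE: vector_space "scale E" .
  show "vE.subspace (space_of E)" unfolding vE.subspace_def using assms by (auto simp: E)
  show "Hausdorff_space (top_of_set (space_of E))" by (rule Hausdorff_subset)
  have "((\<lambda>z. fst z + snd z) \<longlongrightarrow> fst w + snd w) (at w within D)" for w :: "('h \<Rightarrow> 'b) \<times> ('h \<Rightarrow> 'b)" and D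
    using tendsto_fst [OF tendsto_ident_at, of w D] tendsto_snd [OF tendsto_ident_at, of w D]
    unfolding tendsto_fun_iff plus_fun_apply by (auto intro: ta.tendsto_plus)
  then show "continuous_on (space_of E \<times> space_of E) (\<lambda>(x, y). x + y)" by (simp add: continuous_on_def case_prod_unfold)
  have "((\<lambda>z. scale E (fst z) (snd z)) \<longlongrightarrow> scale E (fst w) (snd w)) (at w within D)" for w D
    using tendsto_fst [OF tendsto_ident_at, of w D] tendsto_snd [OF tendsto_ident_at, of w D]
    unfolding tendsto_fun_iff E by (auto intro: ta.tendsto_scl)
  then show "continuous_on (UNIV \<times> space_of E) (\<lambda>(c, x). scale E c x)" by (simp add: continuous_on_def case_prod_unfold)
  fix W assume W: "openin (top_of_set (space_of E)) W \<and> 0 \<in> W"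
  then obtain T where T: "open T" "W = space_of E \<inter> T" by (auto simp: openin_open)
  have "0 \<in> T" using W T by auto
  then obtain X where X: "(0 :: 'h \<Rightarrow> 'b) \<in> Pi\<^sub>E UNIV X" "\<And>i. open (X i)" "finite {i. X i \<noteq> UNIV}" "Pi\<^sub>E UNIV X \<subseteq> T"
    using product_topology_open_contains_basis [of "\<lambda>i. euclidean" UNIV T 0] T(1)
    by (auto simp: euclidean_product_topology)
  \<comment> \<open>Neighbourhoods are chosen coordinate by coordinate. Where \<open>X i\<close> is
    everything, \<open>N i\<close> must be everything too, so that only finitely many coordinates
    are restricted and the product of the \<open>N i\<close> is open.\<close>
  have "\<exists>N C. open N \<and> 0 \<in> N \<and> N \<subseteq> C \<and> C \<subseteq> X i \<and> (X i = UNIV \<longrightarrow> N = UNIV) \<and>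
    (\<forall>x\<in>C. \<forall>y\<in>C. \<forall>t\<in>{0..1::real}. sB (of_real t) x + sB (of_real (1 - t)) y \<in> C)" for i
  proof (cases "X i = UNIV")
    case True
    then show ?thesis by (intro exI [of _ UNIV]) auto
  next
    case False
    have "locally_convex_space \<lparr>scale = sB, space_of = UNIV\<rparr>" using lca by (simp add: comm_locally_convex_algebra_def)
    moreover have "open (X i) \<and> 0 \<in> X i" using X(1,2) by (auto simp: PiE_def Pi_def)
    ultimately show ?thesis using False unfolding locally_convex_space_def by simp
  qed
  then obtain N C where NC: "\<And>i. open (N i)" "\<And>i. 0 \<in> N i" "\<And>i. N i \<subseteq> C i" "\<And>i. C i \<subseteq> X i" "\<And>i. X i = UNIV \<Longrightarrow> N i = UNIV"
    "\<And>i x y t. x \<in> C i \<Longrightarrow> y \<in> C i \<Longrightarrow> t \<in> {0..1::real} \<Longrightarrow> sB (of_real t) x + sB (of_real (1 - t)) y \<in> C i"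
    by metis
  have "open {f. \<forall>i. f i \<in> N i}"
  proof (rule open_PiE_UNIV [OF NC(1)])
    show "finite {i. N i \<noteq> UNIV}" by (rule finite_subset [OF _ X(3)]) (use NC(5) in auto)
  qed
  then have "openin (top_of_set (space_of E)) (space_of E \<inter> {f. \<forall>i. f i \<in> N i})" by (rule openin_open_Int)
  moreover have "space_of E \<inter> {f. \<forall>i. f i \<in> C i} \<subseteq> W" using NC(4) X(4) T(2) by (fastforce simp: PiE_def Pi_def)
  moreover have "scale E (of_real t) x + scale E (of_real (1 - t)) y \<in> space_of E \<inter> {f. \<forall>i. f i \<in> C i}"
    if "x \<in> space_of E \<inter> {f. \<forall>i. f i \<in> C i}" "y \<in> space_of E \<inter> {f. \<forall>i. f i \<in> C i}" "t \<in> {0..1}" for x y t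
    using that NC(6) by (auto simp: E add scl)
  ultimately show "\<exists>N C. openin (top_of_set (space_of E)) N \<and> 0 \<in> N \<and> N \<subseteq> C \<and> C \<subseteq> W \<and>
        (\<forall>x\<in>C. \<forall>y\<in>C. \<forall>t\<in>{0..1::real}. scale E (of_real t) x + scale E (of_real (1 - t)) y \<in> C)"
    using NC(2,3) 0
    by (intro exI [of _ "space_of E \<inter> {f. \<forall>i. f i \<in> N i}"] exI [of _ "space_of E \<inter> {f. \<forall>i. f i \<in> C i}"]) (auto simp: subset_iff)
qed

lemma locally_convex_I: "locally_convex_space I"
  by (rule locally_convex_fun) (auto simp: space_of_hom_lcs lin_zero lin_add lin_scl)

lemma locally_convex_L: "locally_convex_space (inf_characters H sB)"
  by (rule locally_convex_fun) (auto simp: L_zero L_add L_scl inf_characters_def [of H sB, THEN arg_cong, of scale])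

section \<open>The logarithm as a chart\<close>

abbreviation U where "U \<equiv> {\<phi>. lin \<phi> \<and> \<phi> 1 = 1}"
abbreviation CG where "CG \<equiv> character_group H sB"
abbreviation g where "g \<equiv> inf_characters H sB"

definition char_mfd where "char_mfd = \<lparr>model = g, mtop = top_of_set G, atlas = {(G, logc)}\<rparr>"

lemma char_mfd_simps [simp]:
  "model char_mfd = g" "mtop char_mfd = top_of_set G" "atlas char_mfd = {(G, logc)}"
  by (simp_all add: char_mfd_def)

lemma unital_simps [simp]:
  "model (unital_hom_mfd H sB) = I" "mtop (unital_hom_mfd H sB) = top_of_set U"
  "atlas (unital_hom_mfd H sB) = {(U, \<lambda>\<phi>. \<phi> - unit)}"
  by (simp_all add: unital_hom_mfd_def Let_def space_of_hom_lcs)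

lemma space_of_I: "space_of I = {\<phi>. aug \<phi>}"
  by (auto simp: space_of_hom_lcs)

lemma G_subset_U: "G \<subseteq> U"
  by (auto simp: G_iff)

lemma L_subset_I: "L \<subseteq> space_of I"
  using L_aug by (auto simp: space_of_I)

lemma continuous_on_fun_coord: "continuous_on D (fun_coord x :: _ \<Rightarrow> 'b)"
  unfolding fun_coord_def [abs_def] by (rule continuous_on_subset [OF continuous_eval]) simp

lemma continuous_on_poly_family:
  fixes p :: "'i \<Rightarrow> 'e::topological_space \<Rightarrow> 'b"
  assumes "poly_family p D F" "\<And>i. continuous_on D (p i)"
  shows "continuous_on D F"
proof (rule continuous_on_coordinatewise_then_product)
  show "continuous_on D (\<lambda>e. F e x)" for x
    by (rule ta.poly_map_continuous [where p = p]) (use assms in \<open>simp_all add: poly_family_def\<close>)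
qed

lemma continuous_on_logc: "continuous_on U logc"
  by (rule continuous_on_poly_family [OF poly_family_logc [OF poly_family_id]]) (auto simp: continuous_on_fun_coord)

lemma continuous_on_expc: "continuous_on (space_of I) expc"
  by (rule continuous_on_poly_family [OF poly_family_expc [OF poly_family_id]]) (auto simp: continuous_on_fun_coord space_of_I)

lemma homeomorphic_maps_UI: "homeomorphic_maps (top_of_set U) (top_of_set (space_of I)) logc expc"
  unfolding homeomorphic_maps_def
  using continuous_on_logc continuous_on_expc
  by (auto simp: space_of_I aug_logc lin_expc expc_one expc_logc logc_expc)

lemma homeomorphic_maps_GL: "homeomorphic_maps (top_of_set G) (top_of_set L) logc expc"
proof -
  have "continuous_on G logc" "continuous_on L expc"
    using continuous_on_subset [OF continuous_on_logc G_subset_U] continuous_on_subset [OF continuous_on_expc L_subset_I] by auto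
  then show ?thesis
    unfolding homeomorphic_maps_def using G_subset_U L_aug
    by (auto simp: logc_in_L expc_in_G expc_logc logc_expc image_subset_iff)
qed

lemma logc_image_G: "logc ` G = L"
  using homeomorphic_imp_surjective_map [OF homeomorphic_maps_imp_map [OF homeomorphic_maps_GL]] by simp

lemma logc_image_U: "logc ` U = space_of I"
  using homeomorphic_imp_surjective_map [OF homeomorphic_maps_imp_map [OF homeomorphic_maps_UI]] by simp

lemma expc_logc_G: "\<phi> \<in> G \<Longrightarrow> expc (logc \<phi>) = \<phi>" and logc_expc_L: "\<psi> \<in> L \<Longrightarrow> logc (expc \<psi>) = \<psi>"
  using L_aug by (auto simp: G_iff expc_logc logc_expc)

lemma inv_into_logc: "\<psi> \<in> L \<Longrightarrow> inv_into G logc \<psi> = expc \<psi>"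
  by (intro inv_into_eqI) (auto simp: expc_logc_G logc_expc_L expc_in_G)

lemma inv_into_logc_U: "\<psi> \<in> space_of I \<Longrightarrow> inv_into U logc \<psi> = expc \<psi>"
  by (intro inv_into_eqI) (auto simp: expc_logc logc_expc lin_expc expc_one space_of_I)

lemma inv_into_translation: "\<psi> \<in> space_of I \<Longrightarrow> inv_into U (\<lambda>\<phi>. \<phi> - unit) \<psi> = \<psi> + unit"
  by (intro inv_into_eqI [where g = "\<lambda>\<psi>. \<psi> + unit"]) (auto simp: space_of_I lin_add lin_unit)

lemma translation_image: "(\<lambda>\<phi>. \<phi> - unit) ` U = space_of I"
proof
  show "(\<lambda>\<phi>. \<phi> - unit) ` U \<subseteq> space_of I" using aug_diff_unit by (auto simp: space_of_I)
  show "space_of I \<subseteq> (\<lambda>\<phi>. \<phi> - unit) ` U"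
  proof
    fix \<psi> assume "\<psi> \<in> space_of I"
    then have "\<psi> + unit \<in> U" by (auto simp: space_of_I lin_add lin_unit)
    then show "\<psi> \<in> (\<lambda>\<phi>. \<phi> - unit) ` U" by (rule rev_image_eqI) simp
  qed
qed

lemma analytic_id_I: "(\<And>x. x \<in> space_of I \<Longrightarrow> f x = x) \<Longrightarrow> analytic_map_on I I (space_of I) f"
  by (rule analytic_ser [of fps_X]) (auto simp: space_of_I ser_X)

lemma analytic_id_L: "(\<And>x. x \<in> L \<Longrightarrow> f x = x) \<Longrightarrow> analytic_map_on g g L f"
  by (rule ta.coordinatewise_linear_analytic(1) [OF coord_system_L coord_system_L])
    (simp_all add: fun_coord_def, metis bs.scale_one)

lemma continuous_on_translation: "continuous_on D (\<lambda>\<phi>. \<phi> - unit)" "continuous_on D (\<lambda>\<phi>. \<phi> + unit)"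
  by (rule continuous_on_poly_family [where p = fun_coord]; auto simp: continuous_on_fun_coord poly_family_def
      intro!: poly_map_diff poly_map_plus poly_map_const poly_map_eval)+

lemma homeomorphic_map_translation: "homeomorphic_map (top_of_set U) (top_of_set (space_of I)) (\<lambda>\<phi>. \<phi> - unit)"
proof (rule homeomorphic_maps_imp_map)
  show "homeomorphic_maps (top_of_set U) (top_of_set (space_of I)) (\<lambda>\<phi>. \<phi> - unit) (\<lambda>\<phi>. \<phi> + unit)"
    unfolding homeomorphic_maps_def
    by (auto simp: continuous_on_translation space_of_I lin_add lin_unit lin_diff)
qed

lemma is_chart_translation: "is_chart I (top_of_set U) (U, \<lambda>\<phi>. \<phi> - unit)"
  using homeomorphic_map_translation by (simp add: is_chart_def translation_image subtopology_subtopology)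

lemma is_chart_logc_U: "is_chart I (top_of_set U) (U, logc)"
  using homeomorphic_maps_imp_map [OF homeomorphic_maps_UI] by (simp add: is_chart_def logc_image_U subtopology_subtopology)

lemma is_chart_logc: "is_chart g (top_of_set G) (G, logc)"
  using homeomorphic_maps_imp_map [OF homeomorphic_maps_GL] by (simp add: is_chart_def logc_image_G subtopology_subtopology)

lemma analytic_manifold_unital: "analytic_manifold (unital_hom_mfd H sB)"
proof -
  have "analytic_map_on I I (space_of I) (local_rep (U, \<lambda>\<phi>. \<phi> - unit) (U, \<lambda>\<phi>. \<phi> - unit) (\<lambda>p. p))"
    by (rule analytic_id_I) (simp only: local_rep_def o_def snd_conv fst_conv inv_into_translation add_diff_cancel)
  then show ?thesis
    unfolding analytic_manifold_def unital_simps
    by (simp add: locally_convex_I Hausdorff_subset is_chart_translation analytic_transition_def translation_image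
        del: space_of_hom_lcs)
qed

lemma analytic_manifold_char: "analytic_manifold char_mfd"
  unfolding analytic_manifold_def char_mfd_simps
  by (auto simp: locally_convex_L Hausdorff_subset is_chart_logc analytic_transition_def local_rep_def
      logc_image_G inv_into_logc logc_expc_L intro!: analytic_id_L)

text \<open>Relative to the translation chart the logarithm is the series log(1 + X) and its inverse
  is exp(X) - 1; both have zero constant term.\<close>

lemma logc_in_maximal_atlas: "(U, logc) \<in> maximal_atlas (unital_hom_mfd H sB)"
proof -
  have "analytic_map_on I I (space_of I) (local_rep (U, logc) (U, \<lambda>\<phi>. \<phi> - unit) (\<lambda>p. p))"
    by (rule analytic_ser [of "fps_exp 1 - 1"])
      (simp_all only: local_rep_def o_def snd_conv fst_conv inv_into_logc_U ser_diff ser_one expc_def fps_sub_nth fps_exp_0, simp)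
  moreover have "analytic_map_on I I (space_of I) (local_rep (U, \<lambda>\<phi>. \<phi> - unit) (U, logc) (\<lambda>p. p))"
    by (rule analytic_ser [of "fps_ln 1"])
      (simp_all only: local_rep_def o_def snd_conv fst_conv inv_into_translation logc_def add_diff_cancel fps_ln_0)
  ultimately show ?thesis
    unfolding maximal_atlas_def unital_simps analytic_transition_def
    using is_chart_logc_U by (simp add: logc_image_U translation_image del: space_of_hom_lcs)
qed

text \<open>The chart \<open>logc\<close> of the unital maps is adapted: it sends the characters
  onto \<open>L\<close>, and \<open>L\<close> is exactly the part of the image of the chart that
  lies in this closed subspace.\<close>

lemma analytic_submanifold_char: "analytic_submanifold (unital_hom_mfd H sB) G g char_mfd"
proof -
  have "closed_subspace I g"
  proof -
    have "vector_space (\<lambda>c \<phi>. c \<cdot> \<phi>)" by (rule vector_space_fun) (rule bs.vector_space_axioms)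
    then interpret v: vector_space "\<lambda>c \<phi>. c \<cdot> \<phi>" .
    have "scale I = (\<lambda>c \<phi>. c \<cdot> \<phi>)" by (simp add: fun_eq_iff)
    moreover have "v.subspace L" unfolding v.subspace_def using L_zero L_add L_scl by auto
    moreover have "closedin (top_of_set (space_of I)) L"
      using closed_L L_subset_I by (simp add: closed_subset)
    ultimately show ?thesis by (simp add: closed_subspace_def inf_characters_def)
  qed
  moreover have "(G, logc) \<in> adapted_charts (unital_hom_mfd H sB) G g"
  proof -
    have UG: "U \<inter> G = G" using G_subset_U by blast
    have "logc ` (U \<inter> G) = logc ` U \<inter> L"
      using L_subset_I unfolding UG logc_image_G logc_image_U by blast
    then have "(U \<inter> G, logc) \<in> adapted_charts (unital_hom_mfd H sB) G g"
      unfolding adapted_charts_def using logc_in_maximal_atlas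
      by (intro CollectI exI [of _ U] exI [of _ logc] conjI refl)
    then show ?thesis unfolding UG .
  qed
  moreover have "subtopology (top_of_set U) G = top_of_set G"
    using G_subset_U by (simp add: subtopology_subtopology Int_absorb1)
  ultimately show ?thesis
    using G_subset_U analytic_manifold_unital analytic_manifold_char by (simp add: analytic_submanifold_def)
qed

section \<open>The Lie group structure\<close>

lemma CG_simps [simp]: "mult CG = convolution H" "one CG = unit"
  by (simp_all add: character_group_def)

lemma continuous_on_conv: "continuous_on (G \<times> G) (\<lambda>z. fst z \<star> snd z)"
proof (rule continuous_on_poly_family [OF poly_family_conv])
  show "continuous_on (G \<times> G) (pair_coord i :: _ \<Rightarrow> 'b)" for i
    using coord_system_LL by (auto simp: coord_system_def intro: continuous_on_subset)
qed (auto simp: G_iff intro: poly_family_pair)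

lemma inv_into_map_prod: "z \<in> L \<times> L \<Longrightarrow> inv_into (G \<times> G) (map_prod logc logc) z = map_prod expc expc z"
  by (intro inv_into_eqI) (auto simp: expc_logc_G logc_expc_L expc_in_G)

text \<open>Products of characters never leave the chart domain, so the local representative is
  \<open>bch\<close> on all of \<open>L \<times> L\<close>.\<close>

lemma analytic_mult: "analytic_map (prod_mfd char_mfd char_mfd) char_mfd (\<lambda>(x, y). x \<otimes>\<^bsub>CG\<^esub> y)"
proof -
  have "continuous_map (prod_topology (top_of_set G) (top_of_set G)) (top_of_set G) (\<lambda>(x, y). x \<otimes>\<^bsub>CG\<^esub> y)"
    using continuous_on_conv G_conv by (auto simp: case_prod_unfold prod_topology_subtopology_eu)
  moreover have "map_prod logc logc ` (G \<times> G \<inter> (\<lambda>(x, y). x \<otimes>\<^bsub>CG\<^esub> y) -` G) = L \<times> L"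
  proof -
    have "G \<times> G \<inter> (\<lambda>(x, y). x \<otimes>\<^bsub>CG\<^esub> y) -` G = G \<times> G" using G_conv by auto
    then show ?thesis by (simp add: map_prod_surj_on logc_image_G)
  qed
  moreover have "analytic_map_on (prod_lcs g g) g (L \<times> L) (local_rep (G \<times> G, map_prod logc logc) (G, logc) (\<lambda>(x, y). x \<otimes>\<^bsub>CG\<^esub> y))"
    by (rule analytic_bch) (auto simp: local_rep_def inv_into_map_prod bch_def)
  ultimately show ?thesis by (simp add: analytic_map_def prod_mfd_def)
qed

text \<open>Inversion is negation in the chart, which multiplies every coordinate by -1.\<close>

lemma analytic_inverse: "analytic_map char_mfd char_mfd (\<lambda>x. inv\<^bsub>CG\<^esub> x)"
proof -
  have inv: "x \<in> G \<Longrightarrow> inv\<^bsub>CG\<^esub> x \<in> G" for x using group.inv_closed [OF group_G] by simp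
  have "continuous_on L uminus"
    by (rule continuous_on_poly_family [where p = fun_coord])
      (auto simp: continuous_on_fun_coord poly_family_def intro!: poly_map_uminus poly_map_eval)
  then have "continuous_on G (\<lambda>x. - logc x)"
    by (rule continuous_on_compose2 [OF _ continuous_on_subset [OF continuous_on_logc G_subset_U]]) (simp add: logc_image_G)
  then have "continuous_on G (\<lambda>x. expc (- logc x))"
    by (rule continuous_on_compose2 [OF continuous_on_subset [OF continuous_on_expc L_subset_I]])
      (auto intro: L_minus logc_in_L)
  then have "continuous_on G (\<lambda>x. inv\<^bsub>CG\<^esub> x)" by (rule continuous_on_eq) (simp add: inv_G)
  moreover have "G \<inter> (\<lambda>x. inv\<^bsub>CG\<^esub> x) -` G = G" using inv by auto
  moreover have "analytic_map_on g g L (local_rep (G, logc) (G, logc) (\<lambda>x. inv\<^bsub>CG\<^esub> x))"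
  proof (rule ta.coordinatewise_linear_analytic(1) [OF coord_system_L coord_system_L])
    have *: "local_rep (G, logc) (G, logc) (\<lambda>x. inv\<^bsub>CG\<^esub> x) x = - x" if "x \<in> L" for x
      using that by (simp add: local_rep_def inv_into_logc inv_G expc_in_G logc_expc_L L_minus)
    then show "local_rep (G, logc) (G, logc) (\<lambda>x. inv\<^bsub>CG\<^esub> x) x \<in> L" if "x \<in> L" for x using that by (simp add: L_minus)
    show "\<exists>i a. \<forall>x\<in>L. fun_coord j (local_rep (G, logc) (G, logc) (\<lambda>x. inv\<^bsub>CG\<^esub> x) x) = sB a (fun_coord i x)" for j
      by (rule exI [of _ j], rule exI [of _ "- 1"]) (simp add: * fun_coord_def)
  qed
  ultimately show ?thesis using inv by (auto simp: analytic_map_def logc_image_G)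
qed

lemma analytic_lie_group_char: "analytic_lie_group CG char_mfd"
  using group_G analytic_manifold_char analytic_mult analytic_inverse by (simp add: analytic_lie_group_def)

section \<open>Derivatives of curves in the convolution algebra\<close>

text \<open>The derivative at 0 for pointwise convergence, with the parameter in the ground field.
  That it lies in a given subspace is shown separately, by closedness.\<close>

definition curve_deriv :: "('k \<Rightarrow> 'h \<Rightarrow> 'b) \<Rightarrow> ('h \<Rightarrow> 'b) \<Rightarrow> bool"
  where "curve_deriv F D \<longleftrightarrow> (\<forall>x. ((\<lambda>t. sB (inverse t) (F t x - F 0 x)) \<longlongrightarrow> D x) (at 0))"

lemma curve_deriv_const: "curve_deriv (\<lambda>t. \<phi>) 0"
  by (simp add: curve_deriv_def)

lemma eventually_nonzero: "\<forall>\<^sub>F t in at (0::'k). t \<noteq> 0"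
  using eventually_neq_at_within [of 0 0 UNIV] by simp

lemma curve_deriv_line: "curve_deriv (\<lambda>t. t \<cdot> \<phi>) \<phi>"
  unfolding curve_deriv_def
  by (intro allI tendsto_eventually eventually_mono [OF eventually_nonzero]) simp

lemma curve_deriv_add: "curve_deriv F D \<Longrightarrow> curve_deriv F' D' \<Longrightarrow> curve_deriv (\<lambda>t. F t + F' t) (D + D')"
  unfolding curve_deriv_def
proof (intro allI)
  fix x
  assume "\<forall>x. ((\<lambda>t. sB (inverse t) (F t x - F 0 x)) \<longlongrightarrow> D x) (at 0)" "\<forall>x. ((\<lambda>t. sB (inverse t) (F' t x - F' 0 x)) \<longlongrightarrow> D' x) (at 0)"
  then have "((\<lambda>t. sB (inverse t) (F t x - F 0 x) + sB (inverse t) (F' t x - F' 0 x)) \<longlongrightarrow> D x + D' x) (at 0)"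
    by (intro ta.tendsto_plus) auto
  then show "((\<lambda>t. sB (inverse t) ((F t + F' t) x - (F 0 + F' 0) x)) \<longlongrightarrow> (D + D') x) (at 0)"
    by (simp add: bs.scale_right_distrib [symmetric] add_diff_add)
qed

lemma curve_deriv_continuous: assumes "curve_deriv F D" shows "((\<lambda>t. F t x) \<longlongrightarrow> F 0 x) (at 0)"
proof -
  have "((\<lambda>t. F 0 x + sB t (sB (inverse t) (F t x - F 0 x))) \<longlongrightarrow> F 0 x + sB 0 (D x)) (at 0)"
    using assms unfolding curve_deriv_def by (intro ta.tendsto_plus tendsto_const ta.tendsto_scl tendsto_ident_at) auto
  moreover have "\<forall>\<^sub>F t in at 0. F 0 x + sB t (sB (inverse t) (F t x - F 0 x)) = F t x"
    by (rule eventually_mono [OF eventually_nonzero]) simp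
  ultimately show ?thesis by (auto dest: Lim_transform_eventually)
qed

lemma tendsto_sum_list:
  assumes "\<And>p. p \<in> set xs \<Longrightarrow> ((\<lambda>t. f p t) \<longlongrightarrow> (l p :: 'b)) A"
  shows "((\<lambda>t. \<Sum>p\<leftarrow>xs. f p t) \<longlongrightarrow> (\<Sum>p\<leftarrow>xs. l p)) A"
  using assms by (induction xs) (auto intro: ta.tendsto_plus)

lemma tendsto_finite_sum:
  assumes "\<And>p. p \<in> X \<Longrightarrow> ((\<lambda>t. f p t) \<longlongrightarrow> (l p :: 'b)) A"
  shows "((\<lambda>t. \<Sum>p\<in>X. f p t) \<longlongrightarrow> (\<Sum>p\<in>X. l p)) A"
  using assms by (induction X rule: infinite_finite_induct) (auto intro: ta.tendsto_plus)

lemma scale_sum_list_diff: "sB c ((\<Sum>p\<leftarrow>xs. f p) - (\<Sum>p\<leftarrow>xs. f' p)) = (\<Sum>p\<leftarrow>xs. sB c (f p - f' p))"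
  by (induction xs) (auto simp: bs.scale_right_distrib add_diff_add)

lemma curve_deriv_conv:
  assumes "curve_deriv F D" "curve_deriv F' D'" "\<And>t. lin (F t)" "\<And>t. lin (F' t)" "lin D" "lin D'"
  shows "curve_deriv (\<lambda>t. F t \<star> F' t) (D \<star> F' 0 + F 0 \<star> D')"
  unfolding curve_deriv_def
proof
  fix x
  have "((\<lambda>t. \<Sum>p\<leftarrow>sweedler x. sB (inverse t) (F t (fst p) - F 0 (fst p)) * F' t (snd p) + F 0 (fst p) * sB (inverse t) (F' t (snd p) - F' 0 (snd p)))
      \<longlongrightarrow> (\<Sum>p\<leftarrow>sweedler x. D (fst p) * F' 0 (snd p) + F 0 (fst p) * D' (snd p))) (at 0)"
    using assms(1,2) curve_deriv_continuous [OF assms(2)] unfolding curve_deriv_def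
    by (intro tendsto_sum_list ta.tendsto_plus ta.tendsto_times tendsto_const) auto
  moreover have "(\<Sum>p\<leftarrow>sweedler x. D (fst p) * F' 0 (snd p) + F 0 (fst p) * D' (snd p)) = (D \<star> F' 0 + F 0 \<star> D') x"
    by (simp add: conv_sweedler assms case_prod_unfold sum_list_addf)
  moreover have "sB c (a - a') * b + a' * sB c (b - b') = sB c (a * b - a' * b')" for a a' b b' c
    by (simp add: sB_mult [symmetric] bs.scale_right_distrib [symmetric] left_diff_distrib right_diff_distrib del: bs.scale_right_distrib)
  then have "(\<Sum>p\<leftarrow>sweedler x. sB (inverse t) (F t (fst p) - F 0 (fst p)) * F' t (snd p) + F 0 (fst p) * sB (inverse t) (F' t (snd p) - F' 0 (snd p)))
      = sB (inverse t) ((F t \<star> F' t) x - (F 0 \<star> F' 0) x)" for t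
    by (simp add: conv_sweedler assms case_prod_unfold scale_sum_list_diff)
  ultimately show "((\<lambda>t. sB (inverse t) ((F t \<star> F' t) x - (F 0 \<star> F' 0) x)) \<longlongrightarrow> (D \<star> F' 0 + F 0 \<star> D') x) (at 0)" by simp
qed

text \<open>The derivative of the k-th convolution power at \<phi> in direction \<delta>: the sum of
  all products in which one of the k factors \<phi> is replaced by \<delta>, the order being kept.
  The recursion is the product rule.\<close>

definition dcpow :: "('h \<Rightarrow> 'b) \<Rightarrow> ('h \<Rightarrow> 'b) \<Rightarrow> nat \<Rightarrow> 'h \<Rightarrow> 'b"
  where "dcpow \<phi> \<delta> = rec_nat 0 (\<lambda>k D. \<delta> \<star> cpow \<phi> k + \<phi> \<star> D)"

lemma dcpow_0 [simp]: "dcpow \<phi> \<delta> 0 = 0"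
  and dcpow_Suc [simp]: "dcpow \<phi> \<delta> (Suc k) = \<delta> \<star> cpow \<phi> k + \<phi> \<star> dcpow \<phi> \<delta> k"
  by (simp_all add: dcpow_def)

lemma expc_lambda_zero [simp]: "expc (\<lambda>x. 0) = unit"
  using expc_zero by (simp add: zero_fun_def)

lemma lin_dcpow: "lin \<phi> \<Longrightarrow> lin \<delta> \<Longrightarrow> lin (dcpow \<phi> \<delta> k)"
  by (induction k) (auto simp: lin_zero lin_add lin_conv lin_cpow)

lemma curve_deriv_cpow:
  assumes "curve_deriv F D" "\<And>t. lin (F t)" "lin D"
  shows "curve_deriv (\<lambda>t. cpow (F t) k) (dcpow (F 0) D k)"
proof (induction k)
  case 0
  show ?case unfolding dcpow_0 cpow_0 by (rule curve_deriv_const)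
next
  case (Suc k)
  show ?case
    unfolding dcpow_Suc cpow_Suc
    by (rule curve_deriv_conv [OF assms(1) Suc]) (simp_all add: assms lin_cpow lin_dcpow)
qed

lemma conv_zero: "lin \<phi> \<Longrightarrow> 0 \<star> \<phi> = 0" "lin \<phi> \<Longrightarrow> \<phi> \<star> 0 = 0"
  by (auto simp: fun_eq_iff conv_sweedler lin_zero case_prod_unfold)

lemma cpow_zero: "k > 0 \<Longrightarrow> cpow 0 k = 0"
  by (cases k) (auto simp: cpow_Suc conv_zero lin_cpow lin_zero)

lemma dcpow_zero: "lin \<delta> \<Longrightarrow> dcpow 0 \<delta> k = (if k = 1 then \<delta> else 0)"
  by (cases k) (auto simp: conv_zero lin_dcpow lin_zero cpow_zero conv_unit)

lemma curve_deriv_scale_sum: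
  assumes "\<And>k. curve_deriv (F k) (D k)"
  shows "((\<lambda>t. sB (inverse t) ((\<Sum>k\<le>N. sB (c k) (F k t x)) - (\<Sum>k\<le>N. sB (c k) (F k 0 x)))) \<longlongrightarrow> (\<Sum>k\<le>N. sB (c k) (D k x))) (at 0)"
proof -
  have "((\<lambda>t. \<Sum>k\<le>N. sB (c k) (sB (inverse t) (F k t x - F k 0 x))) \<longlongrightarrow> (\<Sum>k\<le>N. sB (c k) (D k x))) (at 0)"
    using assms unfolding curve_deriv_def by (intro tendsto_finite_sum ta.tendsto_scl tendsto_const) auto
  moreover have "(\<Sum>k\<le>N. sB (c k) (sB a (F k t x - F k 0 x))) = sB a ((\<Sum>k\<le>N. sB (c k) (F k t x)) - (\<Sum>k\<le>N. sB (c k) (F k 0 x)))" for t a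
    by (simp add: sum_subtractf [symmetric] bs.scale_sum_right bs.scale_right_diff_distrib mult.commute)
  ultimately show ?thesis by simp
qed

text \<open>The truncation order is at least 2 because the coefficients of first and second order
  are evaluated later, whatever the degree of \<open>x\<close>.\<close>

lemma curve_deriv_ser:
  assumes "curve_deriv F D" "\<And>t. aug (F t)" "lin D"
  shows "curve_deriv (\<lambda>t. ser c (F t)) (\<lambda>x. \<Sum>k\<le>max 2 (deg x). sB (fps_nth c k) (dcpow (F 0) D k x))"
  unfolding curve_deriv_def
proof
  fix x
  have "curve_deriv (\<lambda>t. cpow (F t) k) (dcpow (F 0) D k)" for k
    by (rule curve_deriv_cpow [OF assms(1) _ assms(3)]) (use assms(2) in blast)
  from curve_deriv_scale_sum [OF this, where N = "max 2 (deg x)" and x = x]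
  show "((\<lambda>t. sB (inverse t) (ser c (F t) x - ser c (F 0) x)) \<longlongrightarrow> (\<Sum>k\<le>max 2 (deg x). sB (fps_nth c k) (dcpow (F 0) D k x))) (at 0)"
    by (simp add: ser_eq [OF assms(2), of x "max 2 (deg x)"])
qed

lemma curve_deriv_expc:
  assumes "aug \<phi>" shows "curve_deriv (\<lambda>t. expc (t \<cdot> \<phi>)) \<phi>"
proof -
  have "curve_deriv (\<lambda>t. expc (t \<cdot> \<phi>)) (\<lambda>x. \<Sum>k\<le>max 2 (deg x). sB (fps_nth (fps_exp 1) k) (dcpow (0 \<cdot> \<phi>) \<phi> k x))"
    unfolding expc_def by (rule curve_deriv_ser [OF curve_deriv_line]) (use assms aug_scl in auto)
  moreover have "0 \<cdot> \<phi> = 0" by (auto simp: fun_eq_iff)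
  moreover have "(\<Sum>k\<le>max 2 (deg x). sB (fps_nth (fps_exp 1) k) (dcpow 0 \<phi> k x)) = (\<Sum>k\<le>max 2 (deg x). if k = 1 then \<phi> x else 0)" for x
    using assms by (intro sum.cong) (auto simp: dcpow_zero)
  ultimately show ?thesis by (simp add: le_max_iff_disj)
qed

lemma curve_deriv_diff_unit: "curve_deriv F D \<Longrightarrow> curve_deriv (\<lambda>t. F t - unit) D"
  by (simp add: curve_deriv_def)

text \<open>In the chart \<open>logc\<close>, the left invariant vector field extending \<open>y\<close>.\<close>

definition log_field :: "('h \<Rightarrow> 'b) \<Rightarrow> ('h \<Rightarrow> 'b) \<Rightarrow> 'h \<Rightarrow> 'b"
  where "log_field y z x = (\<Sum>k\<le>max 2 (deg x). sB (fps_nth (fps_ln 1) k) (dcpow (expc z - unit) (expc z \<star> y) k x))"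

lemma curve_deriv_log_field:
  assumes "aug z" "aug y"
  shows "curve_deriv (\<lambda>t. logc (expc z \<star> expc (t \<cdot> y))) (log_field y z)"
proof -
  note lz = lin_expc [OF assms(1)] and ly = lin_expc [OF aug_scl [OF assms(2)]]
  have e0: "expc (0 \<cdot> y) = unit" using expc_zero by (simp add: zero_fun_def)
  have "curve_deriv (\<lambda>t. expc z \<star> expc (t \<cdot> y)) (0 \<star> expc (0 \<cdot> y) + expc z \<star> y)"
    by (rule curve_deriv_conv [OF curve_deriv_const curve_deriv_expc]) (use assms lz ly lin_zero in auto)
  then have "curve_deriv (\<lambda>t. expc z \<star> expc (t \<cdot> y) - unit) (expc z \<star> y)"
    using lin_unit by (intro curve_deriv_diff_unit) (simp add: conv_zero)
  from curve_deriv_ser [OF this, of "fps_ln 1"] show ?thesis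
    using lz ly assms unfolding logc_def log_field_def [abs_def] e0 conv_unit [OF lz]
    by (simp add: lin_diff lin_conv lin_unit conv_one expc_one)
qed

lemma log_field_zero:
  assumes "aug y" shows "log_field y 0 = y"
proof
  fix x
  have "log_field y 0 x = (\<Sum>k\<le>max 2 (deg x). if k = 1 then y x else 0)"
    unfolding log_field_def using assms by (intro sum.cong) (auto simp: expc_zero unit_conv dcpow_zero fps_ln_nth)
  then show "log_field y 0 x = y x" by (simp add: le_max_iff_disj)
qed

lemma curve_deriv_conv_zero:
  assumes "curve_deriv F D" "curve_deriv F' D'" "\<And>t. lin (F t)" "\<And>t. lin (F' t)" "lin D" "lin D'" "F 0 = 0" "F' 0 = 0"
  shows "curve_deriv (\<lambda>t. F t \<star> F' t) 0"
  using curve_deriv_conv [OF assms(1-6)] assms by (simp add: conv_zero)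

text \<open>Existence is enough: in the treatment of higher powers this derivative is multiplied by
  the value of \<open>F\<close> at 0, which is 0 there.\<close>

lemma curve_deriv_dcpow_exists:
  assumes "curve_deriv F D" "curve_deriv \<Theta> E" "\<And>t. lin (F t)" "\<And>t. lin (\<Theta> t)" "lin D" "lin E"
  shows "\<exists>D'. lin D' \<and> curve_deriv (\<lambda>t. dcpow (F t) (\<Theta> t) k) D'"
proof (induction k)
  case 0
  show ?case unfolding dcpow_0 using curve_deriv_const lin_zero by blast
next
  case (Suc k)
  then obtain D' where D': "lin D'" "curve_deriv (\<lambda>t. dcpow (F t) (\<Theta> t) k) D'" by blast
  have "curve_deriv (\<lambda>t. \<Theta> t \<star> cpow (F t) k) (E \<star> cpow (F 0) k + \<Theta> 0 \<star> dcpow (F 0) D k)"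
    by (rule curve_deriv_conv [OF assms(2) curve_deriv_cpow]) (auto simp: assms lin_cpow lin_dcpow)
  moreover have "curve_deriv (\<lambda>t. F t \<star> dcpow (F t) (\<Theta> t) k) (D \<star> dcpow (F 0) (\<Theta> 0) k + F 0 \<star> D')"
    by (rule curve_deriv_conv [OF assms(1) D'(2)]) (auto simp: assms D' lin_dcpow)
  ultimately have "curve_deriv (\<lambda>t. dcpow (F t) (\<Theta> t) (Suc k))
      (E \<star> cpow (F 0) k + \<Theta> 0 \<star> dcpow (F 0) D k + (D \<star> dcpow (F 0) (\<Theta> 0) k + F 0 \<star> D'))"
    unfolding dcpow_Suc by (rule curve_deriv_add)
  moreover have "lin (E \<star> cpow (F 0) k + \<Theta> 0 \<star> dcpow (F 0) D k + (D \<star> dcpow (F 0) (\<Theta> 0) k + F 0 \<star> D'))"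
    by (intro lin_add lin_conv lin_cpow lin_dcpow assms D')
  ultimately show ?case by blast
qed

text \<open>For positive k, \<open>dcpow\<close> is linear in \<Theta> and homogeneous of degree k -
  1 in \<open>F\<close>. As \<open>F\<close> vanishes at 0, only k = 1 and k = 2 contribute to first
  order.\<close>

lemma curve_deriv_dcpow:
  assumes "curve_deriv F D" "curve_deriv \<Theta> E" "\<And>t. lin (F t)" "\<And>t. lin (\<Theta> t)" "lin D" "lin E" "F 0 = 0"
  shows "curve_deriv (\<lambda>t. dcpow (F t) (\<Theta> t) k) (if k = 1 then E else if k = 2 then \<Theta> 0 \<star> D + D \<star> \<Theta> 0 else 0)"
proof -
  consider "k = 0" | "k = 1" | "k = 2" | j where "k = Suc (Suc (Suc j))"
    by (metis One_nat_def Suc_1 not0_implies_Suc)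
  then show ?thesis
  proof cases
    case 1
    then show ?thesis unfolding 1 dcpow_0 using curve_deriv_const by simp
  next
    case 2
    have "dcpow (F t) (\<Theta> t) 1 = \<Theta> t" for t using assms by (simp add: conv_unit conv_zero)
    then show ?thesis using 2 assms by simp
  next
    case 3
    have "dcpow (F t) (\<Theta> t) 2 = \<Theta> t \<star> F t + F t \<star> \<Theta> t" for t
      using assms by (simp add: numeral_2_eq_2 cpow_1 conv_unit conv_zero)
    moreover have "curve_deriv (\<lambda>t. \<Theta> t \<star> F t + F t \<star> \<Theta> t) ((E \<star> F 0 + \<Theta> 0 \<star> D) + (D \<star> \<Theta> 0 + F 0 \<star> E))"
      by (intro curve_deriv_add curve_deriv_conv assms)
    ultimately show ?thesis using 3 assms by (simp add: conv_zero)
  next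
    case 4
    obtain D' where D': "lin D'" "curve_deriv (\<lambda>t. dcpow (F t) (\<Theta> t) (Suc (Suc j))) D'"
      using curve_deriv_dcpow_exists [OF assms(1-6)] by blast
    have "curve_deriv (\<lambda>t. F t \<star> dcpow (F t) (\<Theta> t) (Suc (Suc j))) 0"
      by (rule curve_deriv_conv_zero [OF assms(1) D'(2)])
        (use assms D' dcpow_zero [of "\<Theta> 0" "Suc (Suc j)"] in \<open>auto simp: lin_dcpow simp del: dcpow_Suc\<close>)
    moreover have "curve_deriv (\<lambda>t. F t \<star> cpow (F t) (Suc j)) 0"
      by (rule curve_deriv_conv_zero [OF assms(1) curve_deriv_cpow [OF assms(1)]])
        (use assms in \<open>auto simp: lin_dcpow lin_cpow lin_zero cpow_zero simp del: dcpow_Suc\<close>)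
    then have "curve_deriv (\<lambda>t. \<Theta> t \<star> (F t \<star> cpow (F t) (Suc j))) (E \<star> (F 0 \<star> cpow (F 0) (Suc j)) + \<Theta> 0 \<star> 0)"
      by (rule curve_deriv_conv [OF assms(2)]) (auto simp: assms lin_conv lin_cpow lin_zero)
    ultimately have "curve_deriv (\<lambda>t. \<Theta> t \<star> (F t \<star> cpow (F t) (Suc j)) + F t \<star> dcpow (F t) (\<Theta> t) (Suc (Suc j)))
        (E \<star> (F 0 \<star> cpow (F 0) (Suc j)) + \<Theta> 0 \<star> 0 + 0)"
      by (intro curve_deriv_add)
    then show ?thesis using 4 assms by (simp add: cpow_Suc conv_zero lin_cpow lin_conv lin_unit lin_zero)
  qed
qed

text \<open>The coefficients 1 and -1/2 of log(1 + X) give xy - (xy + yx)/2, which is one half of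
  the commutator.\<close>

lemma curve_deriv_log_field_line:
  assumes "aug x" "aug y"
  shows "curve_deriv (\<lambda>t. log_field y (t \<cdot> x)) (\<lambda>h. sB (1 / 2) ((x \<star> y) h - (y \<star> x) h))"
  unfolding curve_deriv_def
proof
  fix h
  let ?F = "\<lambda>t. expc (t \<cdot> x) - unit" and ?\<Theta> = "\<lambda>t. expc (t \<cdot> x) \<star> y"
  have lx: "lin (expc (t \<cdot> x))" for t by (rule lin_expc [OF aug_scl [OF assms(1)]])
  have e0: "expc (0 \<cdot> x) = unit" using expc_zero by (simp add: zero_fun_def)
  have F: "curve_deriv ?F x" by (rule curve_deriv_diff_unit [OF curve_deriv_expc [OF assms(1)]])
  have "curve_deriv ?\<Theta> (x \<star> y + expc (0 \<cdot> x) \<star> 0)"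
    by (rule curve_deriv_conv [OF curve_deriv_expc [OF assms(1)] curve_deriv_const]) (use assms lx lin_zero in auto)
  then have \<Theta>: "curve_deriv ?\<Theta> (x \<star> y)" by (simp add: e0 conv_zero lin_unit)
  have "curve_deriv (\<lambda>t. dcpow (?F t) (?\<Theta> t) k) (if k = 1 then x \<star> y else if k = 2 then y \<star> x + x \<star> y else 0)" for k
  proof -
    have "lin y" using assms by simp
    then show ?thesis
      using curve_deriv_dcpow [OF F \<Theta>, of k, unfolded e0 unit_conv [OF \<open>lin y\<close>]] assms lx
      by (simp only: lin_diff lin_conv lin_unit diff_self)
  qed
  from curve_deriv_scale_sum [OF this, where N = "max 2 (deg h)" and x = h and c = "fps_nth (fps_ln 1)"]
  have "((\<lambda>t. sB (inverse t) (log_field y (t \<cdot> x) h - log_field y (0 \<cdot> x) h)) \<longlongrightarrow>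
      (\<Sum>k\<le>max 2 (deg h). sB (fps_nth (fps_ln 1) k) ((if k = 1 then x \<star> y else if k = 2 then y \<star> x + x \<star> y else 0) h))) (at 0)"
    unfolding log_field_def .
  moreover have "(\<Sum>k\<le>max 2 (deg h). sB (fps_nth (fps_ln 1) k) ((if k = 1 then x \<star> y else if k = 2 then y \<star> x + x \<star> y else 0) h)) =
      sB (1 / 2) ((x \<star> y) h - (y \<star> x) h)"
  proof -
    have "(\<Sum>k\<le>max 2 (deg h). sB (fps_nth (fps_ln 1) k) ((if k = 1 then x \<star> y else if k = 2 then y \<star> x + x \<star> y else 0) h)) =
       (\<Sum>k\<le>max 2 (deg h). (if k = 1 then (x \<star> y) h else 0) + (if k = 2 then sB (- 1 / 2) ((y \<star> x + x \<star> y) h) else 0))"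
      by (intro sum.cong refl) (auto simp: fps_ln_nth)
    also have "\<dots> = (x \<star> y) h + sB (- 1 / 2) ((y \<star> x + x \<star> y) h)"
      by (simp add: sum.distrib le_max_iff_disj)
    also have "\<dots> = sB (1 - 1 / 2) ((x \<star> y) h) - sB (1 / 2) ((y \<star> x) h)"
      unfolding bs.scale_left_diff_distrib by (simp add: bs.scale_right_distrib bs.scale_minus_left)
    also have "\<dots> = sB (1 / 2) ((x \<star> y) h - (y \<star> x) h)"
      by (simp add: bs.scale_right_diff_distrib)
    finally show ?thesis .
  qed
  ultimately show "((\<lambda>t. sB (inverse t) (log_field y (t \<cdot> x) h - log_field y (0 \<cdot> x) h)) \<longlongrightarrow>
      sB (1 / 2) ((x \<star> y) h - (y \<star> x) h)) (at 0)" by simp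
qed

section \<open>The Lie algebra\<close>

abbreviation \<kappa> where "\<kappa> \<equiv> (G, logc)"
abbreviation lie where "lie \<equiv> tangent_space char_mfd unit"
abbreviation bracket where "bracket \<equiv> lie_bracket CG char_mfd"
abbreviation commutator where "commutator \<equiv> \<lambda>\<phi> \<psi>. \<phi> \<star> \<psi> - \<psi> \<star> \<phi>"

lemma charts_at_char: "p \<in> G \<Longrightarrow> charts_at char_mfd p = {\<kappa>}"
  by (auto simp: charts_at_def)

lemma dir_deriv_g_eqI:
  assumes "l \<in> L" "\<And>h. ((\<lambda>t. diff_quotient g g f x v t h) \<longlongrightarrow> l h) (at 0)"
  shows "dir_deriv g g f x v = l"
  by (rule ta.dir_deriv_eqI [OF coord_system_L assms(1)]) (use assms(2) in \<open>simp add: tendsto_fun_iff\<close>)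

lemma dir_deriv_id:
  assumes "x \<in> L" "v \<in> L" "\<And>y. y \<in> L \<Longrightarrow> f y = y"
  shows "dir_deriv g g f x v = v"
proof (rule dir_deriv_g_eqI [OF assms(2)])
  fix h
  have "x + t \<cdot> v \<in> L" for t by (intro L_add L_scl assms)
  then have "diff_quotient g g f x v t h = v h" if "t \<noteq> 0" for t
    using assms that by (simp add: diff_quotient_def)
  then show "((\<lambda>t. diff_quotient g g f x v t h) \<longlongrightarrow> v h) (at 0)"
    by (intro tendsto_eventually eventually_mono [OF eventually_nonzero]) simp
qed

text \<open>With a single chart the compatibility condition involves only the derivative of the
  identity, so a tangent vector amounts to its component at \<kappa>.\<close>

lemma tangent_iff: "X \<in> space_of lie \<longleftrightarrow> (\<forall>c. c \<noteq> \<kappa> \<longrightarrow> X c = 0) \<and> X \<kappa> \<in> L"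
proof -
  have "dir_deriv g g (local_rep \<kappa> \<kappa> (\<lambda>q. q)) 0 (X \<kappa>) = X \<kappa>" if "X \<kappa> \<in> L"
    by (rule dir_deriv_id [OF L_zero that]) (simp add: local_rep_def inv_into_logc logc_expc_L)
  then show ?thesis
    by (auto simp: tangent_space_def charts_at_char [OF G_unit] logc_unit)
qed

lemma scale_lie: "scale lie a X = (\<lambda>c. a \<cdot> X c)"
  by (simp add: tangent_space_def)

text \<open>Inverse of evaluation at \<kappa>; the value 0 elsewhere is the one that
  \<open>tangent_space\<close> prescribes off the charts at the point.\<close>

definition ins :: "('h \<Rightarrow> 'b) \<Rightarrow> ('h \<Rightarrow> 'b, 'h \<Rightarrow> 'b) chart \<Rightarrow> 'h \<Rightarrow> 'b"
  where "ins x c = (if c = \<kappa> then x else 0)"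

lemma ins_\<kappa> [simp]: "ins x \<kappa> = x"
  by (simp add: ins_def)

lemma ins_in_lie: "x \<in> L \<Longrightarrow> ins x \<in> space_of lie"
  by (simp add: tangent_iff ins_def)

lemma lieD: "X \<in> space_of lie \<Longrightarrow> X \<kappa> \<in> L"
  by (simp add: tangent_iff)

lemma lie_eqI: "X \<in> space_of lie \<Longrightarrow> Y \<in> space_of lie \<Longrightarrow> X \<kappa> = Y \<kappa> \<Longrightarrow> X = Y"
  unfolding tangent_iff by (rule ext) metis

lemma ins_eq: "X \<in> space_of lie \<Longrightarrow> ins (X \<kappa>) = X"
  by (rule lie_eqI) (simp_all add: ins_in_lie lieD)

lemma lie_add: "X \<in> space_of lie \<Longrightarrow> Y \<in> space_of lie \<Longrightarrow> X + Y \<in> space_of lie"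
  and lie_scl: "X \<in> space_of lie \<Longrightarrow> scale lie a X \<in> space_of lie"
  and lie_zero: "0 \<in> space_of lie"
  by (auto simp: tangent_iff L_add L_scl L_zero scale_lie fun_eq_iff)

text \<open>Closedness of \<open>L\<close> replaces computations: that \<open>log_field\<close> and
  half of a commutator lie in \<open>L\<close> is inherited from the curves whose derivatives they
  are.\<close>

lemma limit_in_L:
  assumes "curve_deriv F D" "\<And>t. F t \<in> L" shows "D \<in> L"
proof (rule Lim_in_closed_set [OF closed_L])
  show "((\<lambda>t x. sB (inverse t) (F t x - F 0 x)) \<longlongrightarrow> D) (at 0)"
    using assms(1) by (simp add: curve_deriv_def tendsto_fun_iff)
  have "(\<lambda>x. sB a (F t x - F 0 x)) \<in> L" for t a
    using L_scl [OF L_add [OF assms(2) L_minus [OF assms(2)]], of a t 0] by simp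
  then show "\<forall>\<^sub>F t in at 0. (\<lambda>x. sB (inverse t) (F t x - F 0 x)) \<in> L" by simp
qed simp

lemma left_inv_field_eq:
  assumes "z \<in> L" "X \<in> space_of lie"
  shows "left_inv_field CG char_mfd X (inv_into G logc z) \<kappa> = log_field (X \<kappa>) z"
proof -
  let ?x = "X \<kappa>"
  have x: "?x \<in> L" using assms by (simp add: tangent_iff)
  have ez: "expc z \<in> G" using assms by (simp add: expc_in_G)
  then have "charts_at char_mfd (expc z \<star> unit) = {\<kappa>}" by (intro charts_at_char G_conv G_unit)
  then have "left_inv_field CG char_mfd X (inv_into G logc z) \<kappa> =
      dir_deriv g g (local_rep \<kappa> \<kappa> (\<lambda>h. expc z \<star> h)) 0 ?x"
    by (simp add: left_inv_field_def tangent_map_def inv_into_logc assms charts_at_char G_unit logc_unit Let_def)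
  also have "\<dots> = log_field ?x z"
  proof (rule dir_deriv_g_eqI)
    note d = curve_deriv_log_field [OF L_aug [OF assms(1)] L_aug [OF x]]
    show "log_field ?x z \<in> L"
      by (rule limit_in_L [OF d]) (intro logc_conv_expc_in_L L_scl x assms)
    have *: "inv_into G logc (t \<cdot> ?x) = expc (t \<cdot> ?x)" for t by (intro inv_into_logc L_scl x)
    \<comment> \<open>The base point 0 is written as \<open>0 \<cdot> ?x\<close>, so that the
      difference quotient has literally the form occurring in \<open>curve_deriv\<close>.\<close>
    have **: "inv_into G logc 0 = expc (0 \<cdot> ?x)" using inv_into_logc [OF L_zero] by (simp add: expc_zero)
    show "((\<lambda>t. diff_quotient g g (local_rep \<kappa> \<kappa> (\<lambda>h. expc z \<star> h)) 0 ?x t h) \<longlongrightarrow> log_field ?x z h) (at 0)" for h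
      using d unfolding curve_deriv_def diff_quotient_def local_rep_def
      by (simp add: * ** del: bs.scale_zero_left expc_lambda_zero)
  qed
  finally show ?thesis .
qed

lemma dir_deriv_log_field:
  assumes "x \<in> L" "y \<in> L" "\<And>z. z \<in> L \<Longrightarrow> \<eta> z = log_field y z"
  shows "dir_deriv g g \<eta> 0 x = (1 / 2) \<cdot> commutator x y"
proof (rule dir_deriv_g_eqI)
  note d = curve_deriv_log_field_line [OF L_aug [OF assms(1)] L_aug [OF assms(2)]]
  have c: "(1 / 2) \<cdot> commutator x y = (\<lambda>h. sB (1 / 2) ((x \<star> y) h - (y \<star> x) h))" by simp
  have tx: "t \<cdot> x \<in> L" for t by (intro L_scl assms)
  have lf: "log_field y (t \<cdot> x) \<in> L" for t
    by (rule limit_in_L [OF curve_deriv_log_field]) (use L_aug [OF tx] L_aug [OF assms(2)] in \<open>auto intro!: logc_conv_expc_in_L L_scl tx assms\<close>)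
  show "(1 / 2) \<cdot> commutator x y \<in> L"
    unfolding c by (rule limit_in_L [OF d lf])
  have *: "\<eta> (t \<cdot> x) = log_field y (t \<cdot> x)" for t by (rule assms(3) [OF tx])
  have **: "\<eta> 0 = log_field y (0 \<cdot> x)" using assms(3) [OF L_zero] by (simp add: zero_fun_def)
  show "((\<lambda>t. diff_quotient g g \<eta> 0 x t h) \<longlongrightarrow> ((1 / 2) \<cdot> commutator x y) h) (at 0)" for h
    using d unfolding curve_deriv_def diff_quotient_def
    by (simp add: * ** del: bs.scale_zero_left)
qed

text \<open>The two directional derivatives are halves of commutators with opposite signs; their
  difference is the whole commutator.\<close>

lemma lie_bracket_eq:
  assumes "X \<in> space_of lie" "Y \<in> space_of lie"
  shows "bracket X Y = ins (commutator (X \<kappa>) (Y \<kappa>))"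
proof
  fix c
  show "bracket X Y c = ins (commutator (X \<kappa>) (Y \<kappa>)) c"
  proof (cases "c = \<kappa>")
    case True
    let ?x = "X \<kappa>" and ?y = "Y \<kappa>"
    have xy: "?x \<in> L" "?y \<in> L" using assms by (auto simp: tangent_iff)
    note l = left_inv_field_eq [OF _ assms(1)] left_inv_field_eq [OF _ assms(2)]
    have "bracket X Y \<kappa> = (1 / 2) \<cdot> commutator ?x ?y - (1 / 2) \<cdot> commutator ?y ?x"
      unfolding lie_bracket_def Let_def
      using dir_deriv_log_field [OF xy, of "\<lambda>z. left_inv_field CG char_mfd Y (inv_into G logc z) \<kappa>"]
        dir_deriv_log_field [OF xy(2,1), of "\<lambda>z. left_inv_field CG char_mfd X (inv_into G logc z) \<kappa>"]
        log_field_zero [OF L_aug [OF xy(1)]] log_field_zero [OF L_aug [OF xy(2)]]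
      by (simp add: l charts_at_char G_unit logc_unit L_zero)
    also have "\<dots> = commutator ?x ?y"
    proof
      fix h
      have "sB (1 / 2) (u - v) - sB (1 / 2) (v - u) = u - v" for u v
      proof -
        have "sB (1 / 2) (u - v) - sB (1 / 2) (v - u) = sB (1 / 2) (u - v) + sB (1 / 2) (u - v)"
          by (metis bs.scale_minus_right diff_conv_add_uminus minus_diff_eq)
        also have "\<dots> = sB (1 / 2 + 1 / 2) (u - v)" by (rule bs.scale_left_distrib [symmetric])
        finally show ?thesis by simp
      qed
      then show "((1 / 2) \<cdot> commutator ?x ?y - (1 / 2) \<cdot> commutator ?y ?x) h = commutator ?x ?y h" by simp
    qed
    finally show ?thesis using True by simp
  next
    case False
    then show ?thesis by (auto simp: lie_bracket_def charts_at_char G_unit ins_def)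
  qed
qed

text \<open>The mixed terms in the value of \<phi> \<star> \<psi> at a product are symmetric in
  \<phi> and \<psi> and cancel in the commutator.\<close>

lemma commutator_in_L:
  assumes "\<phi> \<in> L" "\<psi> \<in> L" shows "commutator \<phi> \<psi> \<in> L"
proof -
  have l: "lin \<phi>" "lin \<psi>" using assms by (auto simp: L_iff)
  have e: "(\<phi> \<star> \<psi>) (x * y) = unit x * (\<phi> \<star> \<psi>) y + \<phi> x * \<psi> y + \<psi> x * \<phi> y + (\<phi> \<star> \<psi>) x * unit y"
    if "\<phi> \<in> L" "\<psi> \<in> L" for \<phi> \<psi> x y
  proof -
    have l: "lin \<phi>" "lin \<psi>" using that by (auto simp: L_iff)
    have m: "\<theta> (a * b) = unit a * \<theta> b + \<theta> a * unit b" if "\<theta> \<in> L" for \<theta> a b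
      using that by (simp add: L_iff unit_mult mult.commute [of "\<theta> a"])
    have "(\<phi> \<star> \<psi>) (x * y) = (\<Sum>(a, b)\<leftarrow>sweedler x. \<Sum>(c, d)\<leftarrow>sweedler y.
        (unit a * unit b) * (\<phi> c * \<psi> d) + (unit a * \<psi> b) * (\<phi> c * unit d) +
        ((\<phi> a * unit b) * (unit c * \<psi> d) + (\<phi> a * \<psi> b) * (unit c * unit d)))"
      unfolding conv_mult_arg [OF l] m [OF that(1)] m [OF that(2)]
      by (simp add: distrib_left distrib_right mult_ac add_ac)
    also have "\<dots> = (unit \<star> unit) x * (\<phi> \<star> \<psi>) y + (unit \<star> \<psi>) x * (\<phi> \<star> unit) y +
        ((\<phi> \<star> unit) x * (unit \<star> \<psi>) y + (\<phi> \<star> \<psi>) x * (unit \<star> unit) y)"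
      unfolding conv_sweedler [OF l] conv_sweedler [OF lin_unit lin_unit] conv_sweedler [OF lin_unit l(2)]
        conv_sweedler [OF l(1) lin_unit] sum_list_prod_swap [symmetric]
      by (simp add: case_prod_unfold sum_list_addf)
    finally show ?thesis using l by (simp add: unit_conv conv_unit lin_unit add_ac)
  qed
  have "commutator \<phi> \<psi> (x * y) = unit x * commutator \<phi> \<psi> y + unit y * commutator \<phi> \<psi> x" for x y
    unfolding minus_apply e [OF assms] e [OF assms(2,1)] by (simp add: algebra_simps)
  then show ?thesis using l by (simp add: L_iff unit_mult lin_diff lin_conv)
qed

section \<open>Lie algebra laws of commutator and bracket\<close>

lemma commutator_add: "lin x \<Longrightarrow> lin y \<Longrightarrow> lin z \<Longrightarrow> commutator (x + y) z = commutator x z + commutator y z"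
  "lin x \<Longrightarrow> lin y \<Longrightarrow> lin z \<Longrightarrow> commutator z (x + y) = commutator z x + commutator z y"
  by (simp_all add: conv_add_left conv_add_right)

lemma commutator_scl: "lin x \<Longrightarrow> lin y \<Longrightarrow> commutator (a \<cdot> x) y = a \<cdot> commutator x y"
  "lin x \<Longrightarrow> lin y \<Longrightarrow> commutator x (a \<cdot> y) = a \<cdot> commutator x y"
  by (auto simp: conv_scl_left conv_scl_right fun_eq_iff bs.scale_right_diff_distrib)

lemma commutator_jacobi:
  "lin x \<Longrightarrow> lin y \<Longrightarrow> lin z \<Longrightarrow>
    commutator x (commutator y z) + commutator y (commutator z x) + commutator z (commutator x y) = 0"
  by (simp add: conv_diff_left conv_diff_right lin_conv conv_assoc)

lemma scale_g: "scale g = (\<lambda>c x. c \<cdot> x)"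
  by (simp add: fun_eq_iff)

lemma vector_space_fun_scale: "vector_space (\<lambda>c x. c \<cdot> x)"
  by (rule vector_space_fun) (rule bs.vector_space_axioms)

lemma subspace_iff: "vector_space sc \<Longrightarrow> module.subspace sc S \<longleftrightarrow> 0 \<in> S \<and> (\<forall>x\<in>S. \<forall>y\<in>S. x + y \<in> S) \<and> (\<forall>c. \<forall>x\<in>S. sc c x \<in> S)"
proof -
  assume "vector_space sc"
  then interpret vector_space sc .
  show ?thesis by (rule subspace_def)
qed

lemma lie_algebra_g: "lie_algebra g commutator"
  unfolding lie_algebra_def scale_g
proof (intro conjI ballI allI)
  show "vector_space (\<lambda>c x. c \<cdot> x)" by (rule vector_space_fun_scale)
  show "module.subspace (\<lambda>c x. c \<cdot> x) L"
    by (simp add: subspace_iff [OF vector_space_fun_scale] L_zero L_add L_scl)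
  fix x y z a assume x: "x \<in> L" and y: "y \<in> L"
  have lin: "lin v" if "v \<in> L" for v using that by (simp add: L_iff)
  show "commutator x y \<in> L" by (rule commutator_in_L [OF x y])
  show "commutator (a \<cdot> x) y = a \<cdot> commutator x y" "commutator x (a \<cdot> y) = a \<cdot> commutator x y"
    by (rule commutator_scl [OF lin [OF x] lin [OF y]])+
  assume z: "z \<in> L"
  show "commutator (x + y) z = commutator x z + commutator y z" "commutator z (x + y) = commutator z x + commutator z y"
    by (rule commutator_add [OF lin [OF x] lin [OF y] lin [OF z]])+
  show "commutator x (commutator y z) + commutator y (commutator z x) + commutator z (commutator x y) = 0"
    by (rule commutator_jacobi [OF lin [OF x] lin [OF y] lin [OF z]])
qed simp

text \<open>A tangent vector is determined by its component at \<kappa>, where the bracket is the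
  commutator; the identities are checked there.\<close>

lemma lie_algebra_lie: "lie_algebra lie (bracket)"
proof -
  have sl: "scale lie = (\<lambda>a X c. a \<cdot> X c)" by (simp add: fun_eq_iff scale_lie)
  have vs: "vector_space (\<lambda>a (X :: ('h \<Rightarrow> 'b, 'h \<Rightarrow> 'b) chart \<Rightarrow> 'h \<Rightarrow> 'b) c. a \<cdot> X c)"
    by (rule vector_space_fun) (rule vector_space_fun_scale)
  have sub: "module.subspace (scale lie) (space_of lie)"
    unfolding sl by (simp only: subspace_iff [OF vs]) (use lie_add lie_scl lie_zero in \<open>auto simp: scale_lie\<close>)
  have br: "bracket X Y \<in> space_of lie" if "X \<in> space_of lie" "Y \<in> space_of lie" for X Y
    unfolding lie_bracket_eq [OF that] using that by (intro ins_in_lie commutator_in_L lieD)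
  have br\<kappa>: "bracket X Y \<kappa> = commutator (X \<kappa>) (Y \<kappa>)" if "X \<in> space_of lie" "Y \<in> space_of lie" for X Y
    using lie_bracket_eq [OF that] by simp
  have lL: "lin (X \<kappa>)" if "X \<in> space_of lie" for X using that by (simp add: tangent_iff L_iff)
  show ?thesis
    unfolding lie_algebra_def
  proof (intro conjI ballI allI)
    show "vector_space (scale lie)" unfolding sl by (rule vs)
    fix X Y Z a
    assume X: "X \<in> space_of lie" and Y: "Y \<in> space_of lie"
    show "bracket (scale lie a X) Y = scale lie a (bracket X Y)"
      by (rule lie_eqI) (use X Y lL commutator_scl(1) [of "X \<kappa>" "Y \<kappa>" a] in \<open>simp_all add: br br\<kappa> lie_scl scale_lie [of _ _, THEN fun_cong]\<close>)
    show "bracket X (scale lie a Y) = scale lie a (bracket X Y)"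
      by (rule lie_eqI) (use X Y lL commutator_scl(2) [of "X \<kappa>" "Y \<kappa>" a] in \<open>simp_all add: br br\<kappa> lie_scl scale_lie [of _ _, THEN fun_cong]\<close>)
    assume Z: "Z \<in> space_of lie"
    show "bracket (X + Y) Z = bracket X Z + bracket Y Z"
      by (rule lie_eqI) (use X Y Z lL commutator_add(1) [of "X \<kappa>" "Y \<kappa>" "Z \<kappa>"] in \<open>simp_all add: br br\<kappa> lie_add\<close>)
    show "bracket Z (X + Y) = bracket Z X + bracket Z Y"
      by (rule lie_eqI) (use X Y Z lL commutator_add(2) [of "X \<kappa>" "Y \<kappa>" "Z \<kappa>"] in \<open>simp_all add: br br\<kappa> lie_add\<close>)
    show "bracket X (bracket Y Z) + bracket Y (bracket Z X) +
        bracket Z (bracket X Y) = 0"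
      by (rule lie_eqI) (use X Y Z lL commutator_jacobi [of "X \<kappa>" "Y \<kappa>" "Z \<kappa>"] in \<open>simp_all add: br br\<kappa> lie_add lie_zero\<close>)
  next
    fix X assume X: "X \<in> space_of lie"
    show "bracket X X = 0"
      by (rule lie_eqI) (use X in \<open>simp_all add: br br\<kappa> lie_zero\<close>)
  qed (use br sub in auto)
qed

text \<open>Read in the chart, the inclusion of the characters into all linear maps is
  \<open>expc\<close>, whose derivative at 0 is the identity.\<close>

lemma tangent_inclusion_char:
  assumes "X \<in> space_of lie"
  shows "tangent_inclusion char_mfd (hom_lcs H sB) unit X = X \<kappa>"
proof -
  have x: "X \<kappa> \<in> L" by (rule lieD [OF assms])
  have "tangent_inclusion char_mfd (hom_lcs H sB) unit X =
      dir_deriv g (hom_lcs H sB) (inv_into G logc) 0 (X \<kappa>)"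
    by (simp add: tangent_inclusion_def tangent_map_def charts_at_char G_unit logc_unit local_rep_def o_def)
      (simp add: charts_at_def lcs_mfd_def lin_unit)
  also have "\<dots> = X \<kappa>"
  proof (rule ta.dir_deriv_eqI [OF coord_system_hom])
    show "X \<kappa> \<in> space_of (hom_lcs H sB)" using x by (simp add: L_iff)
    have *: "inv_into G logc (t \<cdot> X \<kappa>) = expc (t \<cdot> X \<kappa>)" for t by (intro inv_into_logc L_scl x)
    have **: "inv_into G logc 0 = expc (0 \<cdot> X \<kappa>)" using inv_into_logc [OF L_zero] by (simp add: expc_zero)
    show "(diff_quotient g (hom_lcs H sB) (inv_into G logc) 0 (X \<kappa>) \<longlongrightarrow> X \<kappa>) (at 0)"
      using curve_deriv_expc [OF L_aug [OF x]] unfolding tendsto_fun_iff curve_deriv_def diff_quotient_def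
      by (simp add: * ** del: bs.scale_zero_left expc_lambda_zero)
  qed
  finally show ?thesis .
qed

section \<open>The topology of the tangent space\<close>

definition tan_coord :: "('h \<Rightarrow> 'b, 'h \<Rightarrow> 'b) chart \<times> 'h \<Rightarrow> (('h \<Rightarrow> 'b, 'h \<Rightarrow> 'b) chart \<Rightarrow> 'h \<Rightarrow> 'b) \<Rightarrow> 'b"
  where "tan_coord i X = X (fst i) (snd i)"

lemma continuous_tan_coord: "continuous_on D (tan_coord i)"
proof -
  have "continuous_on UNIV (\<lambda>X::('h \<Rightarrow> 'b, 'h \<Rightarrow> 'b) chart \<Rightarrow> 'h \<Rightarrow> 'b. X (fst i) (snd i))"
    by (rule continuous_on_compose2 [OF continuous_eval continuous_on_product_coordinates]) simp
  then show ?thesis unfolding tan_coord_def [abs_def] by (rule continuous_on_subset) simp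
qed

lemma closed_lie: "closed (space_of lie)"
proof -
  have "{X. X c = 0} = (\<Inter>h. {X. tan_coord (c, h) X = 0})" for c
    by (auto simp: tan_coord_def fun_eq_iff)
  moreover have "space_of lie = (\<Inter>c\<in>-{\<kappa>}. {X. X c = 0}) \<inter> {X. X \<kappa> \<in> L}"
    using tangent_iff by blast
  ultimately have "space_of lie = (\<Inter>c\<in>-{\<kappa>}. \<Inter>h. {X. tan_coord (c, h) X = 0}) \<inter> {X. X \<kappa> \<in> L}"
    by simp
  moreover have "closed \<dots>"
  proof (intro closed_Int closed_INT ballI ta.closed_equalizer continuous_tan_coord continuous_on_const)
    have "{X. X \<kappa> \<in> L} = (\<lambda>X. X \<kappa>) -` L" by auto
    moreover have "closed ((\<lambda>X. X \<kappa>) -` L)"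
      by (rule closed_vimage [OF closed_L continuous_on_product_coordinates])
    ultimately show "closed {X :: ('h \<Rightarrow> 'b, 'h \<Rightarrow> 'b) chart \<Rightarrow> 'h \<Rightarrow> 'b. X \<kappa> \<in> L}" by simp
  qed
  ultimately show ?thesis by simp
qed

lemma coord_system_lie: "coord_system sB lie tan_coord (\<lambda>\<rho> c h. \<rho> (c, h))"
proof -
  have "continuous_on UNIV (\<lambda>(\<rho> :: ('h \<Rightarrow> 'b, 'h \<Rightarrow> 'b) chart \<times> 'h \<Rightarrow> 'b) c h. \<rho> (c, h))"
    by (intro continuous_on_coordinatewise_then_product continuous_on_product_coordinates)
  then show ?thesis
    unfolding coord_system_def
    using lie_add lie_scl lie_zero closed_lie continuous_tan_coord
    by (auto simp: tan_coord_def scale_lie)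
qed

lemma continuous_on_ins: "continuous_on D ins"
proof -
  have "continuous_on D (\<lambda>x. ins x c)" for c
    by (cases "c = \<kappa>") (simp_all add: ins_def continuous_on_id)
  then show ?thesis by (rule continuous_on_coordinatewise_then_product)
qed

lemma homeomorphic_maps_lie: "homeomorphic_maps (top_of_set (space_of lie)) (top_of_set L) (\<lambda>X. X \<kappa>) ins"
  unfolding homeomorphic_maps_def
  using continuous_on_subset [OF continuous_on_product_coordinates [of \<kappa>] subset_UNIV]
  by (auto simp: continuous_on_ins ins_in_lie ins_eq lieD)

lemma lie_algebra_iso_char:
  "lie_algebra_iso lie (bracket) g commutator (tangent_inclusion char_mfd (hom_lcs H sB) unit)"
proof -
  have "homeomorphic_map (top_of_set (space_of lie)) (top_of_set L) (tangent_inclusion char_mfd (hom_lcs H sB) unit)"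
    by (rule homeomorphic_map_eq [OF homeomorphic_maps_imp_map [OF homeomorphic_maps_lie]])
      (simp add: tangent_inclusion_char)
  moreover have "bracket X Y \<in> space_of lie" if "X \<in> space_of lie" "Y \<in> space_of lie" for X Y
    unfolding lie_bracket_eq [OF that] using that by (intro ins_in_lie commutator_in_L lieD)
  moreover have "bracket X Y \<kappa> = commutator (X \<kappa>) (Y \<kappa>)" if "X \<in> space_of lie" "Y \<in> space_of lie" for X Y
    using lie_bracket_eq [OF that] by simp
  ultimately show ?thesis
    unfolding lie_algebra_iso_def
    using lie_algebra_g lie_algebra_lie lie_add lie_scl by (simp add: tangent_inclusion_char scale_lie plus_fun_def fun_diff_def)
qed

section \<open>The exponential map\<close>

lemma lcs_mfd_simps [simp]:
  "model (lcs_mfd E) = E" "mtop (lcs_mfd E) = top_of_set (space_of E)" "atlas (lcs_mfd E) = {(space_of E, \<lambda>x. x)}"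
  by (simp_all add: lcs_mfd_def)

lemma expc_chart:
  assumes "X \<in> space_of lie" shows "expc (X \<kappa>) \<in> G" "logc (expc (X \<kappa>)) = X \<kappa>"
  using lieD [OF assms] by (auto intro: expc_in_G logc_expc_L)

lemma inv_into_id: "x \<in> A \<Longrightarrow> inv_into A (\<lambda>x. x) x = x"
  by (intro inv_into_eqI [where g = "\<lambda>x. x"]) auto

text \<open>\<open>ex\<close> is prescribed on the Lie algebra only. The results then apply to every
  Lie group exponential map, once \<open>exponential_unique\<close> has identified its values
  there.\<close>

context
  fixes ex :: "(('h \<Rightarrow> 'b, 'h \<Rightarrow> 'b) chart \<Rightarrow> 'h \<Rightarrow> 'b) \<Rightarrow> 'h \<Rightarrow> 'b"
  assumes ex: "\<And>X. X \<in> space_of lie \<Longrightarrow> ex X = expc (X \<kappa>)"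
begin

lemma ex_homeomorphic_maps: "homeomorphic_maps (top_of_set (space_of lie)) (top_of_set G) ex (\<lambda>\<phi>. ins (logc \<phi>))"
proof -
  have "homeomorphic_maps (top_of_set (space_of lie)) (top_of_set G) (expc \<circ> (\<lambda>X. X \<kappa>)) (ins \<circ> logc)"
    by (rule homeomorphic_maps_compose
        [OF conjI [OF homeomorphic_maps_lie homeomorphic_maps_GL [THEN homeomorphic_maps_sym [THEN iffD1]]]])
  then show ?thesis by (rule homeomorphic_maps_eq) (auto simp: ex)
qed

lemma ex_image: "ex ` space_of lie = G"
  using homeomorphic_imp_surjective_map [OF homeomorphic_maps_imp_map [OF ex_homeomorphic_maps]] by simp

lemma ex_bij: "bij_betw ex (space_of lie) G"
  using homeomorphic_maps_imp_map [OF ex_homeomorphic_maps] ex_image homeomorphic_imp_injective_map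
  by (fastforce simp: bij_betw_def)

lemma ex_domain: "space_of lie \<inter> ex -` G = space_of lie"
  using ex_image by auto

lemma ex_local: "X \<in> space_of lie \<Longrightarrow> local_rep (space_of lie, \<lambda>x. x) \<kappa> ex X = X \<kappa>"
  by (simp add: local_rep_def inv_into_id ex expc_chart)

text \<open>In the chart \<open>logc\<close> the exponential map is evaluation at \<kappa>, which is
  linear.\<close>

lemma ex_analytic_smooth:
  "analytic_map_on lie g (space_of lie) (local_rep (space_of lie, \<lambda>x. x) \<kappa> ex)"
  "smooth_on lie g (space_of lie) (local_rep (space_of lie, \<lambda>x. x) \<kappa> ex)"
proof -
  have 1: "local_rep (space_of lie, \<lambda>x. x) \<kappa> ex X \<in> L" if "X \<in> space_of lie" for X
    using that by (simp add: ex_local lieD)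
  have 2: "\<exists>i a. \<forall>X\<in>space_of lie. fun_coord j (local_rep (space_of lie, \<lambda>x. x) \<kappa> ex X) = sB a (tan_coord i X)" for j
    by (rule exI [of _ "(\<kappa>, j)"], rule exI [of _ 1]) (simp add: ex_local fun_coord_def tan_coord_def)
  show "analytic_map_on lie g (space_of lie) (local_rep (space_of lie, \<lambda>x. x) \<kappa> ex)"
    "smooth_on lie g (space_of lie) (local_rep (space_of lie, \<lambda>x. x) \<kappa> ex)"
    by (rule ta.coordinatewise_linear_analytic [OF coord_system_lie coord_system_L], fact 1, fact 2)+
qed

lemma ex_continuous: "continuous_map (top_of_set (space_of lie)) (top_of_set G) ex"
  using ex_homeomorphic_maps by (simp add: homeomorphic_maps_def)

lemma ex_inverse: "\<phi> \<in> G \<Longrightarrow> inv_into (space_of lie) ex \<phi> = ins (logc \<phi>)"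
  by (rule inv_into_eqI [where g = "\<lambda>\<phi>. ins (logc \<phi>)"]) (auto simp: ex ins_eq logc_expc_L lieD ins_in_lie logc_in_L expc_logc_G)

lemma ex_diffeo: "analytic_diffeo (lcs_mfd lie) char_mfd ex"
proof -
  have "analytic_map (lcs_mfd lie) char_mfd ex"
    using ex_continuous ex_analytic_smooth(1) by (simp add: analytic_map_def ex_domain)
  moreover have "analytic_map char_mfd (lcs_mfd lie) (inv_into (space_of lie) ex)"
  proof -
    let ?f = "inv_into (space_of lie) ex"
    have "continuous_map (top_of_set G) (top_of_set (space_of lie)) (\<lambda>\<phi>. ins (logc \<phi>))"
      using ex_homeomorphic_maps by (simp add: homeomorphic_maps_def)
    then have "continuous_map (top_of_set G) (top_of_set (space_of lie)) ?f"
      by (rule continuous_map_eq) (simp add: ex_inverse)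
    moreover have "G \<inter> ?f -` space_of lie = G"
      by (auto simp: ex_inverse ins_in_lie logc_in_L)
    moreover have "analytic_map_on g lie L (local_rep \<kappa> (space_of lie, \<lambda>x. x) ?f)"
    proof (rule ta.coordinatewise_linear_analytic(1) [OF coord_system_L coord_system_lie])
      have *: "local_rep \<kappa> (space_of lie, \<lambda>x. x) ?f x = ins x" if "x \<in> L" for x
        using that by (simp add: local_rep_def inv_into_logc ex_inverse expc_in_G logc_expc_L)
      then show "local_rep \<kappa> (space_of lie, \<lambda>x. x) ?f x \<in> space_of lie" if "x \<in> L" for x
        using that by (simp add: ins_in_lie)
      show "\<exists>i a. \<forall>x\<in>L. tan_coord j (local_rep \<kappa> (space_of lie, \<lambda>x. x) ?f x) = sB a (fun_coord i x)" for j
        by (rule exI [of _ "snd j"], rule exI [of _ "if fst j = \<kappa> then 1 else 0"])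
          (simp add: * tan_coord_def fun_coord_def ins_def)
    qed
    ultimately show ?thesis by (simp add: analytic_map_def logc_image_G)
  qed
  ultimately show ?thesis using ex_bij by (simp add: analytic_diffeo_def)
qed

lemma ex_exponential: "lie_exponential CG char_mfd ex"
  unfolding lie_exponential_def CG_simps
proof (intro conjI ballI allI)
  show "smooth_map (lcs_mfd lie) char_mfd ex"
    using ex_continuous ex_analytic_smooth(2) by (simp add: smooth_map_def ex_domain)
  fix X c assume X: "X \<in> space_of lie"
  have e: "ex (scale lie a X) = expc (a \<cdot> X \<kappa>)" for a using ex [OF lie_scl [OF X]] by (simp add: scale_lie)
  show "ex (scale lie (of_real (u + v)) X) = convolution H (ex (scale lie (of_real u) X)) (ex (scale lie (of_real v) X))" for u v :: real
    unfolding e using expc_scl_add [OF L_aug [OF lieD [OF X]], of "of_real u" "of_real v"] by simp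
  assume "c \<in> charts_at char_mfd unit"
  then have c: "c = \<kappa>" by (simp add: charts_at_char G_unit)
  have l: "logc (expc (a \<cdot> X \<kappa>)) = a \<cdot> X \<kappa>" for a by (intro logc_expc_L L_scl lieD X)
  have "scale (model char_mfd) (of_real (inverse t)) (snd c (ex (scale lie (of_real t) X)) - snd c unit) = X c" if "t \<noteq> 0" for t :: real
    using that unfolding c e by (simp add: l logc_unit)
  then show "((\<lambda>t::real. scale (model char_mfd) (of_real (inverse t)) (snd c (ex (scale lie (of_real t) X)) - snd c unit)) \<longlongrightarrow> X c) (at 0)"
    using eventually_neq_at_within [of "0::real" 0 UNIV] by (intro tendsto_eventually) (auto elim: eventually_mono)
qed

end

lemma limit_unique_fun: "(f \<longlongrightarrow> (a :: 'h \<Rightarrow> 'b)) F \<Longrightarrow> (f \<longlongrightarrow> b) F \<Longrightarrow> F \<noteq> bot \<Longrightarrow> a = b"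
  by (rule ta.coord_limit_unique [OF coord_system_hom])

text \<open>A one-parameter group \<open>\<gamma>\<close> satisfies \<open>logc (\<gamma> 1) = n \<cdot> logc (\<gamma> (1/n))\<close>, and the right-hand side tends to
  the derivative of \<open>logc \<circ> \<gamma>\<close> at \<open>0\<close>.\<close>

lemma exponential_unique:
  assumes ex: "lie_exponential CG char_mfd ex" and X: "X \<in> space_of lie"
  shows "ex X = expc (X \<kappa>)"
proof -
  have "continuous_map (top_of_set (space_of lie)) (top_of_set G) ex"
    using ex by (simp add: lie_exponential_def smooth_map_def)
  then have exG: "ex Y \<in> G" if "Y \<in> space_of lie" for Y
    using that by (auto simp: image_subset_iff)
  define \<gamma> where "\<gamma> t = ex (scale lie (of_real t) X)" for t :: real
  have \<gamma>G: "\<gamma> t \<in> G" for t unfolding \<gamma>_def by (intro exG lie_scl X)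
  have add: "\<gamma> (u + v) = \<gamma> u \<star> \<gamma> v" for u v
    using ex X unfolding lie_exponential_def \<gamma>_def by simp
  have der: "((\<lambda>t. of_real (inverse t) \<cdot> (logc (\<gamma> t) - logc unit)) \<longlongrightarrow> X \<kappa>) (at 0)"
    using ex X unfolding lie_exponential_def \<gamma>_def by (simp add: charts_at_char G_unit)
  interpret CG: group CG by (rule group_G)
  have \<gamma>0: "\<gamma> 0 = unit"
  proof -
    have "\<gamma> 0 \<otimes>\<^bsub>CG\<^esub> \<gamma> 0 = \<gamma> 0" using add [of 0 0] by simp
    then have "\<gamma> 0 = \<one>\<^bsub>CG\<^esub>" using CG.l_cancel_one [OF \<gamma>G \<gamma>G, of 0 0] by blast
    then show ?thesis by simp
  qed
  have pow: "\<gamma> (real n * t) = cpow (\<gamma> t) n" for n t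
  proof (induction n)
    case (Suc n)
    have "\<gamma> (real (Suc n) * t) = \<gamma> (t + real n * t)" by (simp add: algebra_simps)
    then show ?case by (simp add: add Suc cpow_Suc)
  qed (simp add: \<gamma>0)
  have log: "logc (\<gamma> (real n * t)) = of_nat n \<cdot> logc (\<gamma> t)" for n t
  proof -
    have L: "logc (\<gamma> t) \<in> L" by (intro logc_in_L \<gamma>G)
    have "\<gamma> (real n * t) = expc (of_nat n \<cdot> logc (\<gamma> t))"
      using pow [of n t] cpow_expc [OF L_aug [OF L], of n] by (simp add: expc_logc_G \<gamma>G)
    then show ?thesis by (simp add: logc_expc_L L_scl L)
  qed
  have one: "\<gamma> 1 = ex X"
    using lie_eqI [OF lie_scl [OF X] X, of 1] by (simp add: \<gamma>_def scale_lie)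
  \<comment> \<open>The times 1/(n + 1) tend to 0 without ever being 0, as the punctured filter
    requires.\<close>
  have "filterlim (\<lambda>n. inverse (real (Suc n))) (at 0) sequentially"
    using LIMSEQ_inverse_real_of_nat by (simp add: filterlim_at)
  from filterlim_compose [OF der this]
  have "(\<lambda>n. of_real (real (Suc n)) \<cdot> (logc (\<gamma> (inverse (real (Suc n)))) - logc unit)) \<longlonglongrightarrow> X \<kappa>" by simp
  moreover have "of_real (real (Suc n)) \<cdot> (logc (\<gamma> (inverse (real (Suc n)))) - logc unit) = logc (ex X)" for n
    using log [of "Suc n" "inverse (real (Suc n))"] by (simp add: logc_unit one del: of_nat_Suc)
  ultimately have "(\<lambda>n. logc (ex X)) \<longlonglongrightarrow> X \<kappa>" by simp
  then have "logc (ex X) = X \<kappa>"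
    by (rule limit_unique_fun [OF tendsto_const]) simp
  then show ?thesis using expc_logc_G [OF exG [OF X]] by simp
qed

lemma open_submfd_self: "open_submfd (lcs_mfd E) (space_of E) = lcs_mfd E" "open_submfd char_mfd G = char_mfd"
  by (simp_all add: open_submfd_def lcs_mfd_def char_mfd_def subtopology_subtopology)

lemma bch_lie_group_char: "bch_lie_group CG char_mfd"
proof -
  define ex where "ex = (\<lambda>X :: ('h \<Rightarrow> 'b, 'h \<Rightarrow> 'b) chart \<Rightarrow> 'h \<Rightarrow> 'b. expc (X \<kappa>))"
  have e: "\<And>X. X \<in> space_of lie \<Longrightarrow> ex X = expc (X \<kappa>)" by (simp add: ex_def)
  show ?thesis
    unfolding bch_lie_group_def CG_simps
    using analytic_lie_group_char ex_exponential [where ex = ex, OF e] ex_diffeo [where ex = ex, OF e] lie_zero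
    by (intro conjI exI [of _ ex] exI [of _ "space_of lie"])
      (simp_all add: ex_image [where ex = ex, OF e] open_submfd_self)
qed

lemma sum_fun_apply: "(\<Sum>i\<in>A. f i) x = (\<Sum>i\<in>A. f i x :: 'b)"
  by (induction A rule: infinite_finite_induct) auto

text \<open>At each element \<open>x\<close> the partial sums are constant once n exceeds
  \<open>deg x\<close>.\<close>

lemma exp_series_sums:
  assumes "aug \<phi>" shows "exp_series_term H sB \<phi> sums expc \<phi>"
  unfolding sums_def tendsto_fun_iff
proof
  fix x
  have "\<forall>\<^sub>F n in sequentially. (\<Sum>k<n. exp_series_term H sB \<phi> k) x = expc \<phi> x"
    unfolding eventually_sequentially
  proof (intro exI allI impI)
    fix n assume "Suc (deg x) \<le> n"
    then obtain m where m: "n = Suc m" "deg x \<le> m" by (cases n) auto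
    show "(\<Sum>k<n. exp_series_term H sB \<phi> k) x = expc \<phi> x"
      unfolding m(1) lessThan_Suc_atMost expc_def ser_eq [OF assms m(2)] sum_fun_apply
      by (simp add: exp_series_term_def cpow_def field_simps)
  qed
  then show "(\<lambda>n. (\<Sum>k<n. exp_series_term H sB \<phi> k) x) \<longlonglongrightarrow> expc \<phi> x" by (rule tendsto_eventually)
qed

section \<open>Frechet and weakly complete model spaces\<close>

text \<open>Stated for an arbitrary topology \<open>X\<close>, since the domains below carry a
  metric topology or a product topology over an index set.\<close>

lemma continuous_map_plus:
  assumes "continuous_map X euclidean f" "continuous_map X euclidean (k :: _ \<Rightarrow> 'b)"
  shows "continuous_map X euclidean (\<lambda>x. f x + k x)"
proof -
  have "continuous_map X euclidean (\<lambda>x. (f x, k x))"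
    using continuous_map_pairedI [OF assms] by simp
  moreover have "continuous_map euclidean euclidean (\<lambda>(x, y). x + y :: 'b)" using ta.continuous_plus by simp
  ultimately have "continuous_map X euclidean ((\<lambda>(x, y). x + y) \<circ> (\<lambda>x. (f x, k x)))" by (rule continuous_map_compose)
  then show ?thesis by (simp add: o_def)
qed

lemma continuous_map_scl:
  assumes "continuous_map X euclidean f" shows "continuous_map X euclidean (\<lambda>x. sB c (f x))"
proof -
  have "continuous_map euclidean euclidean (sB c)"
    using continuous_on_scl [OF continuous_on_id, of UNIV c] by simp
  from continuous_map_compose [OF assms this] show ?thesis by (simp add: o_def)
qed

lemma continuous_map_finite_sum:
  assumes "\<And>i. i \<in> A \<Longrightarrow> continuous_map X euclidean (f i :: _ \<Rightarrow> 'b)"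
  shows "continuous_map X euclidean (\<lambda>x. \<Sum>i\<in>A. f i x)"
  using assms by (induction A rule: infinite_finite_induct) (auto intro: continuous_map_plus)

lemma vanish_on_span:
  assumes "lin \<phi>" "\<And>x. x \<in> S \<Longrightarrow> \<phi> x = 0" "x \<in> hs.span S"
  shows "\<phi> x = 0"
  using assms(3) by (induction rule: hs.span_induct_alt) (simp_all add: linear_0 [OF assms(1)] linD [OF assms(1)] assms(2))

text \<open>Spans the scalars together with the square of the augmentation ideal. Infinitesimal
  characters are thus the linear maps on the quotient, the space of indecomposables of H.\<close>

definition decomposables where "decomposables = insert 1 {a * b | a b. \<epsilon> a = 0 \<and> \<epsilon> b = 0}"

text \<open>Splitting off \<epsilon>(x) 1 and \<epsilon>(y) 1 reduces the defining identity to its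
  case for two elements of the augmentation ideal.\<close>

lemma L_iff_vanish: "\<phi> \<in> L \<longleftrightarrow> lin \<phi> \<and> (\<forall>x\<in>decomposables. \<phi> x = 0)"
proof (intro iffI conjI ballI)
  fix x assume "\<phi> \<in> L" "x \<in> decomposables"
  then show "\<phi> x = 0" using L_aug [of \<phi>] by (auto simp: decomposables_def L_iff)
next
  assume *: "lin \<phi> \<and> (\<forall>x\<in>decomposables. \<phi> x = 0)"
  then have l: "lin \<phi>" and 1: "\<phi> 1 = 0" by (auto simp: decomposables_def)
  have "\<phi> (x * y) = sB (\<epsilon> x) (\<phi> y) + sB (\<epsilon> y) (\<phi> x)" for x y
  proof -
    define x' y' where "x' = x - s (\<epsilon> x) 1" and "y' = y - s (\<epsilon> y) 1"
    have \<epsilon>0: "\<epsilon> (u - v) = \<epsilon> u - \<epsilon> v" for u v by (rule linear_diff [OF linear_counit])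
    have "\<epsilon> x' = 0" "\<epsilon> y' = 0" by (simp_all add: x'_def y'_def \<epsilon>0)
    then have p: "\<phi> (x' * y') = 0" using * by (auto simp: decomposables_def)
    have "x * y = s (\<epsilon> x) y + x' * y"
      by (simp add: x'_def left_diff_distrib s_mult(1) [symmetric])
    also have "x' * y = s (\<epsilon> y) x' + x' * y'"
      by (simp add: y'_def right_diff_distrib s_mult(2) [symmetric])
    finally have "x * y = s (\<epsilon> x) y + (s (\<epsilon> y) x' + x' * y')" .
    moreover have "\<phi> x' = \<phi> x" by (simp add: x'_def linear_diff [OF l] linD [OF l] 1)
    ultimately show ?thesis by (simp add: linD [OF l] p)
  qed
  then show "\<phi> \<in> L" using l by (simp add: L_iff)
qed (simp add: L_iff)

lemma lin_representation:
  assumes "lin \<phi>" "hs.independent B" "hs.span B = UNIV"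
  shows "\<phi> x = (\<Sum>b | hs.representation B x b \<noteq> 0. sB (hs.representation B x b) (\<phi> b))"
proof -
  have "x = (\<Sum>b | hs.representation B x b \<noteq> 0. s (hs.representation B x b) b)"
    using hs.sum_nonzero_representation_eq [OF assms(2), of x] assms(3) by simp
  then have "\<phi> x = \<phi> (\<Sum>b | hs.representation B x b \<noteq> 0. s (hs.representation B x b) b)" by simp
  then show ?thesis by (simp add: linear_sum [OF assms(1)] linD [OF assms(1)])
qed

text \<open>\<open>C\<close> completes a basis of the span of the decomposables to a basis of \<open>H\<close>, and \<open>X\<close> extends linearly by
  \<open>0\<close>: the infinitesimal characters are homeomorphic to the power of \<open>B\<close> with exponent \<open>C\<close>.\<close>

lemma free_coordinates:
  obtains C :: "'h set" and X :: "('h \<Rightarrow> 'b) \<Rightarrow> 'h \<Rightarrow> 'b" where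
    "\<And>f. X f \<in> L" "\<And>f c. c \<in> C \<Longrightarrow> X f c = f c" "\<And>\<phi> f. \<phi> \<in> L \<Longrightarrow> (\<And>c. c \<in> C \<Longrightarrow> f c = \<phi> c) \<Longrightarrow> X f = \<phi>"
    "\<And>x. \<exists>S r. finite S \<and> S \<subseteq> C \<and> (\<forall>f. X f x = (\<Sum>c\<in>S. sB (r c) (f c)))"
proof -
  obtain B0 where B0: "B0 \<subseteq> decomposables" "hs.independent B0" "decomposables \<subseteq> hs.span B0"
    using hs.maximal_independent_subset by blast
  obtain B where B: "B0 \<subseteq> B" "hs.independent B" "UNIV \<subseteq> hs.span B"
    using hs.maximal_independent_subset_extend [OF subset_UNIV B0(2)] by metis
  have sp: "hs.span B = UNIV" using B(3) by blast
  define C where "C = B - B0"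
  let ?r = "hs.representation B"
  define X where "X f x = (\<Sum>b | ?r x b \<noteq> 0. sB (?r x b) (if b \<in> C then f b else 0))" for f :: "'h \<Rightarrow> 'b" and x
  interpret p: vector_space_pair s sB
    using vector_space_s bs.vector_space_axioms by (simp add: vector_space_pair_def)
  have ext: "lin (X f) \<and> (\<forall>b\<in>B. X f b = (if b \<in> C then f b else 0))" for f
  proof -
    obtain \<phi> where \<phi>: "lin \<phi>" "\<forall>b\<in>B. \<phi> b = (if b \<in> C then f b else 0)"
      using p.linear_independent_extend [OF B(2), of "\<lambda>b. if b \<in> C then f b else 0"] by blast
    have "X f = \<phi>"
    proof
      fix x
      show "X f x = \<phi> x"
        unfolding X_def lin_representation [OF \<phi>(1) B(2) sp, of x]
        using hs.representation_ne_zero \<phi>(2) by (intro sum.cong) auto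
    qed
    then show ?thesis using \<phi> by simp
  qed
  have XL: "X f \<in> L" for f
    unfolding L_iff_vanish
  proof (intro conjI ballI)
    show l: "lin (X f)" using ext by blast
    fix x assume "x \<in> decomposables"
    then have "x \<in> hs.span B0" using B0 by blast
    then show "X f x = 0" by (rule vanish_on_span [OF l, rotated]) (use ext B(1) in \<open>auto simp: C_def\<close>)
  qed
  have XC: "X f c = f c" if "c \<in> C" for f c using ext that by (auto simp: C_def)
  have Xeq: "X f = \<phi>" if "\<phi> \<in> L" "\<And>c. c \<in> C \<Longrightarrow> f c = \<phi> c" for \<phi> f
  proof
    fix x
    have l: "lin \<phi>" using that by (simp add: L_iff)
    have "\<phi> b = 0" if "b \<in> B0" for b using \<open>\<phi> \<in> L\<close> B0(1) that by (auto simp: L_iff_vanish)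
    then show "X f x = \<phi> x"
      unfolding X_def lin_representation [OF l B(2) sp, of x]
      using hs.representation_ne_zero that(2) by (intro sum.cong) (auto simp: C_def)
  qed
  have Xsum: "\<exists>S r. finite S \<and> S \<subseteq> C \<and> (\<forall>f. X f x = (\<Sum>c\<in>S. sB (r c) (f c)))" for x
  proof (intro exI conjI allI)
    show "finite ({b. ?r x b \<noteq> 0} \<inter> C)" using hs.finite_representation by blast
    show "X f x = (\<Sum>c\<in>{b. ?r x b \<noteq> 0} \<inter> C. sB (?r x c) (f c))" for f
      unfolding X_def by (rule sum.mono_neutral_cong_right) (auto simp: hs.finite_representation)
  qed simp
  show thesis by (rule that [of X C]) (fact XL XC Xeq Xsum)+
qed

text \<open>\<open>L\<close> is a power of B with exponent \<open>C\<close>, and B is a power of the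
  field with exponent \<open>J\<close>; hence the coordinates are indexed by pairs from
  \<open>C \<times> J\<close>.\<close>

lemma weakly_complete_g:
  assumes "weakly_complete \<lparr>scale = sB, space_of = UNIV\<rparr>"
  shows "weakly_complete g"
proof -
  obtain J :: "('b \<Rightarrow> 'k) set" and T where
    T: "homeomorphic_map euclidean (product_topology (\<lambda>_. euclidean) J) T"
    and Tadd: "\<And>i x y. i \<in> J \<Longrightarrow> T (x + y) i = T x i + T y i" and Tscl: "\<And>i c x. i \<in> J \<Longrightarrow> T (sB c x) i = c * T x i"
    using assms unfolding weakly_complete_def by auto
  obtain Ti where Ti: "homeomorphic_maps euclidean (product_topology (\<lambda>_. euclidean) J) T Ti"
    using T by (auto simp: homeomorphic_map_maps)
  obtain C :: "'h set" and X :: "('h \<Rightarrow> 'b) \<Rightarrow> 'h \<Rightarrow> 'b" where X: "\<And>f. X f \<in> L" "\<And>f c. c \<in> C \<Longrightarrow> X f c = f c"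
    "\<And>\<phi> f. \<phi> \<in> L \<Longrightarrow> (\<And>c. c \<in> C \<Longrightarrow> f c = \<phi> c) \<Longrightarrow> X f = \<phi>"
    "\<And>x. \<exists>S r. finite S \<and> S \<subseteq> C \<and> (\<forall>f. X f x = (\<Sum>c\<in>S. sB (r c) (f c)))"
    by (rule free_coordinates) blast
  \<comment> \<open>\<open>weakly_complete\<close> asks for an index set of functionals, so the pair
    (c, j) is encoded as the coordinate functional it stands for. The coordinate map
    \<open>P\<close> is then plain evaluation.\<close>
  define \<iota> where "\<iota> c j = (\<lambda>\<phi>::'h \<Rightarrow> 'b. T (\<phi> c) j)" for c j
  define Idx where "Idx = (\<lambda>(c, j). \<iota> c j) ` (C \<times> J)"
  have \<iota>: "\<iota> c j \<in> Idx" if "c \<in> C" "j \<in> J" for c j using that by (auto simp: Idx_def)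
  define P where "P \<phi> = (\<lambda>i\<in>Idx. i \<phi>)" for \<phi> :: "'h \<Rightarrow> 'b"
  \<comment> \<open>The inverse recovers the values on \<open>C\<close> from their field coordinates
    and extends them by \<open>X\<close>.\<close>
  define Q where "Q z = X (\<lambda>c. Ti (\<lambda>j\<in>J. z (\<iota> c j)))" for z :: "(('h \<Rightarrow> 'b) \<Rightarrow> 'k) \<Rightarrow> 'k"
  have Tc: "continuous_map euclidean (product_topology (\<lambda>_. euclidean) J) T"
    and Tic: "continuous_map (product_topology (\<lambda>_. euclidean) J) euclidean Ti"
    and TiT: "\<And>b. Ti (T b) = b" and TTi: "\<And>y. y \<in> (\<Pi>\<^sub>E i\<in>J. UNIV) \<Longrightarrow> T (Ti y) = y"
    using Ti by (auto simp: homeomorphic_maps_def)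
  have Text: "(\<lambda>j\<in>J. T b j) = T b" for b
  proof -
    have "T b \<in> (\<Pi>\<^sub>E i\<in>J. UNIV)"
      using continuous_map_image_subset_topspace [OF Tc] by (simp add: image_subset_iff)
    then show ?thesis by (simp add: PiE_restrict)
  qed
  have "homeomorphic_maps (top_of_set L) (product_topology (\<lambda>_. euclidean) Idx) P Q"
    unfolding homeomorphic_maps_def
  proof (intro conjI ballI)
    have "continuous_map (top_of_set L) euclidean i" if iI: "i \<in> Idx" for i
    proof -
      obtain c j where i: "i = (\<lambda>\<phi>. T (\<phi> c) j)" "j \<in> J" using iI by (auto simp: Idx_def \<iota>_def)
      have "continuous_map euclidean euclidean (\<lambda>b. T b j)"
        using Tc i(2) by (simp add: continuous_map_componentwise)
      moreover have "continuous_map (top_of_set L) euclidean (\<lambda>\<phi>. \<phi> c)"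
        using continuous_on_subset [OF continuous_eval subset_UNIV] by simp
      ultimately have "continuous_map (top_of_set L) euclidean ((\<lambda>b. T b j) \<circ> (\<lambda>\<phi>. \<phi> c))"
        by (rule continuous_map_compose [rotated])
      then show ?thesis unfolding i by (simp add: o_def)
    qed
    then show "continuous_map (top_of_set L) (product_topology (\<lambda>_. euclidean) Idx) P"
      by (simp add: continuous_map_componentwise P_def image_subset_iff cong: restrict_cong)
    \<comment> \<open>The value at a fixed \<open>x\<close> involves only finitely many elements of
      \<open>C\<close>.\<close>
    have "continuous_map (product_topology (\<lambda>_. euclidean) Idx) euclidean (\<lambda>z. Q z x)" for x
    proof -
      from X(4) [of x] obtain S r where S: "finite S" "S \<subseteq> C" "\<And>f. X f x = (\<Sum>c\<in>S. sB (r c) (f c))" by blast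
      have "continuous_map (product_topology (\<lambda>_. euclidean) Idx) euclidean (\<lambda>z. Ti (\<lambda>j\<in>J. z (\<iota> c j)))" if "c \<in> C" for c
      proof -
        have "continuous_map (product_topology (\<lambda>_. euclidean) Idx) (product_topology (\<lambda>_. euclidean) J) (\<lambda>z. \<lambda>j\<in>J. z (\<iota> c j))"
          using \<iota> [OF that] by (auto simp: continuous_map_componentwise intro: continuous_map_product_projection)
        from continuous_map_compose [OF this Tic] show ?thesis by (simp add: o_def)
      qed
      then show ?thesis unfolding Q_def S(3) using S(2) by (intro continuous_map_finite_sum continuous_map_scl) auto
    qed
    then have "continuous_map (product_topology (\<lambda>_. euclidean) Idx) euclidean Q"
      unfolding euclidean_product_topology [symmetric] by (simp add: continuous_map_componentwise)
    then show "continuous_map (product_topology (\<lambda>_. euclidean) Idx) (top_of_set L) Q"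
      by (auto simp: continuous_map_in_subtopology Q_def X(1))
    show "Q (P \<phi>) = \<phi>" if "\<phi> \<in> topspace (top_of_set L)" for \<phi>
      unfolding Q_def
    proof (rule X(3))
      show "\<phi> \<in> L" using that by simp
      fix c assume "c \<in> C"
      then have "(\<lambda>j\<in>J. P \<phi> (\<iota> c j)) = (\<lambda>j\<in>J. T (\<phi> c) j)" using \<iota> by (auto simp: P_def \<iota>_def)
      then show "Ti (\<lambda>j\<in>J. P \<phi> (\<iota> c j)) = \<phi> c" by (simp only: Text TiT)
    qed
    show "P (Q z) = z" if "z \<in> topspace (product_topology (\<lambda>_. euclidean) Idx)" for z
    proof
      fix i
      show "P (Q z) i = z i"
      proof (cases "i \<in> Idx")
        case True
        then obtain c j where i: "i = \<iota> c j" "c \<in> C" "j \<in> J" by (auto simp: Idx_def)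
        have "T (Ti (\<lambda>j\<in>J. z (\<iota> c j))) j = z (\<iota> c j)" using i(3) by (simp add: TTi)
        then show ?thesis using True i by (simp add: P_def Q_def X(2) \<iota>_def [of c j])
      next
        case False
        then show ?thesis using that by (auto simp: P_def PiE_def extensional_def)
      qed
    qed
  qed
  then have "homeomorphic_map (top_of_set L) (product_topology (\<lambda>_. euclidean) Idx) P"
    by (rule homeomorphic_maps_imp_map)
  moreover have "P (x + y) i = P x i + P y i" "P (scale g c x) i = c * P x i" if "i \<in> Idx" for i x y c
    using that Tadd Tscl by (auto simp: P_def Idx_def \<iota>_def)
  ultimately show ?thesis
    unfolding weakly_complete_def using locally_convex_L by blast
qed

text \<open>On \<open>L\<close>, pointwise convergence is convergence on a countable spanning set,
  and the resulting countably many copies of the complete invariant metric of B combine into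
  one.\<close>

lemma frechet_g:
  assumes cd: "countable_dimension (hscale H)" and fr: "frechet_space \<lparr>scale = sB, space_of = UNIV\<rparr>"
  shows "frechet_space g"
proof -
  obtain b where b: "countable b" "hs.span b = UNIV"
    using cd unfolding countable_dimension_def by blast
  \<comment> \<open>Nonemptiness, due to 1 not being 0, allows an enumeration by all natural
    numbers; it may have repetitions, which covers finite dimension.\<close>
  have "b \<noteq> {}" using b(2) one_neq_zero [where 'a = 'h] by (metis UNIV_I empty_iff hs.span_empty insert_iff)
  then obtain e :: "nat \<Rightarrow> 'h" where e: "range e = b" using b(1) by (metis range_from_nat_into)
  obtain dB :: "'b \<Rightarrow> 'b \<Rightarrow> real" where MB: "Metric_space UNIV dB" and top: "Metric_space.mtopology UNIV dB = euclidean"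
    and cpl: "Metric_space.mcomplete UNIV dB" and inv: "\<And>x y z. dB (x + z) (y + z) = dB x y"
    using fr unfolding frechet_space_def by auto
  interpret MB: Metric_space UNIV dB by (rule MB)
  \<comment> \<open>The cutoffs tend to 0, so a ball constrains only finitely many indices; each of
    them is positive, so a small distance still controls the value at every single
    \<open>e n\<close>.\<close>
  define \<delta> where "\<delta> n \<phi> \<psi> = min (inverse (real (Suc n))) (dB (\<phi> (e n)) (\<psi> (e n)))" for n \<phi> \<psi>
  define d where "d \<phi> \<psi> = (SUP n. \<delta> n \<phi> \<psi>)" for \<phi> \<psi> :: "'h \<Rightarrow> 'b"
  have \<delta>1: "\<delta> n \<phi> \<psi> \<le> 1" "0 \<le> \<delta> n \<phi> \<psi>" for n \<phi> \<psi>
  proof -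
    have "inverse (real (Suc n)) \<le> 1" by (simp add: inverse_le_1_iff)
    then show "\<delta> n \<phi> \<psi> \<le> 1" "0 \<le> \<delta> n \<phi> \<psi>" unfolding \<delta>_def by (simp_all add: min_le_iff_disj)
  qed
  have up: "\<delta> n \<phi> \<psi> \<le> d \<phi> \<psi>" for n \<phi> \<psi>
    unfolding d_def using \<delta>1(1) by (intro cSUP_upper) (auto intro!: bdd_aboveI [of _ 1])
  have least: "d \<phi> \<psi> \<le> r" if "\<And>n. \<delta> n \<phi> \<psi> \<le> r" for \<phi> \<psi> r
    unfolding d_def using that by (intro cSUP_least) auto
  interpret M: Metric_space L d
  proof
    show "0 \<le> d \<phi> \<psi>" for \<phi> \<psi> using up [of 0 \<phi> \<psi>] \<delta>1(2) [of 0 \<phi> \<psi>] by linarith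
    show "d \<phi> \<psi> = d \<psi> \<phi>" for \<phi> \<psi> by (simp add: d_def \<delta>_def MB.commute)
    show "d \<phi> \<psi> = 0 \<longleftrightarrow> \<phi> = \<psi>" if "\<phi> \<in> L" "\<psi> \<in> L" for \<phi> \<psi>
    proof
      assume "d \<phi> \<psi> = 0"
      then have \<delta>0: "\<delta> n \<phi> \<psi> = 0" for n using up [of n \<phi> \<psi>] \<delta>1(2) [of n \<phi> \<psi>] by linarith
      have z: "dB (\<phi> (e n)) (\<psi> (e n)) = 0" for n
      proof -
        have "min (inverse (real (Suc n))) (dB (\<phi> (e n)) (\<psi> (e n))) = 0" "0 < inverse (real (Suc n))"
          using \<delta>0 [of n] by (simp_all add: \<delta>_def)
        then show ?thesis by linarith
      qed
      have "(\<phi> - \<psi>) x = 0" for x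
      proof (rule vanish_on_span)
        show "lin (\<phi> - \<psi>)" using that by (simp add: L_iff lin_diff)
        show "x \<in> hs.span b" by (simp add: b)
        show "(\<phi> - \<psi>) x = 0" if "x \<in> b" for x using z that by (auto simp: e [symmetric])
      qed
      then show "\<phi> = \<psi>" by (auto simp: fun_eq_iff)
    qed (simp add: d_def \<delta>_def)
    show "d \<phi> \<theta> \<le> d \<phi> \<psi> + d \<psi> \<theta>" for \<phi> \<psi> \<theta>
    proof (rule least)
      fix n
      have "dB (\<phi> (e n)) (\<theta> (e n)) \<le> dB (\<phi> (e n)) (\<psi> (e n)) + dB (\<psi> (e n)) (\<theta> (e n))" by (simp add: MB.triangle)
      moreover have "0 \<le> dB (\<phi> (e n)) (\<psi> (e n))" "0 \<le> dB (\<psi> (e n)) (\<theta> (e n))" by simp_all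
      moreover have "0 \<le> inverse (real (Suc n))" by simp
      ultimately have "\<delta> n \<phi> \<theta> \<le> \<delta> n \<phi> \<psi> + \<delta> n \<psi> \<theta>" unfolding \<delta>_def by linarith
      then show "\<delta> n \<phi> \<theta> \<le> d \<phi> \<psi> + d \<psi> \<theta>" using up [of n \<phi> \<psi>] up [of n \<psi> \<theta>] by linarith
    qed
  qed
  have cont: "continuous_map M.mtopology euclidean (\<lambda>\<phi>. \<phi> (e n) :: 'b)" for n
    unfolding top [symmetric]
  proof (rule M.metric_continuous_map [OF MB, THEN iffD2], intro conjI ballI allI impI)
    fix \<phi> r assume "\<phi> \<in> L" "0 < (r::real)"
    show "\<exists>q>0. \<forall>\<psi>. \<psi> \<in> L \<and> d \<phi> \<psi> < q \<longrightarrow> dB (\<phi> (e n)) (\<psi> (e n)) < r"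
    \<comment> \<open>Below its cutoff the minimum defining \<delta> is the distance in B.\<close>
    proof (intro exI [of _ "min r (inverse (real (Suc n)))"] conjI allI impI)
      show "0 < min r (inverse (real (Suc n)))" using \<open>0 < r\<close> by simp
      fix \<psi> assume "\<psi> \<in> L \<and> d \<phi> \<psi> < min r (inverse (real (Suc n)))"
      then have "\<delta> n \<phi> \<psi> < min r (inverse (real (Suc n)))" using up [of n \<phi> \<psi>] by linarith
      then show "dB (\<phi> (e n)) (\<psi> (e n)) < r" by (auto simp: \<delta>_def)
    qed
  qed simp
  have span_e: "x \<in> hs.span (range e)" for x by (simp add: e b)
  have contL: "continuous_map M.mtopology euclidean (\<lambda>\<phi>. \<phi> x :: 'b)" for x
    using span_e [of x]
  proof (induction rule: hs.span_induct_alt)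
    case base
    have "continuous_map M.mtopology euclidean (\<lambda>\<phi>. 0 :: 'b)" by simp
    then show ?case by (rule continuous_map_eq) (auto simp: L_iff linear_0 [of s sB])
  next
    case (step c v y)
    then have "continuous_map M.mtopology euclidean (\<lambda>\<phi>. sB c (\<phi> v) + \<phi> y)"
      by (intro continuous_map_plus continuous_map_scl) (auto simp: cont)
    then show ?case by (rule continuous_map_eq) (simp add: L_iff linD)
  qed
  have "continuous_map M.mtopology (top_of_set L) (\<lambda>\<phi>. \<phi>)"
    using contL unfolding continuous_map_in_subtopology
    by (auto simp: euclidean_product_topology [symmetric] continuous_map_componentwise)
  moreover have "continuous_map (top_of_set L) M.mtopology (\<lambda>\<phi>. \<phi>)"
    unfolding M.continuous_map_to_metric
  proof (intro ballI allI impI)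
    fix \<phi> and r :: real assume \<phi>: "\<phi> \<in> topspace (top_of_set L)" and r: "0 < r"
    \<comment> \<open>Beyond N the cutoffs alone are below r / 2. Half the radius is used because a
      supremum inherits only the weak inequality.\<close>
    obtain N where N: "inverse (real (Suc N)) < r / 2" using reals_Archimedean [of "r / 2"] r by auto
    define W where "W = {\<psi>. \<forall>n\<le>N. \<psi> (e n) \<in> MB.mball (\<phi> (e n)) (r / 2)}"
    have "open W"
    proof -
      have "W = (\<Inter>n\<le>N. (\<lambda>\<psi>. \<psi> (e n)) -` MB.mball (\<phi> (e n)) (r / 2))" by (auto simp: W_def)
      moreover have "open (MB.mball (\<phi> (e n)) (r / 2))" for n
        using MB.openin_mball [of "\<phi> (e n)" "r / 2"] by (simp add: top)
      then have "open ((\<lambda>\<psi>. \<psi> (e n)) -` MB.mball (\<phi> (e n)) (r / 2))" for n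
        by (rule open_vimage) (rule continuous_eval)
      ultimately show ?thesis by (auto intro!: open_INT)
    qed
    then have "openin (top_of_set L) (L \<inter> W)" by (rule openin_open_Int)
    moreover have "\<phi> \<in> L \<inter> W" using \<phi> r by (simp add: W_def)
    moreover have "\<psi> \<in> M.mball \<phi> r" if "\<psi> \<in> L \<inter> W" for \<psi>
    proof -
      have "d \<phi> \<psi> \<le> r / 2"
      proof (rule least)
        fix n
        show "\<delta> n \<phi> \<psi> \<le> r / 2"
        proof (cases "n \<le> N")
          case True
          then have "dB (\<phi> (e n)) (\<psi> (e n)) < r / 2" using that by (auto simp: W_def)
          then show ?thesis by (auto simp: \<delta>_def)
        next
          case False
          then have "inverse (real (Suc n)) \<le> inverse (real (Suc N))" by (intro le_imp_inverse_le) auto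
          then show ?thesis using N unfolding \<delta>_def by linarith
        qed
      qed
      then show ?thesis using that \<phi> r by simp
    qed
    ultimately show "\<exists>U. openin (top_of_set L) U \<and> \<phi> \<in> U \<and> (\<forall>\<psi>\<in>U. \<psi> \<in> M.mball \<phi> r)" by blast
  qed
  \<comment> \<open>The identity is continuous in both directions, so the two topologies have the
    same open sets.\<close>
  ultimately have "openin M.mtopology S \<longleftrightarrow> openin (top_of_set L) S" for S
    using openin_continuous_map_preimage [of M.mtopology "top_of_set L" "\<lambda>\<phi>. \<phi>" S]
      openin_continuous_map_preimage [of "top_of_set L" M.mtopology "\<lambda>\<phi>. \<phi>" S]
      openin_subset [of M.mtopology S] openin_subset [of "top_of_set L" S]
    by (auto simp: Int_absorb1 Collect_conj_eq)
  then have mtop: "M.mtopology = top_of_set L" by (simp add: topology_eq)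
  have "M.mcomplete"
    unfolding M.mcomplete_def
  proof (intro allI impI)
    fix \<sigma> assume \<sigma>: "M.MCauchy \<sigma>"
    have \<sigma>L: "\<sigma> k \<in> L" for k using \<sigma> by (auto simp: M.MCauchy_def)
    have ce: "\<exists>l. (\<lambda>k. \<sigma> k (e n)) \<longlonglongrightarrow> l" for n
    proof -
      have "MB.MCauchy (\<lambda>k. \<sigma> k (e n))"
        unfolding MB.MCauchy_def
      proof (intro conjI allI impI)
        fix r :: real assume r: "0 < r"
        then obtain N where N: "\<forall>k k'. N \<le> k \<longrightarrow> N \<le> k' \<longrightarrow> d (\<sigma> k) (\<sigma> k') < min r (inverse (real (Suc n)))"
          using \<sigma> unfolding M.MCauchy_def by (meson inverse_positive_iff_positive min_less_iff_conj of_nat_0_less_iff zero_less_Suc)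
        have "dB (\<sigma> k (e n)) (\<sigma> k' (e n)) < r" if "N \<le> k" "N \<le> k'" for k k'
        proof -
          have "\<delta> n (\<sigma> k) (\<sigma> k') < min r (inverse (real (Suc n)))"
            using N that up [of n "\<sigma> k" "\<sigma> k'"] le_less_trans by blast
          then show ?thesis unfolding \<delta>_def by linarith
        qed
        then show "\<exists>N. \<forall>k k'. N \<le> k \<longrightarrow> N \<le> k' \<longrightarrow> dB (\<sigma> k (e n)) (\<sigma> k' (e n)) < r"
          by blast
      qed simp
      then show ?thesis using cpl unfolding MB.mcomplete_def top by (simp add: limitin_canonical_iff)
    qed
    \<comment> \<open>Convergence passes from the spanning set to all of H by linearity of the
      members of the sequence.\<close>
    have "\<exists>l. (\<lambda>k. \<sigma> k x) \<longlonglongrightarrow> l" for x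
      using span_e [of x]
    proof (induction rule: hs.span_induct_alt)
      case base
      have "\<sigma> k 0 = 0" for k using \<sigma>L [of k] by (auto simp: L_iff linear_0 [of s sB])
      then show ?case by auto
    next
      case (step c v y)
      then obtain l l' where "(\<lambda>k. \<sigma> k v) \<longlonglongrightarrow> l" "(\<lambda>k. \<sigma> k y) \<longlonglongrightarrow> l'" using ce by blast
      then have "(\<lambda>k. sB c (\<sigma> k v) + \<sigma> k y) \<longlonglongrightarrow> sB c l + l'"
        by (intro ta.tendsto_plus ta.tendsto_scl tendsto_const)
      moreover have "\<sigma> k (s c v + y) = sB c (\<sigma> k v) + \<sigma> k y" for k using \<sigma>L [of k] by (simp add: L_iff linD)
      ultimately show ?case by auto
    qed
    then obtain \<phi> where "\<And>x. (\<lambda>k. \<sigma> k x) \<longlonglongrightarrow> \<phi> x" by metis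
    then have lim: "\<sigma> \<longlonglongrightarrow> \<phi>" by (simp add: tendsto_fun_iff)
    have "\<phi> \<in> L" by (rule Lim_in_closed_set [OF closed_L _ _ lim]) (simp_all add: \<sigma>L)
    then have "limitin M.mtopology \<sigma> \<phi> sequentially"
      using lim \<sigma>L by (simp add: mtop limitin_subtopology limitin_canonical_iff)
    then show "\<exists>\<phi>. limitin M.mtopology \<sigma> \<phi> sequentially" by blast
  qed
  moreover have "d (x + z) (y + z) = d x y" for x y z by (simp add: d_def \<delta>_def inv)
  ultimately show ?thesis
    unfolding frechet_space_def using locally_convex_L M.Metric_space_axioms mtop by blast
qed

end

theorem theorem2p7:
  fixes H :: "('k::real_or_complex, 'h::ring_1) hopf"
    and V :: "nat \<Rightarrow> 'h set"
    and sB :: "'k \<Rightarrow> 'b::{comm_ring, comm_monoid_mult, topological_space} \<Rightarrow> 'b"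
  assumes "graded_connected_hopf_algebra H V"
    and "comm_locally_convex_algebra sB"
  shows
    "\<exists>M :: ('k, 'h \<Rightarrow> 'b, 'h \<Rightarrow> 'b) mfd.
       analytic_submanifold (unital_hom_mfd H sB) (carrier (character_group H sB)) (inf_characters H sB) M \<and>
       analytic_lie_group (character_group H sB) M \<and>
       lie_algebra_iso
         (lie_space (character_group H sB) M)
         (lie_bracket (character_group H sB) M)
         (inf_characters H sB)
         (\<lambda>\<phi> \<psi>. convolution H \<phi> \<psi> - convolution H \<psi> \<phi>)
         (tangent_inclusion M (hom_lcs H sB) (conv_unit H sB)) \<and>
       bch_lie_group (character_group H sB) M \<and>
       (\<forall>ex. lie_exponential (character_group H sB) M ex \<longrightarrow>
          analytic_diffeo (lcs_mfd (lie_space (character_group H sB) M)) M ex \<and>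
          (\<forall>X\<in>space_of (lie_space (character_group H sB) M).
             exp_series_term H sB (tangent_inclusion M (hom_lcs H sB) (conv_unit H sB) X) sums ex X)) \<and>
       (countable_dimension (hscale H) \<and> frechet_space \<lparr>scale = sB, space_of = UNIV\<rparr> \<longrightarrow>
          frechet_space (model M)) \<and>
       (weakly_complete \<lparr>scale = sB, space_of = UNIV\<rparr> \<longrightarrow> weakly_complete (model M))"
proof -
  interpret character_lie_group H V sB
    by unfold_locales (use assms in auto)
  \<comment> \<open>An arbitrary exponential map is reduced to \<open>expc\<close> by
    \<open>exponential_unique\<close>.\<close>
  have ex: "analytic_diffeo (lcs_mfd lie) char_mfd ex \<and>
      (\<forall>X\<in>space_of lie. exp_series_term H sB (tangent_inclusion char_mfd (hom_lcs H sB) unit X) sums ex X)"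
    if "lie_exponential CG char_mfd ex" for ex
    using ex_diffeo [where ex = ex, OF exponential_unique [OF that]] exponential_unique [OF that]
    by (simp add: tangent_inclusion_char exp_series_sums L_aug lieD)
  show ?thesis
    using analytic_submanifold_char analytic_lie_group_char lie_algebra_iso_char bch_lie_group_char ex frechet_g weakly_complete_g
    by (intro exI [of _ char_mfd]) simp
qed

end
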